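(* Let $G$ be the simply connected 6-dimensional nilpotent Lie group whose left-invariant coframe $e^1,\dots,e^6$ satisfies $de^1=de^2=de^3=de^5=0$, $de^4=e^{15}$, $de^6=e^{13}$, with left-invariant symplectic form $\omega=e^{12}+e^{34}+e^{56}$. Let $\varphi$ be a left-invariant primitive 3-form on $G$, written as $$\varphi=Ae^{135}+Be^{136}+Ce^{145}+De^{146}+Ee^{235}+Fe^{236}+Ge^{245}+He^{246}+(Ie^1+Je^2)(e^{34}-e^{56})+(Ke^3+Le^4)(e^{12}-e^{56})+(Me^5+Ne^6)(e^{12}-e^{34})$$ with constants $A,\dots,N$, and let $\hat H$ denote the coefficient of $e^{246}$ in $-\frac12F(\varphi)$. Then: 1. $\varphi$ is integrable ($d\varphi=0$) if and only if $H=J=L=N=0$. 2. $\varphi$ is a stationary point of the Type IIA flow $\partial_t\varphi=d\Lambda_\omega dF(\varphi)$ if and only if $\hat H=0$. 3. $\varphi$ is an integrable stationary point of the Type IIA flow if and only if $H=J=L=N=0$ and $\hat H=-2DFG=0$. In this case $$\frac{Q(\varphi)}{4}=2(B^2G^2+C^2F^2+D^2E^2)-(BG+CF+DE)^2+4(I^2FG+K^2DG+M^2DF),$$ which can be of any sign. When $Q(\varphi)$ is negative, $\varphi$ belongs to an orbit $\mathcal{O}_-^-(\mu)$, hence the associated metric $q(\omega,\varphi)$ must have signature $(2,4)$ (two positive and four negative directions). 4. $\varphi$ is integrable and $F$-integrable ($d\varphi=0$ and $dF(\varphi)=0$) if and only if $H=J=L=N=0$ and $DFG=DKG=DFM=IFG=0$.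 In this case $$\frac{Q(\varphi)}{4}=2(B^2G^2+C^2F^2+D^2E^2)-(BG+CF+DE)^2\geq0$$ since $DFG=0$. As a consequence, there exist left-invariant integrable and $F$-integrable forms from any of the orbits $\mathcal{O}_+(\mu)$, $\mathcal{O}_0^\pm$, $\mathcal{O}_1^\pm$, $\mathcal{O}_3\cap\bigwedge^3_0V^*$ and $\mathcal{O}_6=\{0\}$. In particular, there exist para-Kähler Calabi-Yau structures on the associated nilmanifolds.
   Context: Notation: $e^{ij}=e^i\wedge e^j$, $e^{ijk}=e^i\wedge e^j\wedge e^k$; products such as $e^1(e^{34}-e^{56})$ are wedge products; $\Lambda_\omega$ is the Lefschetz operator of contraction with $\omega$. A 3-form is primitive if $\omega\wedge\varphi=0$; the displayed expression is the general left-invariant primitive 3-form. The coefficients $F,K$ in the expression for $\varphi$ are constants, not to be confused with the following: $K(\varphi)\in\mathrm{End}\,TG$ is defined by $\iota_{K(\varphi)X}\frac{\omega^3}{3!}=-\iota_X\varphi\wedge\varphi$; the 3-form $F(\varphi)$ by $F(\varphi)(X,Y,Z)=-2\varphi(K(\varphi)X,Y,Z)$; the number $Q(\varphi)$ by $\varphi\wedge F(\varphi)=-Q(\varphi)\frac{\omega^3}{3!}$; and $q(\omega,\varphi)(v_1,v_2)=\omega(v_1,K(\varphi)v_2)$, a symmetric bilinear form. Let $V$ be the Lie algebra of $G$ and $\bigwedge^3_0V^*$ the space of primitive 3-forms on $V$. The $\mathrm{Sp}(V,\omega)$-orbits are represented by the following normal forms, in a basis $f^i$ of $V^*$ with $\omega=f^{12}+f^{34}+f^{56}$: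 $\mathcal{O}_-^\pm(\mu)$: $\mu(f^{135}-f^{146}\mp f^{236}\mp f^{245})$; $\mathcal{O}_+(\mu)$: $\mu(f^{135}+f^{246})$, with $\mu>0$; $\mathcal{O}_0^\pm$: $f^{146}\pm f^{236}\pm f^{245}$; $\mathcal{O}_1^\pm$: $(f^{13}\mp f^{24})\wedge f^5$; $\mathcal{O}_3\cap\bigwedge_0^3V^*$: $f^{135}$; $\mathcal{O}_6$: $0$. The associated nilmanifolds are the quotients of $G$ by cocompact discrete subgroups. A para-Kähler Calabi-Yau structure here means a symplectic form $\omega$ together with a primitive 3-form $\varphi$ lying pointwise in an orbit $\mathcal{O}_+(\mu)$ with $d\varphi=0$ and $dF(\varphi)=0$. *)

theory Defs
  imports
    "HOL-Analysis.Analysis"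
    "HOL-Algebra.Coset"
    "HOL-Library.Function_Algebras"
begin

section \<open>Exterior algebra of a Euclidean space\<close>

text \<open>
  A form on \<open>V\<close> is a real function on lists of vectors; a form of degree \<open>k\<close> vanishes on all
  lists whose length is not \<open>k\<close>, so equations between forms are equations of functions.
  Sums, differences and \<open>0\<close> are pointwise (\<^theory>\<open>HOL-Library.Function_Algebras\<close>).
\<close>

type_synonym 'v form = "'v list \<Rightarrow> real"

definition alternating_form :: "nat \<Rightarrow> 'v::real_vector form \<Rightarrow> bool" where
  "alternating_form k \<alpha> \<longleftrightarrow>
     (\<forall>vs. length vs \<noteq> k \<longrightarrow> \<alpha> vs = 0) \<and>
     (\<forall>vs i. length vs = k \<longrightarrow> i < k \<longrightarrow> linear (\<lambda>v. \<alpha> (vs[i := v]))) \<and>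
     (\<forall>vs i j. length vs = k \<longrightarrow> i < j \<longrightarrow> j < k \<longrightarrow> vs ! i = vs ! j \<longrightarrow> \<alpha> vs = 0)"

definition form_scale :: "real \<Rightarrow> 'v form \<Rightarrow> 'v form"  (infixr "*\<^sub>F" 75) where
  "c *\<^sub>F \<alpha> = (\<lambda>vs. c * \<alpha> vs)"

text \<open>
  The sign of the shuffle which moves the positions in \<open>S\<close> in front of the positions of
  \<open>{..<n}\<close> outside \<open>S\<close>. With it, the wedge product is
  \<open>(\<alpha> \<and> \<beta>)(v\<^sub>1, \<dots>, v\<^sub>p\<^sub>+\<^sub>q) = \<Sum> sgn(\<sigma>) \<alpha>(v\<^bsub>\<sigma>(1)\<^esub>, \<dots>) \<beta>(v\<^bsub>\<sigma>(p+1)\<^esub>, \<dots>)\<close>, the sum being over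
  the \<open>(p, q)\<close>-shuffles; subsets of the wrong cardinality contribute \<open>0\<close>. In this normalisation
  \<open>(\<alpha> \<and> \<beta>)(v, w) = \<alpha>(v) \<beta>(w) - \<alpha>(w) \<beta>(v)\<close> for 1-forms.
\<close>

definition shuffle_sign :: "nat \<Rightarrow> nat set \<Rightarrow> real" where
  "shuffle_sign n S = (- 1) ^ card {(i, j). i \<in> S \<and> j \<in> {..<n} - S \<and> j < i}"

definition wedge :: "'v form \<Rightarrow> 'v form \<Rightarrow> 'v form"  (infixr "\<^bold>\<and>" 70) where
  "(\<alpha> \<^bold>\<and> \<beta>) vs =
     (\<Sum>S\<in>Pow {..<length vs}. shuffle_sign (length vs) S * \<alpha> (nths vs S) * \<beta> (nths vs (- S)))"

definition interior_product :: "'v \<Rightarrow> 'v form \<Rightarrow> 'v form" where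
  "interior_product X \<alpha> = (\<lambda>vs. \<alpha> (X # vs))"

text \<open>
  Contraction with \<open>\<omega>\<close>: if \<open>b\<^sub>j\<close> is a basis and \<open>w\<^sub>j\<close> the vectors with
  \<open>\<omega>(b\<^sub>i, w\<^sub>j) = \<delta>\<^sub>i\<^sub>j\<close>, then \<open>\<Lambda>\<^sub>\<omega> \<beta> = 1/2 \<Sum>\<^sub>j \<beta>(b\<^sub>j, w\<^sub>j, \<dots>)\<close>. In a symplectic basis
  (\<open>\<omega>(a\<^sub>i, b\<^sub>i) = 1\<close>) this is \<open>\<Sum>\<^sub>i \<beta>(a\<^sub>i, b\<^sub>i, \<dots>)\<close>, so that \<open>\<Lambda>\<^sub>\<omega> \<omega> = n\<close> in dimension \<open>2n\<close>.
\<close>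

definition lefschetz :: "'v::euclidean_space form \<Rightarrow> 'v form \<Rightarrow> 'v form" where
  "lefschetz \<omega> \<beta> = (\<lambda>vs. 1/2 * (\<Sum>b\<in>Basis. \<beta> (b # (THE w. \<forall>v. \<omega> [v, w] = v \<bullet> b) # vs)))"


section \<open>Algebra of 3-forms on a 6-dimensional symplectic vector space\<close>

definition volume :: "'v form \<Rightarrow> 'v form" where
  "volume \<omega> = (1 / fact 3) *\<^sub>F (\<omega> \<^bold>\<and> \<omega> \<^bold>\<and> \<omega>)"

definition K_op :: "'v form \<Rightarrow> 'v form \<Rightarrow> 'v \<Rightarrow> 'v" where
  "K_op \<omega> \<phi> X =
     (THE Y. interior_product Y (volume \<omega>) = - (interior_product X \<phi> \<^bold>\<and> \<phi>))"

definition F_form :: "'v form \<Rightarrow> 'v form \<Rightarrow> 'v form" where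
  "F_form \<omega> \<phi> = (\<lambda>vs. case vs of [X, Y, Z] \<Rightarrow> - 2 * \<phi> [K_op \<omega> \<phi> X, Y, Z] | _ \<Rightarrow> 0)"

definition Q_num :: "'v form \<Rightarrow> 'v form \<Rightarrow> real" where
  "Q_num \<omega> \<phi> = (THE c. \<phi> \<^bold>\<and> F_form \<omega> \<phi> = (- c) *\<^sub>F volume \<omega>)"

definition q_metric :: "'v form \<Rightarrow> 'v form \<Rightarrow> 'v \<Rightarrow> 'v \<Rightarrow> real" where
  "q_metric \<omega> \<phi> v1 v2 = \<omega> [v1, K_op \<omega> \<phi> v2]"

definition has_signature :: "('v::real_vector \<Rightarrow> 'v \<Rightarrow> real) \<Rightarrow> nat \<Rightarrow> nat \<Rightarrow> bool" where
  "has_signature B p n \<longleftrightarrow>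
     (\<exists>S. finite S \<and> independent S \<and> span S = UNIV \<and>
        (\<forall>u\<in>S. \<forall>v\<in>S. u \<noteq> v \<longrightarrow> B u v = 0) \<and>
        card {u \<in> S. B u u > 0} = p \<and> card {u \<in> S. B u u < 0} = n)"

text \<open>
  A basis \<open>f\<^sup>1, \<dots>, f\<^sup>6\<close> of \<open>V\<^sup>*\<close> with \<open>\<omega> = f\<^sup>1\<^sup>2 + f\<^sup>3\<^sup>4 + f\<^sup>5\<^sup>6\<close>. The index type is the
  six-element type \<^typ>\<open>6\<close>, in which \<open>6 = 0\<close>.
\<close>

definition symplectic_coframe :: "'v::real_vector form \<Rightarrow> (6 \<Rightarrow> 'v form) \<Rightarrow> bool" where
  "symplectic_coframe \<omega> f \<longleftrightarrow>
     (\<forall>i. alternating_form 1 (f i)) \<and>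
     (\<forall>\<alpha>. alternating_form 1 \<alpha> \<longrightarrow> (\<exists>!c :: 6 \<Rightarrow> real. \<alpha> = (\<Sum>i\<in>UNIV. c i *\<^sub>F f i))) \<and>
     \<omega> = f 1 \<^bold>\<and> f 2 + f 3 \<^bold>\<and> f 4 + f 5 \<^bold>\<and> f 6"

definition triple :: "(6 \<Rightarrow> 'v form) \<Rightarrow> 6 \<Rightarrow> 6 \<Rightarrow> 6 \<Rightarrow> 'v form" where
  "triple f i j k = f i \<^bold>\<and> f j \<^bold>\<and> f k"

text \<open>
  Since \<open>Sp(V, \<omega>)\<close> acts simply transitively on symplectic bases, the orbit of a normal form
  \<open>\<nu>\<close> consists of the values of \<open>\<nu>\<close> in all symplectic bases. A superscript \<open>\<plusminus>\<close> is encoded as a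
  parameter \<open>s \<in> {1, -1}\<close>.
\<close>

definition orbit_of :: "'v::real_vector form \<Rightarrow> ((6 \<Rightarrow> 'v form) \<Rightarrow> 'v form) \<Rightarrow> 'v form set" where
  "orbit_of \<omega> \<nu> = {\<nu> f |f. symplectic_coframe \<omega> f}"

definition O_minus :: "'v::real_vector form \<Rightarrow> real \<Rightarrow> real \<Rightarrow> 'v form set" where
  "O_minus \<omega> s \<mu> = orbit_of \<omega>
     (\<lambda>f. \<mu> *\<^sub>F (triple f 1 3 5 - triple f 1 4 6 - s *\<^sub>F triple f 2 3 6 - s *\<^sub>F triple f 2 4 5))"

definition O_plus :: "'v::real_vector form \<Rightarrow> real \<Rightarrow> 'v form set" where
  "O_plus \<omega> \<mu> = orbit_of \<omega> (\<lambda>f. \<mu> *\<^sub>F (triple f 1 3 5 + triple f 2 4 6))"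

definition O_0 :: "'v::real_vector form \<Rightarrow> real \<Rightarrow> 'v form set" where
  "O_0 \<omega> s = orbit_of \<omega>
     (\<lambda>f. triple f 1 4 6 + s *\<^sub>F triple f 2 3 6 + s *\<^sub>F triple f 2 4 5)"

definition O_1 :: "'v::real_vector form \<Rightarrow> real \<Rightarrow> 'v form set" where
  "O_1 \<omega> s = orbit_of \<omega> (\<lambda>f. (f 1 \<^bold>\<and> f 3 - s *\<^sub>F (f 2 \<^bold>\<and> f 4)) \<^bold>\<and> f 5)"

text \<open>This is the intersection of the orbit \<open>O\<^sub>3\<close> with the primitive 3-forms.\<close>

definition O_3 :: "'v::real_vector form \<Rightarrow> 'v form set" where
  "O_3 \<omega> = orbit_of \<omega> (\<lambda>f. triple f 1 3 5)"

definition O_6 :: "'v form set" where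
  "O_6 = {0}"


section \<open>Differential forms\<close>

type_synonym 'v dform = "'v \<Rightarrow> 'v form"

primrec C_k :: "nat \<Rightarrow> ('v::real_normed_vector \<Rightarrow> real) \<Rightarrow> bool" where
  "C_k 0 f \<longleftrightarrow> continuous_on UNIV f"
| "C_k (Suc k) f \<longleftrightarrow>
     (\<forall>x. f differentiable (at x)) \<and> (\<forall>v. C_k k (\<lambda>x. frechet_derivative f (at x) v))"

definition smooth_form :: "nat \<Rightarrow> 'v::real_normed_vector dform \<Rightarrow> bool" where
  "smooth_form k \<alpha> \<longleftrightarrow>
     (\<forall>x. alternating_form k (\<alpha> x)) \<and> (\<forall>vs r. C_k r (\<lambda>x. \<alpha> x vs))"

text \<open>
  The exterior derivative on a vector space, evaluated on constant vector fields, so that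
  no bracket terms occur.
\<close>

definition ext_d :: "'v::real_normed_vector dform \<Rightarrow> 'v dform" where
  "ext_d \<alpha> x vs =
     (\<Sum>i<length vs. (- 1) ^ i *
        frechet_derivative (\<lambda>y. \<alpha> y (take i vs @ drop (Suc i) vs)) (at x) (vs ! i))"

definition pullback :: "('v::real_normed_vector \<Rightarrow> 'v) \<Rightarrow> 'v dform \<Rightarrow> 'v dform" where
  "pullback h \<alpha> x vs = \<alpha> (h x) (map (frechet_derivative h (at x)) vs)"

definition symplectic_form :: "'v::real_normed_vector dform \<Rightarrow> bool" where
  "symplectic_form \<omega> \<longleftrightarrow> smooth_form 2 \<omega> \<and> ext_d \<omega> = 0 \<and>
     (\<forall>x v. v \<noteq> 0 \<longrightarrow> (\<exists>w. \<omega> x [v, w] \<noteq> 0))"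

definition primitive_form :: "'v dform \<Rightarrow> 'v dform \<Rightarrow> bool" where
  "primitive_form \<omega> \<phi> \<longleftrightarrow> (\<forall>x. \<omega> x \<^bold>\<and> \<phi> x = 0)"

definition F_field :: "'v dform \<Rightarrow> 'v dform \<Rightarrow> 'v dform" where
  "F_field \<omega> \<phi> = (\<lambda>x. F_form (\<omega> x) (\<phi> x))"

definition integrable_form :: "'v::real_normed_vector dform \<Rightarrow> bool" where
  "integrable_form \<phi> \<longleftrightarrow> ext_d \<phi> = 0"

definition F_integrable_form :: "'v::real_normed_vector dform \<Rightarrow> 'v dform \<Rightarrow> bool" where
  "F_integrable_form \<omega> \<phi> \<longleftrightarrow> ext_d (F_field \<omega> \<phi>) = 0"

definition type_IIA_flow :: "'v::euclidean_space dform \<Rightarrow> (real \<Rightarrow> 'v dform) \<Rightarrow> bool" where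
  "type_IIA_flow \<omega> \<Phi> \<longleftrightarrow>
     (\<forall>t x vs. ((\<lambda>s. \<Phi> s x vs) has_real_derivative
        ext_d (\<lambda>y. lefschetz (\<omega> y) (ext_d (F_field \<omega> (\<Phi> t)) y)) x vs) (at t))"

definition stationary_IIA :: "'v::euclidean_space dform \<Rightarrow> 'v dform \<Rightarrow> bool" where
  "stationary_IIA \<omega> \<phi> \<longleftrightarrow> type_IIA_flow \<omega> (\<lambda>t. \<phi>)"

definition para_Kaehler_CY :: "'v::real_normed_vector dform \<Rightarrow> 'v dform \<Rightarrow> bool" where
  "para_Kaehler_CY \<omega> \<phi> \<longleftrightarrow>
     symplectic_form \<omega> \<and> smooth_form 3 \<phi> \<and> primitive_form \<omega> \<phi> \<and>
     (\<exists>\<mu>>0. \<forall>x. \<phi> x \<in> O_plus (\<omega> x) \<mu>) \<and>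
     integrable_form \<phi> \<and> F_integrable_form \<omega> \<phi>"


section \<open>The nilpotent Lie group\<close>

text \<open>
  The simply connected Lie group with the prescribed structure equations is unique up to
  isomorphism. It is realised on \<open>\<real>\<^sup>6\<close>, in coordinates in which \<open>e\<^sup>i = dx\<^sub>i\<close> for
  \<open>i \<noteq> 4, 6\<close>, \<open>e\<^sup>4 = dx\<^sub>4 + x\<^sub>1 dx\<^sub>5\<close> and \<open>e\<^sup>6 = dx\<^sub>6 + x\<^sub>1 dx\<^sub>3\<close>; the identity is the origin.
\<close>

definition nil_mult :: "real^6 \<Rightarrow> real^6 \<Rightarrow> real^6" where
  "nil_mult a b = (\<chi> i. if i = 4 then a $ 4 + b $ 4 - a $ 1 * b $ 5
                        else if i = 6 then a $ 6 + b $ 6 - a $ 1 * b $ 3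
                        else a $ i + b $ i)"

definition nil_group :: "(real^6) monoid" where
  "nil_group = \<lparr>carrier = UNIV, mult = nil_mult, one = 0\<rparr>"

definition coframe :: "6 \<Rightarrow> (real^6) dform" where
  "coframe i x vs = (case vs of
      [v] \<Rightarrow> if i = 4 then v $ 4 + x $ 1 * v $ 5
             else if i = 6 then v $ 6 + x $ 1 * v $ 3
             else v $ i
    | _ \<Rightarrow> 0)"

definition e2 :: "6 \<Rightarrow> 6 \<Rightarrow> (real^6) dform" where
  "e2 i j x = coframe i x \<^bold>\<and> coframe j x"

definition e3 :: "6 \<Rightarrow> 6 \<Rightarrow> 6 \<Rightarrow> (real^6) dform" where
  "e3 i j k x = coframe i x \<^bold>\<and> coframe j x \<^bold>\<and> coframe k x"

definition nil_omega :: "(real^6) dform" where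
  "nil_omega x = e2 1 2 x + e2 3 4 x + e2 5 6 x"

definition left_invariant :: "(real^6) dform \<Rightarrow> bool" where
  "left_invariant \<alpha> \<longleftrightarrow> (\<forall>a. pullback (nil_mult a) \<alpha> = \<alpha>)"

definition invariant_primitive_3form :: "(real^6) dform \<Rightarrow> bool" where
  "invariant_primitive_3form \<phi> \<longleftrightarrow>
     smooth_form 3 \<phi> \<and> left_invariant \<phi> \<and> primitive_form nil_omega \<phi>"

text \<open>
  The coefficient of \<open>e\<^sup>i\<^sup>j\<^sup>k\<close> (\<open>i, j, k\<close> distinct) in a left-invariant 3-form. It can be read off
  at the identity, where the coframe is dual to the standard basis.
\<close>

definition coeff_e3 :: "6 \<Rightarrow> 6 \<Rightarrow> 6 \<Rightarrow> (real^6) dform \<Rightarrow> real" where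
  "coeff_e3 i j k \<alpha> = \<alpha> 0 [axis i 1, axis j 1, axis k 1]"

text \<open>
  For a discrete subgroup \<open>\<Gamma>\<close> acting by left translations, the points of the quotient are the
  cosets \<open>\<Gamma>g\<close>, and differential forms on the quotient manifold are, via pull-back along the
  covering map, the \<open>\<Gamma>\<close>-invariant forms on the group.
\<close>

definition coset_topology :: "(real^6) set \<Rightarrow> (real^6) set topology" where
  "coset_topology \<Gamma> = topology (\<lambda>U. U \<subseteq> rcosets\<^bsub>nil_group\<^esub> \<Gamma> \<and>
     open {g. \<Gamma> #>\<^bsub>nil_group\<^esub> g \<in> U})"

definition cocompact_discrete_subgroup :: "(real^6) set \<Rightarrow> bool" where
  "cocompact_discrete_subgroup \<Gamma> \<longleftrightarrow>
     subgroup \<Gamma> nil_group \<and> discrete \<Gamma> \<and> compact_space (coset_topology \<Gamma>)"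

definition form_on_quotient :: "(real^6) set \<Rightarrow> (real^6) dform \<Rightarrow> bool" where
  "form_on_quotient \<Gamma> \<alpha> \<longleftrightarrow> (\<forall>\<gamma>\<in>\<Gamma>. pullback (nil_mult \<gamma>) \<alpha> = \<alpha>)"


subsection \<open>The model has the prescribed coframe\<close>

lemma group_nil_group: "group nil_group"
proof (rule groupI)
  fix x assume "x \<in> carrier nil_group"
  define y :: "real^6" where "y = (\<chi> i. if i = 4 then - x $ 4 - x $ 1 * x $ 5
      else if i = 6 then - x $ 6 - x $ 1 * x $ 3 else - x $ i)"
  have "nil_mult y x = 0"
    by (simp add: nil_mult_def y_def vec_eq_iff)
  then show "\<exists>y\<in>carrier nil_group. y \<otimes>\<^bsub>nil_group\<^esub> x = \<one>\<^bsub>nil_group\<^esub>"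
    by (auto simp: nil_group_def)
qed (auto simp: nil_group_def nil_mult_def vec_eq_iff algebra_simps)

lemma nil_group_two_step:
  "\<exists>z. nil_mult a b = nil_mult z (nil_mult b a) \<and> (\<forall>c. nil_mult z c = nil_mult c z)"
  by (rule exI[where x = "\<chi> i. if i = 4 then b $ 1 * a $ 5 - a $ 1 * b $ 5
        else if i = 6 then b $ 1 * a $ 3 - a $ 1 * b $ 3 else 0"])
    (simp add: nil_mult_def vec_eq_iff)

lemma frechet_derivative_nil_mult:
  "frechet_derivative (nil_mult a) (at x) v =
     (\<chi> i. if i = 4 then v $ 4 - a $ 1 * v $ 5
           else if i = 6 then v $ 6 - a $ 1 * v $ 3 else v $ i)"
proof -
  let ?D = "\<lambda>v. (\<chi> i. if i = 4 then v $ 4 - a $ 1 * v $ 5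
           else if i = 6 then v $ 6 - a $ 1 * v $ 3 else v $ i) :: real^6"
  have "((\<lambda>b. nil_mult a b $ i) has_derivative (\<lambda>v. ?D v $ i)) (at x)" for i
    by (cases "i = 4"; cases "i = 6") (auto simp: nil_mult_def intro!: derivative_eq_intros bounded_linear_imp_has_derivative bounded_linear_vec_nth)
  then have "(nil_mult a has_derivative ?D) (at x)"
    by (subst has_derivative_componentwise_within) (auto simp: Basis_vec_def inner_axis)
  then show ?thesis by (simp only: frechet_derivative_at[symmetric])
qed

lemma left_invariant_coframe: "left_invariant (coframe i)"
  by (auto simp: left_invariant_def pullback_def coframe_def frechet_derivative_nil_mult
      nil_mult_def fun_eq_iff algebra_simps split: list.splits)

lemma wedge_degree:
  assumes "\<And>vs. length vs \<noteq> p \<Longrightarrow> \<alpha> vs = 0" "\<And>vs. length vs \<noteq> q \<Longrightarrow> \<beta> vs = 0"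
    and "length vs \<noteq> p + q"
  shows "(\<alpha> \<^bold>\<and> \<beta>) vs = 0"
  unfolding wedge_def
proof (rule sum.neutral, rule ballI)
  fix S assume "S \<in> Pow {..<length vs}"
  have "card {i. i < length vs \<and> i \<in> S} + card {i. i < length vs \<and> i \<in> - S} =
      card ({i. i < length vs \<and> i \<in> S} \<union> {i. i < length vs \<and> i \<in> - S})"
    by (intro card_Un_disjoint[symmetric]) auto
  also have "{i. i < length vs \<and> i \<in> S} \<union> {i. i < length vs \<and> i \<in> - S} = {..<length vs}"
    by auto
  finally have "card {i. i < length vs \<and> i \<in> S} + card {i. i < length vs \<and> i \<in> - S} = length vs"
    by simp
  then have "length (nths vs S) \<noteq> p \<or> length (nths vs (- S)) \<noteq> q"
    using assms(3) unfolding length_nths by linarith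
  then show "shuffle_sign (length vs) S * \<alpha> (nths vs S) * \<beta> (nths vs (- S)) = 0"
    using assms(1)[of "nths vs S"] assms(2)[of "nths vs (- S)"] by (metis mult_eq_0_iff)
qed

lemma wedge_two:
  assumes "\<alpha> [] = 0" "\<beta> [] = 0"
  shows "(\<alpha> \<^bold>\<and> \<beta>) [v, w] = \<alpha> [v] * \<beta> [w] - \<alpha> [w] * \<beta> [v]"
proof -
  have P: "Pow {..<2::nat} = {{}, {0}, {1}, {0, 1}}"
    by (simp add: numeral_2_eq_2 lessThan_Suc Pow_insert insert_commute)
  have s: "shuffle_sign 2 {0} = 1" "shuffle_sign 2 {Suc 0} = - 1"
  proof -
    have "{(i, j). i \<in> {0::nat} \<and> j \<in> {..<2} - {0} \<and> j < i} = {}" by auto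
    then show "shuffle_sign 2 {0} = 1" unfolding shuffle_sign_def by (simp only:) simp
    have "{(i, j). i \<in> {Suc 0} \<and> j \<in> {..<2} - {Suc 0} \<and> j < i} = {(Suc 0, 0)}" by auto
    then show "shuffle_sign 2 {Suc 0} = - 1" unfolding shuffle_sign_def by (simp only:) simp
  qed
  show ?thesis
    using assms by (simp add: wedge_def P s numeral_2_eq_2[symmetric] nths_Cons)
qed

lemma coframe_degree: "length vs \<noteq> 1 \<Longrightarrow> coframe i x vs = 0"
  by (auto simp: coframe_def split: list.splits)

lemma ext_d_coframe:
  "ext_d (coframe i) x vs = (case vs of [v, w] \<Rightarrow>
     (if i = 4 then v $ 1 * w $ 5 - w $ 1 * v $ 5
      else if i = 6 then v $ 1 * w $ 3 - w $ 1 * v $ 3 else 0) | _ \<Rightarrow> 0)"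
proof (cases "length vs = 2")
  case True
  then obtain v w where vs: "vs = [v, w]"
    by (auto simp: length_Suc_conv numeral_2_eq_2)
  have *: "frechet_derivative (\<lambda>y::real^6. coframe i y [v]) (at x) =
      (\<lambda>w. if i = 4 then w $ 1 * v $ 5 else if i = 6 then w $ 1 * v $ 3 else 0)" for v
  proof -
    have "((\<lambda>y::real^6. coframe i y [v]) has_derivative
      (\<lambda>w. if i = 4 then w $ 1 * v $ 5 else if i = 6 then w $ 1 * v $ 3 else 0)) (at x)"
      by (cases "i = 4"; cases "i = 6") (auto simp: coframe_def intro!: derivative_eq_intros bounded_linear_imp_has_derivative bounded_linear_vec_nth)
    then show ?thesis by (simp only: frechet_derivative_at[symmetric])
  qed
  show ?thesis
    by (simp add: ext_d_def vs * numeral_2_eq_2 lessThan_Suc)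
next
  case False
  have "(\<lambda>y. coframe i y (take j vs @ drop (Suc j) vs)) = (\<lambda>y. 0)" if "j < length vs" for j
  proof -
    have "length (take j vs @ drop (Suc j) vs) \<noteq> 1" using that False by auto
    then show ?thesis
      by (simp add: coframe_degree)
  qed
  then show ?thesis
    using False by (auto simp: ext_d_def split: list.splits)
qed

lemma e2_apply:
  "e2 i j x vs = (case vs of
      [v, w] \<Rightarrow> coframe i x [v] * coframe j x [w] - coframe i x [w] * coframe j x [v]
    | _ \<Rightarrow> 0)"
proof (cases "length vs = 2")
  case True
  then obtain v w where vs: "vs = [v, w]"
    by (auto simp: length_Suc_conv numeral_2_eq_2)
  show ?thesis unfolding vs e2_def
    by (subst wedge_two) (auto simp: coframe_def)
next
  case False
  then have "e2 i j x vs = 0"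
    unfolding e2_def
    by (intro wedge_degree[where p = 1 and q = 1]) (simp_all add: coframe_degree)
  then show ?thesis using False by (auto split: list.splits)
qed

lemma structure_equations:
  "ext_d (coframe 1) = 0" "ext_d (coframe 2) = 0" "ext_d (coframe 3) = 0"
  "ext_d (coframe 5) = 0" "ext_d (coframe 4) = e2 1 5" "ext_d (coframe 6) = e2 1 3"
  by (auto simp: fun_eq_iff ext_d_coframe e2_apply coframe_def split: list.splits)

end

theory Submission
  imports Defs
begin

text \<open>
  The whole statement concerns forms with constant coefficients in a left-invariant coframe, so it
  is a statement about the exterior algebra of a six-dimensional symplectic space together with one
  linear map, the exterior derivative.

  The algebraic part holds in an arbitrary symplectic coframe \<open>f\<close> of \<open>\<real>\<^sup>6\<close>. Contraction of the volume
  form identifies vectors with 5-forms, so \<open>K(\<phi>)\<close> is found by expanding \<open>- \<iota>\<^sub>X \<phi> \<and> \<phi>\<close> in the coframe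
  (\<open>K_op_primitive3\<close>); contracting again gives the fourteen coefficients of the primitive form \<open>F(\<phi>)\<close>
  (\<open>F_form_primitive3\<close>), and one more wedge product gives \<open>Q(\<phi>)\<close> (\<open>Q_num_reduced\<close>). Since the
  formulas are the same in every symplectic coframe, they apply at each point of the group to the
  left-invariant coframe without any equivariance argument.

  For the differential part, only \<open>e\<^sup>4\<close> and \<open>e\<^sup>6\<close> are not closed and both differentials are multiples
  of \<open>e\<^sup>1\<close>. The Leibniz rule then gives
  \<open>d\<phi> = H (e\<^sup>1\<^sup>2\<^sup>5\<^sup>6 - e\<^sup>1\<^sup>2\<^sup>3\<^sup>4) + 2 J e\<^sup>1\<^sup>2\<^sup>3\<^sup>5 - L e\<^sup>1\<^sup>3\<^sup>4\<^sup>5 - N e\<^sup>1\<^sup>3\<^sup>5\<^sup>6\<close>, which is the closedness criterion,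
  and \<open>d \<Lambda> d\<phi> = - 2 H e\<^sup>1\<^sup>3\<^sup>5\<close>. Applied to \<open>F(\<phi>)\<close> in place of \<open>\<phi>\<close>, the same two formulas describe the
  \<open>F\<close>-integrable forms and the stationary points of the flow.

  For a closed stationary \<open>\<phi>\<close> with \<open>Q(\<phi>) < 0\<close> the normal form has to be reached explicitly. As
  \<open>D F G = 0\<close>, a cyclic permutation of the three conjugate pairs of the coframe makes \<open>D = 0\<close>; then
  \<open>Q(\<phi>) / 4 = (B G - C F)\<^sup>2 + 4 I\<^sup>2 F G\<close>, so that \<open>F G < 0\<close> and \<open>I \<noteq> 0\<close>. These inequalities allow shears
  to remove \<open>E\<close>, \<open>M\<close>, \<open>K\<close>, \<open>A\<close> and to arrange \<open>B G + C F = 0\<close>. What remains is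
  \<open>e\<^sup>1 \<and> \<sigma> + e\<^sup>2 \<and> \<tau>\<close> with two primitive 2-forms \<open>\<sigma>\<close>, \<open>\<tau>\<close> in the other four directions, and a
  scaling, a boost and a rotation in those directions bring it to the representative of
  \<open>O\<^sub>-\<^sup>-(\<mu>)\<close> (\<open>negative_type_exists\<close>). In that coframe the metric is diagonal and its signature can be
  read off (\<open>signature_O_minus\<close>). The remaining orbits are represented by forms with at most three
  non-zero coefficients, and the points with integer coordinates form a cocompact lattice because
  every coset meets the unit cube.
\<close>

section \<open>Exterior algebra\<close>

definition one_form :: "'v form \<Rightarrow> bool" where
  "one_form \<alpha> \<longleftrightarrow> (\<forall>vs. length vs \<noteq> 1 \<longrightarrow> \<alpha> vs = 0)"

text \<open>
  The grading involution. With it the rules for forms of a fixed degree, in which the sign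
  \<open>(- 1)\<^sup>d\<^sup>e\<^sup>g \<alpha>\<close> occurs, become identities between arbitrary functions on lists.
\<close>

definition grade_sign :: "'v form \<Rightarrow> 'v form" where
  "grade_sign \<alpha> = (\<lambda>vs. (- 1) ^ length vs * \<alpha> vs)"

lemmas form_fun_simps = fun_eq_iff plus_fun_def zero_fun_def fun_diff_def form_scale_def

lemma wedge_Nil: "(\<alpha> \<^bold>\<and> \<beta>) [] = \<alpha> [] * \<beta> []"
  by (simp add: wedge_def shuffle_sign_def)

text \<open>
  The subsets of positions are split according to whether they contain the first one; if they
  do not, every position in them has one more inversion, which is the sign of the second summand.
  Associativity, the graded signs and the Leibniz rule follow from this recursion by induction on
  the list of vectors.
\<close>

lemma wedge_Cons:
  "(\<alpha> \<^bold>\<and> \<beta>) (v # vs) =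
     (interior_product v \<alpha> \<^bold>\<and> \<beta>) vs + (grade_sign \<alpha> \<^bold>\<and> interior_product v \<beta>) vs"
proof -
  let ?n = "length vs"
  let ?P = "Pow {..<?n}"
  have "Pow {..<Suc ?n} = (\<lambda>S. insert 0 (Suc ` S)) ` ?P \<union> (\<lambda>S. Suc ` S) ` ?P"
  proof -
    have "{..<Suc ?n} = insert 0 (Suc ` {..<?n})" by (rule lessThan_Suc_eq_insert_0)
    moreover have "Pow (Suc ` {..<?n}) = (\<lambda>S. Suc ` S) ` ?P"
      by (simp add: image_Pow_surj)
    ultimately show ?thesis by (simp add: Pow_insert image_image Un_commute)
  qed
  moreover have "(\<lambda>S. insert 0 (Suc ` S)) ` ?P \<inter> (\<lambda>S. Suc ` S) ` ?P = {}" by auto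
  moreover have "inj_on (\<lambda>S. insert 0 (Suc ` S)) ?P"
    by (rule inj_on_inverseI[where g = "\<lambda>T. Suc -` T"]) auto
  moreover have "inj_on (\<lambda>S. Suc ` S) ?P"
    by (rule inj_on_inverseI[where g = "\<lambda>T. Suc -` T"]) auto
  ultimately have split: "sum g (Pow {..<Suc ?n}) =
      (\<Sum>S\<in>?P. g (insert 0 (Suc ` S))) + (\<Sum>S\<in>?P. g (Suc ` S))" for g :: "nat set \<Rightarrow> real"
    by (simp add: sum.union_disjoint sum.reindex)
  have inv: "{(i, j). i \<in> S' \<and> j \<in> {..<Suc ?n} - S' \<and> j < i} =
      (\<lambda>(i, j). (Suc i, Suc j)) ` {(i, j). i \<in> S \<and> j \<in> {..<?n} - S \<and> j < i}
      \<union> (if 0 \<in> S' then {} else (\<lambda>i. (Suc i, 0)) ` S)"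
    if "S \<in> ?P" "S' = insert 0 (Suc ` S) \<or> S' = Suc ` S" for S S'
  proof (rule Set.set_eqI)
    fix p :: "nat \<times> nat"
    obtain i j where "p = (i, j)" by (cases p)
    then show "p \<in> {(i, j). i \<in> S' \<and> j \<in> {..<Suc ?n} - S' \<and> j < i} \<longleftrightarrow>
      p \<in> (\<lambda>(i, j). (Suc i, Suc j)) ` {(i, j). i \<in> S \<and> j \<in> {..<?n} - S \<and> j < i}
      \<union> (if 0 \<in> S' then {} else (\<lambda>i. (Suc i, 0)) ` S)"
      using that by (cases i; cases j) (auto simp: image_iff)
  qed
  have fin: "finite {(i, j). i \<in> S \<and> j \<in> {..<?n} - S \<and> j < i}" if "S \<in> ?P" for S
    by (rule finite_subset[of _ "{..<?n} \<times> {..<?n}"]) (use that in auto)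
  have s1: "shuffle_sign (Suc ?n) (insert 0 (Suc ` S)) = shuffle_sign ?n S" if "S \<in> ?P" for S
    unfolding shuffle_sign_def inv[OF that disjI1[OF refl]]
    by (simp add: card_image inj_on_def)
  have s2: "shuffle_sign (Suc ?n) (Suc ` S) = (- 1) ^ card S * shuffle_sign ?n S"
    if "S \<in> ?P" for S
  proof -
    have "finite S" using that finite_subset by auto
    then have "card ((\<lambda>(i, j). (Suc i, Suc j)) ` {(i, j). i \<in> S \<and> j \<in> {..<?n} - S \<and> j < i}
      \<union> (\<lambda>i. (Suc i, 0)) ` S) = card {(i, j). i \<in> S \<and> j \<in> {..<?n} - S \<and> j < i} + card S"
      using fin[OF that]
      by (subst card_Un_disjoint) (auto simp: card_image inj_on_def)
    moreover have "0 \<notin> Suc ` S" by auto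
    ultimately show ?thesis
      unfolding shuffle_sign_def inv[OF that disjI2[OF refl]] by (simp add: power_add mult.commute)
  qed
  have n1: "nths (v # vs) (insert 0 (Suc ` S)) = v # nths vs S"
    "nths (v # vs) (- insert 0 (Suc ` S)) = nths vs (- S)"
    "nths (v # vs) (Suc ` S) = nths vs S"
    "nths (v # vs) (- Suc ` S) = v # nths vs (- S)" for S
    by (auto simp: nths_Cons image_iff Compl_eq intro!: arg_cong2[where f = nths])
  have len: "length (nths vs S) = card S" if "S \<in> ?P" for S
    using that unfolding length_nths by (intro arg_cong[where f = card]) auto
  show ?thesis
    unfolding wedge_def length_Cons split sum.distrib[symmetric]
  proof (rule sum.cong[OF refl])
    fix S assume S: "S \<in> ?P"
    show "shuffle_sign (Suc ?n) (insert 0 (Suc ` S)) * \<alpha> (nths (v # vs) (insert 0 (Suc ` S))) *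
          \<beta> (nths (v # vs) (- insert 0 (Suc ` S))) +
        shuffle_sign (Suc ?n) (Suc ` S) * \<alpha> (nths (v # vs) (Suc ` S)) *
          \<beta> (nths (v # vs) (- Suc ` S)) =
        shuffle_sign ?n S * interior_product v \<alpha> (nths vs S) * \<beta> (nths vs (- S)) +
        shuffle_sign ?n S * grade_sign \<alpha> (nths vs S) * interior_product v \<beta> (nths vs (- S))"
      unfolding s1[OF S] s2[OF S] n1
      by (simp add: interior_product_def grade_sign_def len[OF S])
  qed
qed

lemma interior_wedge:
  "interior_product v (\<alpha> \<^bold>\<and> \<beta>) = interior_product v \<alpha> \<^bold>\<and> \<beta> + grade_sign \<alpha> \<^bold>\<and> interior_product v \<beta>"
  by (simp add: fun_eq_iff wedge_Cons interior_product_def[of v "\<alpha> \<^bold>\<and> \<beta>"])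

lemma wedge_add_left: "(\<alpha> + \<beta>) \<^bold>\<and> \<gamma> = \<alpha> \<^bold>\<and> \<gamma> + \<beta> \<^bold>\<and> \<gamma>"
  by (simp add: wedge_def fun_eq_iff sum.distrib[symmetric] algebra_simps)

lemma wedge_add_right: "\<gamma> \<^bold>\<and> (\<alpha> + \<beta>) = \<gamma> \<^bold>\<and> \<alpha> + \<gamma> \<^bold>\<and> \<beta>"
  by (simp add: wedge_def fun_eq_iff sum.distrib[symmetric] algebra_simps)

lemma wedge_scale_left: "(c *\<^sub>F \<alpha>) \<^bold>\<and> \<gamma> = c *\<^sub>F (\<alpha> \<^bold>\<and> \<gamma>)"
  by (simp add: wedge_def fun_eq_iff form_scale_def sum_distrib_left algebra_simps)

lemma wedge_scale_right: "\<gamma> \<^bold>\<and> (c *\<^sub>F \<alpha>) = c *\<^sub>F (\<gamma> \<^bold>\<and> \<alpha>)"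
  by (simp add: wedge_def fun_eq_iff form_scale_def sum_distrib_left algebra_simps)

lemma wedge_zero: "0 \<^bold>\<and> \<alpha> = 0" "\<alpha> \<^bold>\<and> 0 = 0"
  by (simp_all add: wedge_def fun_eq_iff)

lemma form_minus: "- \<alpha> = (- 1) *\<^sub>F \<alpha>" "\<alpha> - \<beta> = \<alpha> + (- 1) *\<^sub>F \<beta>" for \<alpha> \<beta> :: "'v form"
  by (auto simp: form_fun_simps)

lemma scale_add: "c *\<^sub>F (\<alpha> + \<beta>) = c *\<^sub>F \<alpha> + c *\<^sub>F \<beta>"
  by (simp add: form_fun_simps algebra_simps)

lemma scale_scale: "c *\<^sub>F d *\<^sub>F \<alpha> = (c * d) *\<^sub>F \<alpha>"
  by (simp add: form_fun_simps)

lemma scale_zero: "0 *\<^sub>F \<alpha> = 0" "c *\<^sub>F 0 = (0 :: 'v form)" "1 *\<^sub>F \<alpha> = \<alpha>"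
  by (simp_all add: form_fun_simps)

lemma grade_sign_wedge: "grade_sign (\<alpha> \<^bold>\<and> \<beta>) = grade_sign \<alpha> \<^bold>\<and> grade_sign \<beta>"
proof
  fix vs :: "'a list"
  have "length (nths vs S) + length (nths vs (- S)) = length vs" for S
  proof (induction vs arbitrary: S)
    case (Cons v vs)
    show ?case using Cons[of "{j. Suc j \<in> S}"] by (auto simp: nths_Cons Compl_eq)
  qed simp
  then have "(- 1 :: real) ^ length vs =
      (- 1) ^ length (nths vs S) * (- 1) ^ length (nths vs (- S))" for S
    by (metis power_add)
  then show "grade_sign (\<alpha> \<^bold>\<and> \<beta>) vs = (grade_sign \<alpha> \<^bold>\<and> grade_sign \<beta>) vs"
    by (simp add: grade_sign_def wedge_def sum_distrib_left mult_ac)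
qed

text \<open>
  Both sides satisfy the recursion for the contraction of a threefold product.
\<close>

lemma wedge_assoc: "(\<alpha> \<^bold>\<and> \<beta>) \<^bold>\<and> \<gamma> = \<alpha> \<^bold>\<and> \<beta> \<^bold>\<and> \<gamma>"
proof
  fix vs
  show "((\<alpha> \<^bold>\<and> \<beta>) \<^bold>\<and> \<gamma>) vs = (\<alpha> \<^bold>\<and> \<beta> \<^bold>\<and> \<gamma>) vs"
  proof (induction vs arbitrary: \<alpha> \<beta> \<gamma>)
    case (Cons v vs)
    then show ?case
      by (simp add: wedge_Cons interior_wedge grade_sign_wedge wedge_add_left wedge_add_right)
  qed (simp add: wedge_Nil)
qed

lemma grade_sign_one_form: "one_form \<alpha> \<Longrightarrow> grade_sign \<alpha> = (- 1) *\<^sub>F \<alpha>"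
  unfolding one_form_def grade_sign_def form_scale_def
  by (rule ext) (metis mult_zero_right power_one_right)

text \<open>
  The contraction of a one-form is a scalar, that is, a form supported on the empty list, and
  a scalar acts on other forms by multiplication.
\<close>

lemma interior_one_form_wedge: "one_form \<alpha> \<Longrightarrow> (interior_product v \<alpha> \<^bold>\<and> \<beta>) = \<alpha> [v] *\<^sub>F \<beta>"
proof
  fix vs assume a: "one_form \<alpha>"
  have "interior_product v \<alpha> = (\<lambda>us. if us = [] then \<alpha> [v] else 0)"
    using a by (auto simp: one_form_def interior_product_def fun_eq_iff)
  moreover have "((\<lambda>us. if us = [] then c else 0) \<^bold>\<and> \<beta>) vs = c * \<beta> vs" for c
  proof (induction vs arbitrary: \<beta>)
    case (Cons w vs)
    have "interior_product w (\<lambda>us. if us = [] then c else 0) = 0"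
      by (auto simp: interior_product_def)
    moreover have "grade_sign (\<lambda>us::'a list. if us = [] then c else 0) =
        (\<lambda>us. if us = [] then c else 0)"
      by (auto simp: grade_sign_def)
    ultimately show ?case using Cons
      by (simp add: wedge_Cons wedge_zero interior_product_def[of w \<beta>])
  qed (simp add: wedge_Nil)
  ultimately show "(interior_product v \<alpha> \<^bold>\<and> \<beta>) vs = (\<alpha> [v] *\<^sub>F \<beta>) vs"
    by (simp add: form_scale_def)
qed

lemma interior_wedge_one_form:
  "one_form \<alpha> \<Longrightarrow> interior_product v (\<alpha> \<^bold>\<and> \<beta>) = \<alpha> [v] *\<^sub>F \<beta> + (- 1) *\<^sub>F (\<alpha> \<^bold>\<and> interior_product v \<beta>)"
  by (simp add: interior_wedge interior_one_form_wedge grade_sign_one_form wedge_scale_left)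

lemma wedge_interior_one_form: "one_form \<alpha> \<Longrightarrow> (\<beta> \<^bold>\<and> interior_product v \<alpha>) = \<alpha> [v] *\<^sub>F \<beta>"
proof
  fix vs assume a: "one_form \<alpha>"
  have "interior_product v \<alpha> = (\<lambda>us. if us = [] then \<alpha> [v] else 0)"
    using a by (auto simp: one_form_def interior_product_def fun_eq_iff)
  moreover have "(\<beta> \<^bold>\<and> (\<lambda>us. if us = [] then c else 0)) vs = c * \<beta> vs" for c
  proof (induction vs arbitrary: \<beta>)
    case (Cons w vs)
    have "interior_product w (\<lambda>us. if us = [] then c else 0) = 0"
      by (auto simp: interior_product_def)
    then show ?case using Cons
      by (simp add: wedge_Cons wedge_zero interior_product_def[of w \<beta>])
  qed (simp add: wedge_Nil)
  ultimately show "(\<beta> \<^bold>\<and> interior_product v \<alpha>) vs = (\<alpha> [v] *\<^sub>F \<beta>) vs"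
    by (simp add: form_scale_def)
qed

lemma one_forms_anticommute:
  assumes "one_form \<alpha>" "one_form \<beta>"
  shows "\<alpha> \<^bold>\<and> \<beta> = (- 1) *\<^sub>F (\<beta> \<^bold>\<and> \<alpha>)"
proof
  fix vs
  show "(\<alpha> \<^bold>\<and> \<beta>) vs = ((- 1) *\<^sub>F (\<beta> \<^bold>\<and> \<alpha>)) vs"
    using assms(1)[unfolded one_form_def, rule_format, of "[]"]
    by (cases vs) (simp_all add: form_scale_def wedge_Nil wedge_Cons assms interior_one_form_wedge
        wedge_interior_one_form grade_sign_one_form wedge_scale_left)
qed

lemma one_form_square:
  assumes "one_form \<alpha>"
  shows "\<alpha> \<^bold>\<and> \<alpha> = 0" "\<alpha> \<^bold>\<and> \<alpha> \<^bold>\<and> \<beta> = 0"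
proof -
  show *: "\<alpha> \<^bold>\<and> \<alpha> = 0"
    using one_forms_anticommute[OF assms assms] by (auto simp: form_scale_def fun_eq_iff)
  show "\<alpha> \<^bold>\<and> \<alpha> \<^bold>\<and> \<beta> = 0"
    by (simp add: wedge_assoc[symmetric] * wedge_zero)
qed

lemma one_forms_left_commute:
  "one_form \<alpha> \<Longrightarrow> one_form \<beta> \<Longrightarrow> \<alpha> \<^bold>\<and> \<beta> \<^bold>\<and> \<gamma> = (- 1) *\<^sub>F (\<beta> \<^bold>\<and> \<alpha> \<^bold>\<and> \<gamma>)"
  by (metis one_forms_anticommute wedge_assoc wedge_scale_left)

lemma one_forms_wedge_apply:
  assumes "one_form \<alpha>" "one_form \<beta>"
  shows "(\<alpha> \<^bold>\<and> \<beta>) [v, w] = \<alpha> [v] * \<beta> [w] - \<alpha> [w] * \<beta> [v]"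
  using assms by (intro wedge_two) (simp_all add: one_form_def)

lemma wedge_map: "(\<alpha> \<^bold>\<and> \<beta>) (map g vs) = ((\<lambda>us. \<alpha> (map g us)) \<^bold>\<and> (\<lambda>us. \<beta> (map g us))) vs"
  by (simp add: wedge_def nths_map)

lemma form_scale_apply: "(c *\<^sub>F \<alpha>) vs = c * \<alpha> vs"
  by (simp add: form_scale_def)

lemma interior_zero: "interior_product v 0 = 0"
  by (simp add: interior_product_def form_fun_simps)

lemma wedge_apply_Cons:
  "one_form \<alpha> \<Longrightarrow> (\<alpha> \<^bold>\<and> \<beta>) (v # vs) = \<alpha> [v] * \<beta> vs - (\<alpha> \<^bold>\<and> interior_product v \<beta>) vs"
  using fun_cong[OF interior_wedge_one_form[of \<alpha> v \<beta>], of vs]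
  by (simp add: interior_product_def[of v "_ \<^bold>\<and> _"] form_scale_def)

section \<open>Alternating forms\<close>

lemma one_form_linear:
  assumes "alternating_form 1 \<alpha>"
  shows "one_form \<alpha>" "\<alpha> [v + w] = \<alpha> [v] + \<alpha> [w]" "\<alpha> [c *\<^sub>R v] = c * \<alpha> [v]"
proof -
  show "one_form \<alpha>" using assms by (auto simp: alternating_form_def one_form_def)
  have "linear (\<lambda>v. \<alpha> ([undefined][0 := v]))"
    using assms unfolding alternating_form_def
    by (metis One_nat_def length_Cons list.size(3) zero_less_one)
  then have "linear (\<lambda>v. \<alpha> [v])" by simp
  then show "\<alpha> [v + w] = \<alpha> [v] + \<alpha> [w]" "\<alpha> [c *\<^sub>R v] = c * \<alpha> [v]"
    using linear_add[OF \<open>linear (\<lambda>v. \<alpha> [v])\<close>] linear_scale[OF \<open>linear (\<lambda>v. \<alpha> [v])\<close>] by simp_all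
qed

lemma alternating_one_formI:
  assumes "one_form \<alpha>" "linear (\<lambda>v. \<alpha> [v])"
  shows "alternating_form 1 \<alpha>"
  using assms by (auto simp: alternating_form_def one_form_def length_Suc_conv)

text \<open>
  Only a repetition in the first two arguments has to be tested: the hypotheses make the form
  antisymmetric in these two, so the first argument can be moved behind the second and any other
  repetition becomes one inside a contraction.
\<close>

lemma alternating_form_SucI:
  assumes "\<alpha> [] = 0"
    and contraction: "\<And>v. alternating_form k (interior_product v \<alpha>)"
    and linear: "\<And>vs. linear (\<lambda>v. \<alpha> (v # vs))"
    and repeated: "\<And>v vs. \<alpha> (v # v # vs) = 0"
  shows "alternating_form (Suc k) \<alpha>"
proof -
  have deg: "\<alpha> vs = 0" if "length vs \<noteq> Suc k" for vs
    using that assms(1) contraction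
    by (cases vs) (auto simp: alternating_form_def interior_product_def)
  have lin: "linear (\<lambda>v. \<alpha> (vs[i := v]))" if "length vs = Suc k" "i < Suc k" for vs i
    using that linear contraction
    by (cases vs; cases i) (auto simp: alternating_form_def interior_product_def)
  have swap: "\<alpha> (v # w # vs) = - \<alpha> (w # v # vs)" if k: "length vs = k - 1" "k \<noteq> 0" for v w vs
  proof -
    have lin2: "linear (\<lambda>y. \<alpha> (x # y # vs))" for x
      using lin[of "x # 0 # vs" 1] k by simp
    have "0 = \<alpha> ((v + w) # (v + w) # vs)" by (simp add: repeated)
    also have "\<dots> = \<alpha> (v # v # vs) + \<alpha> (v # w # vs) + (\<alpha> (w # v # vs) + \<alpha> (w # w # vs))"
      by (simp add: linear_add[OF linear] linear_add[OF lin2] del: repeated)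
    finally show ?thesis by (simp add: repeated)
  qed
  have alt: "\<alpha> vs = 0" if *: "length vs = Suc k" "i < j" "j < Suc k" "vs ! i = vs ! j" for vs i j
  proof -
    obtain v us where vs: "vs = v # us" "length us = k" using *(1) by (cases vs) auto
    show ?thesis
    proof (cases i)
      case 0
      obtain w ws where us: "us = w # ws" using * vs by (cases us) auto
      show ?thesis
      proof (cases "j = 1")
        case True
        then show ?thesis using * vs us 0 by (simp add: repeated)
      next
        case False
        then obtain j' where j: "j = Suc (Suc j')" using * 0 by (cases j; cases "j - 1") auto
        have "interior_product w \<alpha> (v # ws) = 0"
          using contraction[of w] * vs us 0 j unfolding alternating_form_def
          by (elim conjE allE[of _ "v # ws"] allE[of _ 0] allE[of _ "Suc j'"]) auto
        then show ?thesis using swap[of ws v w] vs us by (simp add: interior_product_def)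
      qed
    next
      case (Suc i')
      then obtain j' where j: "j = Suc j'" using * by (cases j) auto
      have "interior_product v \<alpha> us = 0"
        using contraction[of v] * vs Suc j unfolding alternating_form_def by auto
      then show ?thesis using vs by (simp add: interior_product_def)
    qed
  qed
  show ?thesis unfolding alternating_form_def using deg lin alt by blast
qed

lemma alternating_form_add:
  "alternating_form k \<alpha> \<Longrightarrow> alternating_form k \<beta> \<Longrightarrow> alternating_form k (\<alpha> + \<beta>)"
  by (auto simp: alternating_form_def linear_compose_add)

lemma alternating_form_scale: "alternating_form k \<alpha> \<Longrightarrow> alternating_form k (c *\<^sub>F \<alpha>)"
  by (auto simp: alternating_form_def form_scale_def linear_iff algebra_simps)

lemma alternating_form_contraction:
  fixes v :: "'v::real_vector"
  assumes "alternating_form (Suc k) \<alpha>"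
  shows "alternating_form k (interior_product v \<alpha>)" "linear (\<lambda>v. \<alpha> (v # vs))"
    "\<alpha> (v # v # us) = 0"
proof -
  have *: "linear (\<lambda>w. \<alpha> (us[i := w]))" if "length us = Suc k" "i < Suc k" for us i
    using assms that by (simp add: alternating_form_def)
  have **: "\<alpha> us = 0" if "length us = Suc k" "i < j" "j < Suc k" "us ! i = us ! j" for us i j
    using assms that unfolding alternating_form_def by blast
  have ***: "\<alpha> us = 0" if "length us \<noteq> Suc k" for us
    using assms that by (simp add: alternating_form_def)
  show "alternating_form k (interior_product v \<alpha>)"
    unfolding alternating_form_def interior_product_def
  proof (intro conjI allI impI)
    fix vs :: "'v list" and i assume "length vs = k" "i < k"
    then show "linear (\<lambda>w. \<alpha> (v # vs[i := w]))" using *[of "v # vs" "Suc i"] by simp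
  next
    fix vs :: "'v list" and i j assume "length vs = k" "i < j" "j < k" "vs ! i = vs ! j"
    then show "\<alpha> (v # vs) = 0" using **[of "v # vs" "Suc i" "Suc j"] by simp
  qed (simp add: ***)
  show "linear (\<lambda>v. \<alpha> (v # vs))"
    using *[of "undefined # vs" 0] ***[of "_ # vs"]
    by (cases "length vs = k") (auto simp: linear_iff)
  show "\<alpha> (v # v # us) = 0"
    using **[of "v # v # us" 0 1] ***[of "v # v # us"] by (cases "length us = k - 1") (auto)
qed

lemma alternating_form_wedge:
  assumes "alternating_form 1 \<alpha>" "alternating_form k \<beta>"
  shows "alternating_form (Suc k) (\<alpha> \<^bold>\<and> \<beta>)"
  using assms(2)
proof (induction k arbitrary: \<beta>)
  note \<alpha> = one_form_linear[OF assms(1)]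
  have nil: "(\<alpha> \<^bold>\<and> \<beta>) [] = 0" for \<beta>
    using \<alpha>(1) by (simp add: wedge_Nil one_form_def)
  have contr: "interior_product v (\<alpha> \<^bold>\<and> \<beta>) = \<alpha> [v] *\<^sub>F \<beta> + (- 1) *\<^sub>F (\<alpha> \<^bold>\<and> interior_product v \<beta>)"
    for v \<beta>
    by (rule interior_wedge_one_form[OF \<alpha>(1)])
  have ap: "(\<alpha> \<^bold>\<and> \<beta>) (v # vs) = \<alpha> [v] * \<beta> vs - (\<alpha> \<^bold>\<and> interior_product v \<beta>) vs" for v vs \<beta>
    using fun_cong[OF contr[of v \<beta>], of vs]
    by (simp add: interior_product_def[of v "\<alpha> \<^bold>\<and> \<beta>"] form_scale_def)
  {
    case 0
    have z: "interior_product v \<beta> = 0" for v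
      using 0 by (auto simp: alternating_form_def interior_product_def)
    have ap0: "(\<alpha> \<^bold>\<and> \<beta>) (v # vs) = \<alpha> [v] * \<beta> vs" for v vs
      by (simp add: ap z wedge_zero)
    show ?case
    proof (rule alternating_form_SucI)
      show "alternating_form 0 (interior_product v (\<alpha> \<^bold>\<and> \<beta>))" for v
        using 0 by (simp add: contr z wedge_zero scale_zero alternating_form_scale)
      show "linear (\<lambda>v. (\<alpha> \<^bold>\<and> \<beta>) (v # vs))" for vs
        by (rule linearI) (simp_all add: ap0 \<alpha> algebra_simps)
      show "(\<alpha> \<^bold>\<and> \<beta>) (v # v # vs) = 0" for v vs
        using 0 by (simp add: ap0 alternating_form_def)
    qed (fact nil)
  next
    case (Suc k)
    note \<beta> = alternating_form_contraction[OF Suc.prems]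
    show ?case
    proof (rule alternating_form_SucI)
      show "alternating_form (Suc k) (interior_product v (\<alpha> \<^bold>\<and> \<beta>))" for v
        unfolding contr
        by (intro alternating_form_add alternating_form_scale Suc.IH Suc.prems \<beta>(1))
      show "linear (\<lambda>v. (\<alpha> \<^bold>\<and> \<beta>) (v # vs))" for vs
      proof (rule linearI)
        have l: "interior_product (v + w) \<beta> = interior_product v \<beta> + interior_product w \<beta>"
          "interior_product (c *\<^sub>R v) \<beta> = c *\<^sub>F interior_product v \<beta>" for v w c
          by (simp_all add: interior_product_def form_fun_simps linear_add[OF \<beta>(2)]
            linear_scale[OF \<beta>(2)])
        show "(\<alpha> \<^bold>\<and> \<beta>) ((v + w) # vs) = (\<alpha> \<^bold>\<and> \<beta>) (v # vs) + (\<alpha> \<^bold>\<and> \<beta>) (w # vs)" for v w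
          by (simp add: ap l \<alpha> wedge_add_right algebra_simps)
        show "(\<alpha> \<^bold>\<and> \<beta>) ((c *\<^sub>R v) # vs) = c *\<^sub>R (\<alpha> \<^bold>\<and> \<beta>) (v # vs)" for c v
          by (simp add: ap l \<alpha> wedge_scale_right form_scale_apply algebra_simps)
      qed
      show "(\<alpha> \<^bold>\<and> \<beta>) (v # v # vs) = 0" for v vs
      proof -
        have "interior_product v (interior_product v \<beta>) = 0"
          by (auto simp: interior_product_def \<beta>(3))
        then show ?thesis
          by (simp add: ap wedge_zero) (simp add: interior_product_def)
      qed
    qed (fact nil)
  }
qed

section \<open>Normal forms in six dimensions\<close>

lemma exhaust_6: "x = 1 \<or> x = 2 \<or> x = 3 \<or> x = 4 \<or> x = 5 \<or> x = 6" for x :: 6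
proof (induct x)
  case (of_int z)
  then have "z = 0 \<or> z = 1 \<or> z = 2 \<or> z = 3 \<or> z = 4 \<or> z = 5" by fastforce
  then show ?case by auto
qed

lemma forall_6: "(\<forall>i::6. P i) \<longleftrightarrow> P 1 \<and> P 2 \<and> P 3 \<and> P 4 \<and> P 5 \<and> P 6"
  by (metis exhaust_6)

lemma sum_6: "sum g (UNIV :: 6 set) = g 1 + g 2 + g 3 + g 4 + g 5 + g 6"
proof -
  have U: "UNIV = {1, 2, 3, 4, 5, 6 :: 6}" using exhaust_6 by auto
  show ?thesis unfolding U by (simp add: ac_simps)
qed

text \<open>
  In the six-element index type the numeral \<open>6\<close> denotes \<open>0\<close>, so the order \<open>1 < 2 < \<dots> < 6\<close> of the
  coframe is transferred from the natural numbers.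
\<close>

definition index :: "6 \<Rightarrow> nat" where
  "index i = (if i = 1 then 1 else if i = 2 then 2 else if i = 3 then 3
     else if i = 4 then 4 else if i = 5 then 5 else 6)"

lemma index_simps [simp]:
  "index 1 = 1" "index 2 = 2" "index 3 = 3" "index 4 = 4" "index 5 = 5" "index 6 = 6"
  by (simp_all add: index_def)

text \<open>
  A form is put into normal form by distributing all products and sorting the factors of
  every monomial by index.
\<close>

lemmas exterior_ring = wedge_assoc wedge_add_left wedge_add_right wedge_scale_left
  wedge_scale_right wedge_zero form_minus scale_add scale_scale scale_zero

lemma exterior_sort:
  assumes "\<And>i :: 6. one_form (f i)"
  shows "index j < index i \<Longrightarrow> f i \<^bold>\<and> f j = (- 1) *\<^sub>F (f j \<^bold>\<and> f i)"
    "index j < index i \<Longrightarrow> f i \<^bold>\<and> f j \<^bold>\<and> \<alpha> = (- 1) *\<^sub>F (f j \<^bold>\<and> f i \<^bold>\<and> \<alpha>)"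
    "f i \<^bold>\<and> f i = 0" "f i \<^bold>\<and> f i \<^bold>\<and> \<alpha> = 0"
    "interior_product v (f i \<^bold>\<and> \<alpha>) = f i [v] *\<^sub>F \<alpha> + (- 1) *\<^sub>F (f i \<^bold>\<and> interior_product v \<alpha>)"
    "\<alpha> \<^bold>\<and> interior_product v (f i) = f i [v] *\<^sub>F \<alpha>"
  using assms one_forms_anticommute[of "f i" "f j"] one_forms_left_commute[of "f i" "f j" \<alpha>]
    one_form_square[of "f i"] interior_wedge_one_form[of "f i"] wedge_interior_one_form[of "f i"]
  by blast+

lemma interior_linear:
  "interior_product v (\<alpha> + \<beta>) = interior_product v \<alpha> + interior_product v \<beta>"
  "interior_product v (c *\<^sub>F \<alpha>) = c *\<^sub>F interior_product v \<alpha>"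
  by (simp_all add: interior_product_def form_fun_simps)

text \<open>
  Wedging with \<open>\<omega>\<close> maps the 20-dimensional space of 3-forms onto the 6-dimensional space of
  5-forms; the fourteen coefficients parametrise its kernel.
\<close>

definition primitive3 :: "(6 \<Rightarrow> 'v form) \<Rightarrow> real \<Rightarrow> real \<Rightarrow> real \<Rightarrow> real \<Rightarrow> real \<Rightarrow> real \<Rightarrow> real \<Rightarrow> real \<Rightarrow>
    real \<Rightarrow> real \<Rightarrow> real \<Rightarrow> real \<Rightarrow> real \<Rightarrow> real \<Rightarrow> 'v form" where
  "primitive3 f A B C D E F G H I J K L M N =
      A *\<^sub>F triple f 1 3 5 + B *\<^sub>F triple f 1 3 6 + C *\<^sub>F triple f 1 4 5 + D *\<^sub>F triple f 1 4 6
    + E *\<^sub>F triple f 2 3 5 + F *\<^sub>F triple f 2 3 6 + G *\<^sub>F triple f 2 4 5 + H *\<^sub>F triple f 2 4 6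
    + (I *\<^sub>F f 1 + J *\<^sub>F f 2) \<^bold>\<and> (f 3 \<^bold>\<and> f 4 - f 5 \<^bold>\<and> f 6)
    + (K *\<^sub>F f 3 + L *\<^sub>F f 4) \<^bold>\<and> (f 1 \<^bold>\<and> f 2 - f 5 \<^bold>\<and> f 6)
    + (M *\<^sub>F f 5 + N *\<^sub>F f 6) \<^bold>\<and> (f 1 \<^bold>\<and> f 2 - f 3 \<^bold>\<and> f 4)"

text \<open>
  Naming the fifteen coefficients reduces an equation between 2-forms to fifteen equations
  between real numbers.
\<close>

definition two_form :: "(6 \<Rightarrow> 'v form) \<Rightarrow> real \<Rightarrow> real \<Rightarrow> real \<Rightarrow> real \<Rightarrow> real \<Rightarrow> real \<Rightarrow> real \<Rightarrow>
    real \<Rightarrow> real \<Rightarrow> real \<Rightarrow> real \<Rightarrow> real \<Rightarrow> real \<Rightarrow> real \<Rightarrow> real \<Rightarrow> 'v form" where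
  "two_form f c12 c13 c14 c15 c16 c23 c24 c25 c26 c34 c35 c36 c45 c46 c56 =
     c12 *\<^sub>F (f 1 \<^bold>\<and> f 2) + c13 *\<^sub>F (f 1 \<^bold>\<and> f 3) + c14 *\<^sub>F (f 1 \<^bold>\<and> f 4) + c15 *\<^sub>F (f 1 \<^bold>\<and> f 5)
       + c16 *\<^sub>F (f 1 \<^bold>\<and> f 6) + c23 *\<^sub>F (f 2 \<^bold>\<and> f 3) + c24 *\<^sub>F (f 2 \<^bold>\<and> f 4) + c25 *\<^sub>F (f 2 \<^bold>\<and> f 5)
       + c26 *\<^sub>F (f 2 \<^bold>\<and> f 6) + c34 *\<^sub>F (f 3 \<^bold>\<and> f 4) + c35 *\<^sub>F (f 3 \<^bold>\<and> f 5) + c36 *\<^sub>F (f 3 \<^bold>\<and> f 6)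
       + c45 *\<^sub>F (f 4 \<^bold>\<and> f 5) + c46 *\<^sub>F (f 4 \<^bold>\<and> f 6) + c56 *\<^sub>F (f 5 \<^bold>\<and> f 6)"

text \<open>
  The contraction of the volume form with the vector that has coordinates \<open>y1\<close>, \<dots>, \<open>y6\<close> in the
  dual basis. Every 5-form has this shape, which makes the defining equation of \<open>K_op\<close> solvable.
\<close>

definition volume_contraction :: "(6 \<Rightarrow> 'v form) \<Rightarrow> real \<Rightarrow> real \<Rightarrow> real \<Rightarrow> real \<Rightarrow> real \<Rightarrow> real \<Rightarrow> 'v
  form" where
  "volume_contraction f y1 y2 y3 y4 y5 y6 =
     y1 *\<^sub>F (f 2 \<^bold>\<and> f 3 \<^bold>\<and> f 4 \<^bold>\<and> f 5 \<^bold>\<and> f 6) - y2 *\<^sub>F (f 1 \<^bold>\<and> f 3 \<^bold>\<and> f 4 \<^bold>\<and> f 5 \<^bold>\<and> f 6)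
   + y3 *\<^sub>F (f 1 \<^bold>\<and> f 2 \<^bold>\<and> f 4 \<^bold>\<and> f 5 \<^bold>\<and> f 6) - y4 *\<^sub>F (f 1 \<^bold>\<and> f 2 \<^bold>\<and> f 3 \<^bold>\<and> f 5 \<^bold>\<and> f 6)
   + y5 *\<^sub>F (f 1 \<^bold>\<and> f 2 \<^bold>\<and> f 3 \<^bold>\<and> f 4 \<^bold>\<and> f 6) - y6 *\<^sub>F (f 1 \<^bold>\<and> f 2 \<^bold>\<and> f 3 \<^bold>\<and> f 4 \<^bold>\<and> f 5)"

context
  fixes f :: "6 \<Rightarrow> 'v form"
  assumes f: "\<And>i. one_form (f i)"
begin

lemma symplectic_cube:
  "volume (f 1 \<^bold>\<and> f 2 + f 3 \<^bold>\<and> f 4 + f 5 \<^bold>\<and> f 6) = f 1 \<^bold>\<and> f 2 \<^bold>\<and> f 3 \<^bold>\<and> f 4 \<^bold>\<and> f 5 \<^bold>\<and> f 6"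
proof -
  let ?\<omega> = "f 1 \<^bold>\<and> f 2 + f 3 \<^bold>\<and> f 4 + f 5 \<^bold>\<and> f 6"
  have "?\<omega> \<^bold>\<and> ?\<omega> = 2 *\<^sub>F (f 1 \<^bold>\<and> f 2 \<^bold>\<and> f 3 \<^bold>\<and> f 4)
      + 2 *\<^sub>F (f 1 \<^bold>\<and> f 2 \<^bold>\<and> f 5 \<^bold>\<and> f 6) + 2 *\<^sub>F (f 3 \<^bold>\<and> f 4 \<^bold>\<and> f 5 \<^bold>\<and> f 6)"
    by (simp add: exterior_ring exterior_sort[of f, OF f]) (simp add: form_fun_simps)
  then show ?thesis
    by (simp add: volume_def exterior_ring exterior_sort[of f, OF f])
      (simp add: form_fun_simps fact_numeral)
qed

lemma omega_wedge_primitive3: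
  "(f 1 \<^bold>\<and> f 2 + f 3 \<^bold>\<and> f 4 + f 5 \<^bold>\<and> f 6) \<^bold>\<and> primitive3 f A B C D E F G H I J K L M N = 0"
  by (simp add: primitive3_def triple_def exterior_ring exterior_sort[of f, OF f])
    (simp add: form_fun_simps algebra_simps)

text \<open>
  The coefficients are the values of \<open>\<phi>\<close> on the contracted vector and two dual basis vectors.
\<close>

lemma interior_primitive3:
  "interior_product v (primitive3 f A B C D E F G H I J K L M N) = two_form f
      (K * f 3 [v] + L * f 4 [v] + M * f 5 [v] + N * f 6 [v])
      (- K * f 2 [v] + I * f 4 [v] + A * f 5 [v] + B * f 6 [v])
      (- L * f 2 [v] - I * f 3 [v] + C * f 5 [v] + D * f 6 [v])
      (- M * f 2 [v] - A * f 3 [v] - C * f 4 [v] - I * f 6 [v])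
      (- N * f 2 [v] - B * f 3 [v] - D * f 4 [v] + I * f 5 [v])
      (K * f 1 [v] + J * f 4 [v] + E * f 5 [v] + F * f 6 [v])
      (L * f 1 [v] - J * f 3 [v] + G * f 5 [v] + H * f 6 [v])
      (M * f 1 [v] - E * f 3 [v] - G * f 4 [v] - J * f 6 [v])
      (N * f 1 [v] - F * f 3 [v] - H * f 4 [v] + J * f 5 [v])
      (I * f 1 [v] + J * f 2 [v] - M * f 5 [v] - N * f 6 [v])
      (A * f 1 [v] + E * f 2 [v] + M * f 4 [v] - K * f 6 [v])
      (B * f 1 [v] + F * f 2 [v] + N * f 4 [v] + K * f 5 [v])
      (C * f 1 [v] + G * f 2 [v] - M * f 3 [v] - L * f 6 [v])
      (D * f 1 [v] + H * f 2 [v] - N * f 3 [v] + L * f 5 [v])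
      (- I * f 1 [v] - J * f 2 [v] - K * f 3 [v] - L * f 4 [v])"
  by (simp add: primitive3_def triple_def two_form_def exterior_ring exterior_sort[of f, OF f]
    interior_linear)
    (simp add: form_fun_simps algebra_simps)

lemma two_form_wedge_primitive3:
  "two_form f c12 c13 c14 c15 c16 c23 c24 c25 c26 c34 c35 c36 c45 c46 c56 \<^bold>\<and>
     primitive3 f A B C D E F G H I J K L M N = volume_contraction f
      (-E * c46 + F * c45 + G * c36 - H * c35 - J * c34 + J * c56 + K * c24 - L * c23 + M * c26
        - N * c25)
      (A * c46 - B * c45 - C * c36 + D * c35 + I * c34 - I * c56 - K * c14 + L * c13 - M * c16
        + N * c15)
      (C * c26 - D * c25 - G * c16 + H * c15 - I * c24 + J * c14 - L * c12 + L * c56 - M * c46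
        + N * c45)
      (-A * c26 + B * c25 + E * c16 - F * c15 + I * c23 - J * c13 + K * c12 - K * c56 + M * c36
        - N * c35)
      (-B * c24 + D * c23 + F * c14 - H * c13 + I * c26 - J * c16 + K * c46 - L * c36 - N * c12
        + N * c34)
      (A * c24 - C * c23 - E * c14 + G * c13 - I * c25 + J * c15 - K * c45 + L * c35 + M * c12
        - M * c34)"
  by (simp add: primitive3_def triple_def two_form_def volume_contraction_def exterior_ring
    exterior_sort[of f, OF f])
    (simp add: form_fun_simps algebra_simps)

lemma interior_volume:
  "interior_product v (f 1 \<^bold>\<and> f 2 \<^bold>\<and> f 3 \<^bold>\<and> f 4 \<^bold>\<and> f 5 \<^bold>\<and> f 6) =
     volume_contraction f (f 1 [v]) (f 2 [v]) (f 3 [v]) (f 4 [v]) (f 5 [v]) (f 6 [v])"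
  by (simp add: volume_contraction_def exterior_ring exterior_sort[of f, OF f])

lemma primitive3_wedge_primitive3:
  "primitive3 f A B C D E F G H I J K L M N \<^bold>\<and>
     primitive3 f A' B' C' D' E' F' G' H' I' J' K' L' M' N' =
     (-A * H' + A' * H + B * G' - B' * G + C * F' - C' * F - D * E' + D' * E - 2 * I * J'
       + 2 * I' * J - 2 * K * L' + 2 * K' * L - 2 * M * N' + 2 * M' * N)
       *\<^sub>F (f 1 \<^bold>\<and> f 2 \<^bold>\<and> f 3 \<^bold>\<and> f 4 \<^bold>\<and> f 5 \<^bold>\<and> f 6)"
  by (simp add: primitive3_def triple_def exterior_ring exterior_sort[of f, OF f])
    (simp add: form_fun_simps algebra_simps)

end

section \<open>Symplectic coframes and their dual bases\<close>

text \<open>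
  Six one-forms without a common zero define an injective, hence bijective, linear map of \<open>\<real>\<^sup>6\<close>;
  the dual basis consists of the preimages of the standard basis.
\<close>

lemma dual_basis_if_injective:
  fixes f :: "6 \<Rightarrow> (real^6) form"
  assumes "\<And>i. alternating_form 1 (f i)" "\<And>v. (\<And>i. f i [v] = 0) \<Longrightarrow> v = 0"
  obtains b where "\<And>i j. f i [b j] = (if i = j then 1 else 0)"
    "\<And>v. v = (\<Sum>i\<in>UNIV. f i [v] *\<^sub>R b i)"
proof -
  note f = one_form_linear[OF assms(1)]
  define T where "T v = (\<chi> i. f i [v])" for v
  have T: "linear T" by (rule linearI) (simp_all add: T_def f vec_eq_iff)
  have "v = 0" if "T v = 0" for v
  proof (rule assms(2))
    show "f i [v] = 0" for i using arg_cong[OF that, of "\<lambda>x. x $ i"] by (simp add: T_def)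
  qed
  then have inj: "inj T" using T by (simp add: linear_injective_0)
  then have surj: "surj T" using T linear_injective_imp_surjective by blast
  define b where "b j = inv_into UNIV T (axis j 1)" for j
  have Tb: "T (b j) = axis j 1" for j
    by (simp add: b_def surj surj_f_inv_f)
  show ?thesis
  proof
    show dual: "f i [b j] = (if i = j then 1 else 0)" for i j
      using arg_cong[OF Tb[of j], of "\<lambda>x. x $ i"] by (simp add: T_def axis_def)
    show "v = (\<Sum>i\<in>UNIV. f i [v] *\<^sub>R b i)" for v
    proof (rule injD[OF inj])
      show "T v = T (\<Sum>i\<in>UNIV. f i [v] *\<^sub>R b i)"
        unfolding linear_sum[OF T] linear_scale[OF T] Tb
        by (simp add: T_def vec_eq_iff axis_def if_distrib cong: if_cong)
    qed
  qed
qed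

lemma symplectic_coframeI:
  fixes f :: "6 \<Rightarrow> (real^6) form"
  assumes alt: "\<And>i. alternating_form 1 (f i)" and inj: "\<And>v. (\<And>i. f i [v] = 0) \<Longrightarrow> v = 0"
    and \<omega>: "\<omega> = f 1 \<^bold>\<and> f 2 + f 3 \<^bold>\<and> f 4 + f 5 \<^bold>\<and> f 6"
  shows "symplectic_coframe \<omega> f"
  unfolding symplectic_coframe_def
proof (intro conjI allI impI \<omega> alt)
  obtain b where b: "\<And>i j. f i [b j] = (if i = j then 1 else 0)"
    and expand: "\<And>v. v = (\<Sum>i\<in>UNIV. f i [v] *\<^sub>R b i)"
    by (rule dual_basis_if_injective[of f, OF alt inj]) (auto intro: that)
  have ap: "(\<Sum>i\<in>UNIV. c i *\<^sub>F f i) vs = (\<Sum>i\<in>UNIV. c i * f i vs)" for c vs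
    by (simp add: sum_6 form_scale_apply)
  fix \<alpha> :: "(real^6) form" assume \<alpha>: "alternating_form 1 \<alpha>"
  show "\<exists>!c. \<alpha> = (\<Sum>i\<in>UNIV. c i *\<^sub>F f i)"
  proof (rule ex1I[of _ "\<lambda>i. \<alpha> [b i]"])
    show "\<alpha> = (\<Sum>i\<in>UNIV. \<alpha> [b i] *\<^sub>F f i)"
    proof
      fix vs :: "(real^6) list"
      show "\<alpha> vs = (\<Sum>i\<in>UNIV. \<alpha> [b i] *\<^sub>F f i) vs"
      proof (cases "length vs = 1")
        case True
        then obtain v where vs: "vs = [v]" by (auto simp: length_Suc_conv)
        have "\<alpha> [v] = \<alpha> [\<Sum>i\<in>UNIV. f i [v] *\<^sub>R b i]" using expand[of v] by simp
        also have "\<dots> = (\<Sum>i\<in>UNIV. f i [v] * \<alpha> [b i])"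
          by (simp add: sum_6 one_form_linear[OF \<alpha>])
        finally show ?thesis by (simp add: vs ap mult.commute)
      next
        case False
        then show ?thesis
          using one_form_linear(1)[OF \<alpha>] one_form_linear(1)[OF alt] by (simp add: ap one_form_def)
      qed
    qed
    fix c assume c: "\<alpha> = (\<Sum>i\<in>UNIV. c i *\<^sub>F f i)"
    show "c = (\<lambda>i. \<alpha> [b i])"
      by (simp add: c ap b fun_eq_iff if_distrib cong: if_cong)
  qed
qed

text \<open>
  A common zero \<open>v\<close> of the coframe is annihilated by every one-form, in particular by the one-form
  \<open>u \<mapsto> u \<bullet> v\<close>.
\<close>

lemma symplectic_coframe_dual:
  fixes f :: "6 \<Rightarrow> (real^6) form"
  assumes "symplectic_coframe \<omega> f"
  obtains b where "\<And>i j. f i [b j] = (if i = j then 1 else 0)"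
    "\<And>v. v = (\<Sum>i\<in>UNIV. f i [v] *\<^sub>R b i)"
proof (rule dual_basis_if_injective)
  show alt: "alternating_form 1 (f i)" for i
    using assms by (simp add: symplectic_coframe_def)
  fix v assume v: "\<And>i. f i [v] = 0"
  define \<alpha> :: "(real^6) form" where "\<alpha> = (\<lambda>us. case us of [u] \<Rightarrow> u \<bullet> v | _ \<Rightarrow> 0)"
  have "alternating_form 1 \<alpha>"
  proof (rule alternating_one_formI)
    show "one_form \<alpha>"
      by (auto simp: one_form_def \<alpha>_def split: list.splits)
    show "linear (\<lambda>u. \<alpha> [u])"
      by (rule linearI) (simp_all add: \<alpha>_def inner_add_left)
  qed
  then obtain c where "\<alpha> = (\<Sum>i\<in>UNIV. c i *\<^sub>F f i)"
    using assms unfolding symplectic_coframe_def by blast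
  then have "\<alpha> [v] = (\<Sum>i\<in>UNIV. c i * f i [v])"
    by (simp add: sum_6 form_scale_def)
  then show "v = 0" by (simp add: \<alpha>_def v)
qed (rule that)

section \<open>The invariants of a primitive 3-form\<close>

context
  fixes \<omega> :: "(real^6) form" and f :: "6 \<Rightarrow> (real^6) form"
  assumes sympl: "symplectic_coframe \<omega> f"
begin

lemma frame_alternating: "alternating_form 1 (f i)"
  using sympl by (simp add: symplectic_coframe_def)

lemmas frame_one = one_form_linear[OF frame_alternating]

lemma frame_omega: "\<omega> = f 1 \<^bold>\<and> f 2 + f 3 \<^bold>\<and> f 4 + f 5 \<^bold>\<and> f 6"
  using sympl by (simp add: symplectic_coframe_def)

lemma frame_omega_apply:
  "\<omega> [v, w] = f 1 [v] * f 2 [w] - f 1 [w] * f 2 [v] + (f 3 [v] * f 4 [w] - f 3 [w] * f 4 [v])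
     + (f 5 [v] * f 6 [w] - f 5 [w] * f 6 [v])"
  by (simp add: frame_omega one_forms_wedge_apply frame_one(1))

lemma frame_volume: "volume \<omega> = f 1 \<^bold>\<and> f 2 \<^bold>\<and> f 3 \<^bold>\<and> f 4 \<^bold>\<and> f 5 \<^bold>\<and> f 6"
  unfolding frame_omega by (rule symplectic_cube) (rule frame_one)

text \<open>
  The coordinates are recovered, up to sign, by evaluation on five of the six dual basis
  vectors.
\<close>

lemma volume_contraction_inject:
  "volume_contraction f y1 y2 y3 y4 y5 y6 = volume_contraction f z1 z2 z3 z4 z5 z6 \<longleftrightarrow>
     y1 = z1 \<and> y2 = z2 \<and> y3 = z3 \<and> y4 = z4 \<and> y5 = z5 \<and> y6 = z6"
proof -
  obtain b where b: "\<And>i j. f i [b j] = (if i = j then 1 else 0)"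
    using symplectic_coframe_dual[OF sympl] by metis
  note ap = wedge_apply_Cons[OF frame_one(1)]
  have ev: "volume_contraction f y1 y2 y3 y4 y5 y6 [b 2, b 3, b 4, b 5, b 6] = y1"
    "volume_contraction f y1 y2 y3 y4 y5 y6 [b 1, b 3, b 4, b 5, b 6] = - y2"
    "volume_contraction f y1 y2 y3 y4 y5 y6 [b 1, b 2, b 4, b 5, b 6] = y3"
    "volume_contraction f y1 y2 y3 y4 y5 y6 [b 1, b 2, b 3, b 5, b 6] = - y4"
    "volume_contraction f y1 y2 y3 y4 y5 y6 [b 1, b 2, b 3, b 4, b 6] = y5"
    "volume_contraction f y1 y2 y3 y4 y5 y6 [b 1, b 2, b 3, b 4, b 5] = - y6" for y1 y2 y3 y4 y5 y6
    by (simp_all add: volume_contraction_def exterior_ring form_scale_apply ap b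
        interior_linear interior_zero exterior_sort(5,6)[of f, OF frame_one(1)])
  show ?thesis by (metis ev neg_equal_iff_equal)
qed

text \<open>
  The coordinates of the 5-form \<open>- \<iota>\<^sub>v \<phi> \<and> \<phi>\<close> determine the vector whose contraction with the
  volume form it is. They are linear in \<open>v\<close> and quadratic in \<open>\<phi>\<close>.
\<close>

lemma K_op_primitive3:
  shows "f 1 [K_op \<omega> (primitive3 f A B C D E F G H I J K L M N) v] =
      (A * H - B * G - C * F + D * E + 2 * I * J) * f 1 [v]
      + (2 * E * H - 2 * F * G + 2 * J * J) * f 2 [v]
      + (-2 * E * N + 2 * F * M + 2 * J * K) * f 3 [v]
      + (-2 * G * N + 2 * H * M + 2 * J * L) * f 4 [v]
      + (2 * E * L - 2 * G * K - 2 * J * M) * f 5 [v]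
      + (2 * F * L - 2 * H * K - 2 * J * N) * f 6 [v]"
    (is "_ = ?y1")
  "f 2 [K_op \<omega> (primitive3 f A B C D E F G H I J K L M N) v] =
      (-2 * A * D + 2 * B * C - 2 * I * I) * f 1 [v]
      + (-A * H + B * G + C * F - D * E - 2 * I * J) * f 2 [v]
      + (2 * A * N - 2 * B * M - 2 * I * K) * f 3 [v]
      + (2 * C * N - 2 * D * M - 2 * I * L) * f 4 [v]
      + (-2 * A * L + 2 * C * K + 2 * I * M) * f 5 [v]
      + (-2 * B * L + 2 * D * K + 2 * I * N) * f 6 [v]"
    (is "_ = ?y2")
  "f 3 [K_op \<omega> (primitive3 f A B C D E F G H I J K L M N) v] =
      (-2 * C * N + 2 * D * M + 2 * I * L) * f 1 [v]
      + (-2 * G * N + 2 * H * M + 2 * J * L) * f 2 [v]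
      + (A * H - B * G + C * F - D * E + 2 * K * L) * f 3 [v]
      + (2 * C * H - 2 * D * G + 2 * L * L) * f 4 [v]
      + (-2 * C * J + 2 * G * I + 2 * L * M) * f 5 [v]
      + (-2 * D * J + 2 * H * I + 2 * L * N) * f 6 [v]"
    (is "_ = ?y3")
  "f 4 [K_op \<omega> (primitive3 f A B C D E F G H I J K L M N) v] =
      (2 * A * N - 2 * B * M - 2 * I * K) * f 1 [v]
      + (2 * E * N - 2 * F * M - 2 * J * K) * f 2 [v]
      + (-2 * A * F + 2 * B * E - 2 * K * K) * f 3 [v]
      + (-A * H + B * G - C * F + D * E - 2 * K * L) * f 4 [v]
      + (2 * A * J - 2 * E * I - 2 * K * M) * f 5 [v]
      + (2 * B * J - 2 * F * I - 2 * K * N) * f 6 [v]"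
    (is "_ = ?y4")
  "f 5 [K_op \<omega> (primitive3 f A B C D E F G H I J K L M N) v] =
      (2 * B * L - 2 * D * K - 2 * I * N) * f 1 [v]
      + (2 * F * L - 2 * H * K - 2 * J * N) * f 2 [v]
      + (-2 * B * J + 2 * F * I + 2 * K * N) * f 3 [v]
      + (-2 * D * J + 2 * H * I + 2 * L * N) * f 4 [v]
      + (A * H + B * G - C * F - D * E + 2 * M * N) * f 5 [v]
      + (2 * B * H - 2 * D * F + 2 * N * N) * f 6 [v]"
    (is "_ = ?y5")
  "f 6 [K_op \<omega> (primitive3 f A B C D E F G H I J K L M N) v] =
      (-2 * A * L + 2 * C * K + 2 * I * M) * f 1 [v]
      + (-2 * E * L + 2 * G * K + 2 * J * M) * f 2 [v]
      + (2 * A * J - 2 * E * I - 2 * K * M) * f 3 [v]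
      + (2 * C * J - 2 * G * I - 2 * L * M) * f 4 [v]
      + (-2 * A * G + 2 * C * E - 2 * M * M) * f 5 [v]
      + (-A * H - B * G + C * F + D * E - 2 * M * N) * f 6 [v]"
    (is "_ = ?y6")
proof -
  let ?\<phi> = "primitive3 f A B C D E F G H I J K L M N"
  obtain b where b: "\<And>i j. f i [b j] = (if i = j then 1 else 0)"
    and expand: "\<And>v. v = (\<Sum>i\<in>UNIV. f i [v] *\<^sub>R b i)"
    using symplectic_coframe_dual[OF sympl] by metis
  note contr = frame_volume interior_volume[of f, OF frame_one(1)]
    interior_primitive3[of f, OF frame_one(1)] two_form_wedge_primitive3[of f, OF frame_one(1)]
  define y1 where "y1 = ?y1"
  define y2 where "y2 = ?y2"
  define y3 where "y3 = ?y3"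
  define y4 where "y4 = ?y4"
  define y5 where "y5 = ?y5"
  define y6 where "y6 = ?y6"
  have neg: "- volume_contraction f z1 z2 z3 z4 z5 z6 =
      volume_contraction f (- z1) (- z2) (- z3) (- z4) (- z5) (- z6)" for z1 z2 z3 z4 z5 z6
    by (simp add: volume_contraction_def form_fun_simps)
  have rhs: "- (interior_product v ?\<phi> \<^bold>\<and> ?\<phi>) = volume_contraction f y1 y2 y3 y4 y5 y6"
    unfolding contr neg volume_contraction_inject y1_def y2_def y3_def y4_def y5_def y6_def
    by (intro conjI; simp add: algebra_simps)
  have iff: "interior_product Y (volume \<omega>) = - (interior_product v ?\<phi> \<^bold>\<and> ?\<phi>) \<longleftrightarrow>
      f 1 [Y] = y1 \<and> f 2 [Y] = y2 \<and> f 3 [Y] = y3 \<and> f 4 [Y] = y4 \<and> f 5 [Y] = y5 \<and> f 6 [Y] = y6" for Y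
    unfolding rhs unfolding contr volume_contraction_inject by (rule refl)
  define Y where "Y = y1 *\<^sub>R b 1 + y2 *\<^sub>R b 2 + y3 *\<^sub>R b 3 + y4 *\<^sub>R b 4 + y5 *\<^sub>R b 5 + y6 *\<^sub>R b 6"
  have Y: "f 1 [Y] = y1" "f 2 [Y] = y2" "f 3 [Y] = y3" "f 4 [Y] = y4" "f 5 [Y] = y5" "f 6 [Y] = y6"
    by (simp_all add: Y_def frame_one b)
  have "K_op \<omega> ?\<phi> v = Y"
    unfolding K_op_def iff
  proof (rule the_equality)
    fix Z assume "f 1 [Z] = y1 \<and> f 2 [Z] = y2 \<and> f 3 [Z] = y3 \<and>
      f 4 [Z] = y4 \<and> f 5 [Z] = y5 \<and> f 6 [Z] = y6"
    then show "Z = Y"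
      by (subst expand) (simp add: sum_6 Y_def)
  qed (simp add: Y)
  then show "f 1 [K_op \<omega> ?\<phi> v] = ?y1"
    "f 2 [K_op \<omega> ?\<phi> v] = ?y2"
    "f 3 [K_op \<omega> ?\<phi> v] = ?y3"
    "f 4 [K_op \<omega> ?\<phi> v] = ?y4"
    "f 5 [K_op \<omega> ?\<phi> v] = ?y5"
    "f 6 [K_op \<omega> ?\<phi> v] = ?y6"
    using Y by (simp_all add: y1_def y2_def y3_def y4_def y5_def y6_def)
qed

lemma two_form_cong:
  assumes "c12 = d12" "c13 = d13" "c14 = d14" "c15 = d15" "c16 = d16"
    "c23 = d23" "c24 = d24" "c25 = d25" "c26 = d26" "c34 = d34"
    "c35 = d35" "c36 = d36" "c45 = d45" "c46 = d46" "c56 = d56"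
  shows "two_form f c12 c13 c14 c15 c16 c23 c24 c25 c26 c34 c35 c36 c45 c46 c56 =
    two_form f d12 d13 d14 d15 d16 d23 d24 d25 d26 d34 d35 d36 d45 d46 d56"
  using assms by simp

text \<open>
  After contraction with \<open>v\<close>, the claim compares the 2-forms \<open>- 2 \<iota>\<^sub>K\<^sub>v \<phi>\<close> and \<open>\<iota>\<^sub>v F\<close>, whose
  coefficients are linear in the coordinates of \<open>v\<close> and cubic in those of \<open>\<phi>\<close>. That \<open>F(\<phi>)\<close> is again
  a primitive 3-form is part of the conclusion.
\<close>

lemma F_form_primitive3:
  "F_form \<omega> (primitive3 f A B C D E F G H I J K L M N) = primitive3 f
      (- 2 * (A * A * H - A * B * G - A * C * F - A * D * E + 2 * A * I * J + 2 * A * K * L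
        + 2 * A * M * N + 2 * B * C * E - 2 * B * M * M - 2 * C * K * K - 2 * E * I * I
        - 4 * I * K * M))
      (- 2 * (A * B * H - 2 * A * D * F + 2 * A * N * N - B * B * G + B * C * F + B * D * E
        + 2 * B * I * J + 2 * B * K * L - 2 * B * M * N - 2 * D * K * K - 2 * F * I * I
        - 4 * I * K * N))
      (- 2 * (A * C * H - 2 * A * D * G + 2 * A * L * L + B * C * G - C * C * F + C * D * E
        + 2 * C * I * J - 2 * C * K * L + 2 * C * M * N - 2 * D * M * M - 2 * G * I * I
        - 4 * I * L * M))
      (- 2 * (-A * D * H + 2 * B * C * H - B * D * G + 2 * B * L * L - C * D * F + 2 * C * N * N
        + D * D * E + 2 * D * I * J - 2 * D * K * L - 2 * D * M * N - 2 * H * I * I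
        - 4 * I * L * N))
      (- 2 * (A * E * H - 2 * A * F * G + 2 * A * J * J + B * E * G + C * E * F - D * E * E
        - 2 * E * I * J + 2 * E * K * L + 2 * E * M * N - 2 * F * M * M - 2 * G * K * K
        - 4 * J * K * M))
      (- 2 * (-A * F * H + 2 * B * E * H - B * F * G + 2 * B * J * J + C * F * F - D * E * F
        + 2 * E * N * N - 2 * F * I * J + 2 * F * K * L - 2 * F * M * N - 2 * H * K * K
        - 4 * J * K * N))
      (- 2 * (-A * G * H + B * G * G + 2 * C * E * H - C * F * G + 2 * C * J * J - D * E * G
        + 2 * E * L * L - 2 * G * I * J - 2 * G * K * L + 2 * G * M * N - 2 * H * M * M
        - 4 * J * L * M))
      (- 2 * (-A * H * H + B * G * H + C * F * H + D * E * H - 2 * D * F * G + 2 * D * J * J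
        + 2 * F * L * L + 2 * G * N * N - 2 * H * I * J - 2 * H * K * L - 2 * H * M * N
        - 4 * J * L * N))
      (- 2 * (-2 * A * D * J + A * H * I + 2 * A * L * N + 2 * B * C * J - B * G * I
        - 2 * B * L * M - C * F * I - 2 * C * K * N + D * E * I + 2 * D * K * M))
      (- 2 * (-A * H * J + B * G * J + C * F * J - D * E * J + 2 * E * H * I + 2 * E * L * N
        - 2 * F * G * I - 2 * F * L * M - 2 * G * K * N + 2 * H * K * M))
      (- 2 * (-2 * A * F * L + A * H * K + 2 * A * J * N + 2 * B * E * L - B * G * K
        - 2 * B * J * M + C * F * K - D * E * K - 2 * E * I * N + 2 * F * I * M))
      (- 2 * (-A * H * L + B * G * L - C * F * L + 2 * C * H * K + 2 * C * J * N + D * E * L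
        - 2 * D * G * K - 2 * D * J * M - 2 * G * I * N + 2 * H * I * M))
      (- 2 * (-2 * A * G * N + A * H * M + 2 * A * J * L + B * G * M + 2 * C * E * N - C * F * M
        - 2 * C * J * K - D * E * M - 2 * E * I * L + 2 * G * I * K))
      (- 2 * (-A * H * N - B * G * N + 2 * B * H * M + 2 * B * J * L + C * F * N + D * E * N
        - 2 * D * F * M - 2 * D * J * K - 2 * F * I * L + 2 * H * I * K))"
  (is "_ = ?F")
proof
  fix vs :: "(real^6) list"
  have deg: "alternating_form 3 (primitive3 f A B C D E F G H I J K L M N)"
    for A B C D E F G H I J K L M N
    unfolding primitive3_def triple_def exterior_ring numeral_3_eq_3
    by (intro alternating_form_add alternating_form_scale alternating_form_wedge
      frame_alternating frame_alternating[unfolded One_nat_def])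
  show "F_form \<omega> (primitive3 f A B C D E F G H I J K L M N) vs = ?F vs"
  proof (cases "length vs = 3")
    case False
    then show ?thesis
      using deg by (auto simp: F_form_def alternating_form_def split: list.splits)
  next
    case True
    then obtain v Y Z where vs: "vs = [v, Y, Z]"
      by (auto simp: numeral_3_eq_3 length_Suc_conv)
    let ?K = "K_op \<omega> (primitive3 f A B C D E F G H I J K L M N) v"
    have scale: "c *\<^sub>F two_form f c12 c13 c14 c15 c16 c23 c24 c25 c26 c34 c35 c36 c45 c46 c56 =
      two_form f (c * c12) (c * c13) (c * c14) (c * c15) (c * c16) (c * c23) (c * c24) (c * c25)
      (c * c26) (c * c34) (c * c35) (c * c36) (c * c45) (c * c46) (c * c56)"
      for c c12 c13 c14 c15 c16 c23 c24 c25 c26 c34 c35 c36 c45 c46 c56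
      by (simp add: two_form_def form_fun_simps algebra_simps)
    have "(- 2) *\<^sub>F interior_product ?K (primitive3 f A B C D E F G H I J K L M N) =
      interior_product v ?F"
      unfolding interior_primitive3[of f, OF frame_one(1)] scale K_op_primitive3
      by (rule two_form_cong) (simp add: algebra_simps)+
    from fun_cong[OF this, of "[Y, Z]"] show ?thesis
      by (simp add: vs F_form_def interior_product_def form_scale_def)
  qed
qed

text \<open>
  The four coefficients set to zero are those that vanish for a closed left-invariant form; the
  last summand vanishes for a stationary one.
\<close>

lemma Q_num_reduced:
  "Q_num \<omega> (primitive3 f A B C D E F G 0 I 0 K 0 M 0) =
     4 * (2 * (B\<^sup>2 * G\<^sup>2 + C\<^sup>2 * F\<^sup>2 + D\<^sup>2 * E\<^sup>2) - (B * G + C * F + D * E)\<^sup>2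
       + 4 * (I\<^sup>2 * F * G + K\<^sup>2 * D * G + M\<^sup>2 * D * F) + 4 * A * D * F * G)"
  (is "_ = ?q")
proof -
  let ?\<phi> = "primitive3 f A B C D E F G 0 I 0 K 0 M 0"
  let ?v = "f 1 \<^bold>\<and> f 2 \<^bold>\<and> f 3 \<^bold>\<and> f 4 \<^bold>\<and> f 5 \<^bold>\<and> f 6"
  have *: "?\<phi> \<^bold>\<and> F_form \<omega> ?\<phi> = (- ?q) *\<^sub>F ?v"
    unfolding F_form_primitive3 primitive3_wedge_primitive3[of f, OF frame_one(1)]
    by (rule arg_cong[where f = "\<lambda>c. c *\<^sub>F ?v"]) (simp add: algebra_simps power2_eq_square)
  have "?v \<noteq> 0"
  proof
    assume "?v = 0"
    obtain b where b: "\<And>i j. f i [b j] = (if i = j then 1 else 0)"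
      using symplectic_coframe_dual[OF sympl] by metis
    have "volume_contraction f 1 0 0 0 0 0 = interior_product (b 1) ?v"
      by (simp add: interior_volume[of f, OF frame_one(1)] b)
    also have "\<dots> = volume_contraction f 0 0 0 0 0 0"
      unfolding \<open>?v = 0\<close> by (simp add: interior_product_def volume_contraction_def form_fun_simps)
    finally show False by (simp add: volume_contraction_inject)
  qed
  then obtain vs where "?v vs \<noteq> 0" by (auto simp: fun_eq_iff)
  have iff: "a *\<^sub>F ?v = (- c) *\<^sub>F ?v \<longleftrightarrow> c = - a" for a c
  proof
    assume "a *\<^sub>F ?v = (- c) *\<^sub>F ?v"
    from fun_cong[OF this, of vs] have "(a + c) * ?v vs = 0"
      by (simp add: form_scale_apply algebra_simps)
    then show "c = - a" using \<open>?v vs \<noteq> 0\<close> by simp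
  qed simp
  show ?thesis
    unfolding Q_num_def frame_volume * iff by simp
qed

end

text \<open>
  A common zero of the new one-forms lies in the radical of \<open>\<omega>\<close>, which is trivial because \<open>\<omega>\<close>
  admits the coframe \<open>f\<close>. So preserving \<open>\<omega>\<close> is all that has to be checked for a change of coframe.
\<close>

lemma symplectic_coframe_change:
  fixes f :: "6 \<Rightarrow> (real^6) form"
  assumes f: "symplectic_coframe \<omega> f" and g: "\<And>i. alternating_form 1 (g i)"
    and \<omega>: "g 1 \<^bold>\<and> g 2 + g 3 \<^bold>\<and> g 4 + g 5 \<^bold>\<and> g 6 = \<omega>"
  shows "symplectic_coframe \<omega> g"
proof (rule symplectic_coframeI)
  fix v assume v: "\<And>i. g i [v] = 0"
  obtain b where b: "\<And>i j. f i [b j] = (if i = j then 1 else 0)"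
    and expand: "\<And>v. v = (\<Sum>i\<in>UNIV. f i [v] *\<^sub>R b i)"
    by (rule symplectic_coframe_dual[OF f]) (rule that)
  have "\<omega> [v, w] = 0" for w
    using one_form_linear(1)[OF g] by (simp add: \<omega>[symmetric] one_forms_wedge_apply v)
  from this[of "b 1"] this[of "b 2"] this[of "b 3"] this[of "b 4"] this[of "b 5"] this[of "b 6"]
  show "v = 0" unfolding frame_omega_apply[OF f] by (subst expand) (simp add: b sum_6)
qed (use assms in auto)

text \<open>
  The contraction with \<open>\<omega>\<close> is a trace and can be computed in any symplectic basis.
\<close>

lemma lefschetz_dual_basis:
  fixes f :: "6 \<Rightarrow> (real^6) form"
  assumes f: "symplectic_coframe \<omega> f"
    and b: "\<And>i j. f i [b j] = (if i = j then 1 else 0)"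
    and expand: "\<And>v. v = (\<Sum>i\<in>UNIV. f i [v] *\<^sub>R b i)"
    and \<beta>: "alternating_form (Suc (Suc k)) \<beta>"
  shows "lefschetz \<omega> \<beta> vs = \<beta> (b 1 # b 2 # vs) + \<beta> (b 3 # b 4 # vs) + \<beta> (b 5 # b 6 # vs)"
proof -
  note f1 = frame_one[OF f]
  note contr = alternating_form_contraction[OF \<beta>]
  \<comment> \<open>The vector that represents \<open>u \<bullet> _\<close> with respect to \<open>\<omega>\<close>.\<close>
  define W where "W u = (b 1 \<bullet> u) *\<^sub>R b 2 - (b 2 \<bullet> u) *\<^sub>R b 1 + (b 3 \<bullet> u) *\<^sub>R b 4 - (b 4 \<bullet> u) *\<^sub>R b 3
      + (b 5 \<bullet> u) *\<^sub>R b 6 - (b 6 \<bullet> u) *\<^sub>R b 5" for u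
  have fminus: "f i [v - w] = f i [v] - f i [w]" for i v w
    using f1(2)[of i "v - w" w] by simp
  have W: "(THE w. \<forall>v. \<omega> [v, w] = v \<bullet> u) = W u" for u
  proof (rule the_equality)
    have "\<omega> [v, W u] = (\<Sum>i\<in>UNIV. f i [v] *\<^sub>R b i) \<bullet> u" for v
      unfolding frame_omega_apply[OF f]
      by (simp add: W_def f1 fminus b sum_6 inner_add_left algebra_simps)
    then show "\<forall>v. \<omega> [v, W u] = v \<bullet> u" using expand by simp
    fix w assume "\<forall>v. \<omega> [v, w] = v \<bullet> u"
    with \<open>\<forall>v. \<omega> [v, W u] = v \<bullet> u\<close> have *: "\<omega> [v, w] = \<omega> [v, W u]" for v by simp
    from *[of "b 1"] *[of "b 2"] *[of "b 3"] *[of "b 4"] *[of "b 5"] *[of "b 6"]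
    have "f i [w] = f i [W u]" for i
      unfolding frame_omega_apply[OF f] using exhaust_6[of i] by (auto simp: b)
    then show "w = W u" by (subst (1 2) expand) simp
  qed
  have lin: "linear (\<lambda>w. \<beta> (u # w # vs))" for u
    using alternating_form_contraction(2)[OF contr(1)[of u]] by (simp add: interior_product_def)
  have lins: "\<beta> (u # (w - w') # vs) = \<beta> (u # w # vs) - \<beta> (u # w' # vs)"
    "\<beta> (u # (w + w') # vs) = \<beta> (u # w # vs) + \<beta> (u # w' # vs)"
    "\<beta> (u # (c *\<^sub>R w) # vs) = c * \<beta> (u # w # vs)" for u w w' c
    using linear_diff[OF lin] linear_add[OF lin] linear_scale[OF lin] by simp_all
  have skew: "\<beta> (u # w # vs) = - \<beta> (w # u # vs)" for u w
    using contr(3)[of "u + w" vs] contr(3)[of u vs] contr(3)[of w vs]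
    by (simp add: lins linear_add[OF contr(2)])
  have trace: "(\<Sum>u\<in>Basis. (a \<bullet> u) * \<beta> (u # w # vs)) = \<beta> (a # w # vs)" for a w
  proof -
    have "\<beta> ((\<Sum>u\<in>Basis. (a \<bullet> u) *\<^sub>R u) # w # vs) = (\<Sum>u\<in>Basis. (a \<bullet> u) * \<beta> (u # w # vs))"
      unfolding linear_sum[OF contr(2)] linear_scale[OF contr(2)] by simp
    then show ?thesis by (simp add: euclidean_representation)
  qed
  have "(\<Sum>u\<in>Basis. \<beta> (u # W u # vs)) =
      \<beta> (b 1 # b 2 # vs) - \<beta> (b 2 # b 1 # vs) + \<beta> (b 3 # b 4 # vs) - \<beta> (b 4 # b 3 # vs)
      + \<beta> (b 5 # b 6 # vs) - \<beta> (b 6 # b 5 # vs)"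
    by (simp add: W_def lins sum.distrib sum_subtractf trace)
  then show ?thesis
    unfolding lefschetz_def W
    using skew[of "b 2" "b 1"] skew[of "b 4" "b 3"] skew[of "b 6" "b 5"] by simp
qed


section \<open>Differential forms with polynomial coefficients\<close>

definition polynomial_dform :: "'v::real_normed_vector dform \<Rightarrow> bool" where
  "polynomial_dform \<alpha> \<longleftrightarrow> (\<forall>vs. real_polynomial_function (\<lambda>x. \<alpha> x vs))"

text \<open>
  Polynomial functions are closed under directional derivatives, hence smooth. All forms
  considered below have polynomial coefficients.
\<close>

lemma real_polynomial_function_derivative:
  assumes "real_polynomial_function p"
  shows "\<exists>p'. \<forall>x. (p has_derivative p' x) (at x) \<and> (\<forall>v. real_polynomial_function (\<lambda>x. p' x v))"
  using assms
proof induction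
  case (linear g)
  then show ?case
    by (intro exI[of _ "\<lambda>x. g"]) (auto intro: bounded_linear_imp_has_derivative
      real_polynomial_function.intros(2))
next
  case (const c)
  show ?case
    by (intro exI[of _ "\<lambda>x v. 0"]) (auto intro: real_polynomial_function.intros(2))
next
  case (add p q)
  then obtain p' q' where "\<And>x. (p has_derivative p' x) (at x)" "\<And>x. (q has_derivative q' x) (at x)"
    "\<And>v. real_polynomial_function (\<lambda>x. p' x v)" "\<And>v. real_polynomial_function (\<lambda>x. q' x v)"
    by blast
  then show ?case
    by (intro exI[of _ "\<lambda>x v. p' x v + q' x v"]) (auto intro: has_derivative_add
      real_polynomial_function.intros(3))
next
  case (mult p q)
  then obtain p' q' where "\<And>x. (p has_derivative p' x) (at x)" "\<And>x. (q has_derivative q' x) (at x)"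
    "\<And>v. real_polynomial_function (\<lambda>x. p' x v)" "\<And>v. real_polynomial_function (\<lambda>x. q' x v)"
    by blast
  with mult.hyps show ?case
    by (intro exI[of _ "\<lambda>x v. p x * q' x v + p' x v * q x"])
      (auto intro: has_derivative_mult real_polynomial_function.intros(3)[OF
        real_polynomial_function.intros(4) real_polynomial_function.intros(4)])
qed

lemma real_polynomial_function_differentiable:
  assumes "real_polynomial_function p"
  shows "p differentiable (at x)" "(p has_derivative frechet_derivative p (at x)) (at x)"
    "real_polynomial_function (\<lambda>x. frechet_derivative p (at x) v)"
proof -
  obtain p' where p': "\<And>x. (p has_derivative p' x) (at x)" "\<And>v. real_polynomial_function (\<lambda>x. p'
    x v)"
    using real_polynomial_function_derivative[OF assms] by blast
  then show "p differentiable (at x)" by (auto simp: differentiable_def)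
  then show "(p has_derivative frechet_derivative p (at x)) (at x)"
    by (simp add: frechet_derivative_works)
  have "frechet_derivative p (at x) = p' x" for x
    using p'(1) frechet_derivative_at by metis
  then show "real_polynomial_function (\<lambda>x. frechet_derivative p (at x) v)"
    using p'(2) by simp
qed

lemma real_polynomial_function_C_k: "real_polynomial_function p \<Longrightarrow> C_k k p"
proof (induction k arbitrary: p)
  case 0
  then show ?case
    by (auto intro!: differentiable_imp_continuous_on simp: differentiable_on_def
        real_polynomial_function_differentiable(1) differentiable_at_withinI)
qed (simp add: real_polynomial_function_differentiable)

lemma polynomial_dform_wedge:
  "polynomial_dform \<alpha> \<Longrightarrow> polynomial_dform \<beta> \<Longrightarrow> polynomial_dform (\<lambda>x. \<alpha> x \<^bold>\<and> \<beta> x)"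
  unfolding polynomial_dform_def wedge_def
  by (intro allI real_polynomial_function_sum real_polynomial_function.intros(4)
    real_polynomial_function.intros(2))
    auto

lemma polynomial_dform_add:
  "polynomial_dform \<alpha> \<Longrightarrow> polynomial_dform \<beta> \<Longrightarrow> polynomial_dform (\<lambda>x. \<alpha> x + \<beta> x)"
  by (simp add: polynomial_dform_def real_polynomial_function.intros(3))

lemma polynomial_dform_scale: "polynomial_dform \<alpha> \<Longrightarrow> polynomial_dform (\<lambda>x. c *\<^sub>F \<alpha> x)"
  by (simp add: polynomial_dform_def form_scale_def real_polynomial_function.intros(4)
    real_polynomial_function.intros(2))

lemma polynomial_dform_grade_sign: "polynomial_dform \<alpha> \<Longrightarrow> polynomial_dform (\<lambda>x. grade_sign (\<alpha> x))"
  by (simp add: polynomial_dform_def grade_sign_def real_polynomial_function.intros(4)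
    real_polynomial_function.intros(2))

lemma polynomial_dform_interior:
  "polynomial_dform \<alpha> \<Longrightarrow> polynomial_dform (\<lambda>x. interior_product v (\<alpha> x))"
  by (simp add: polynomial_dform_def interior_product_def)

lemma smooth_formI:
  "polynomial_dform \<alpha> \<Longrightarrow> (\<And>x. alternating_form k (\<alpha> x)) \<Longrightarrow> smooth_form k \<alpha>"
  by (simp add: smooth_form_def polynomial_dform_def real_polynomial_function_C_k)

lemma ext_d_Nil: "ext_d \<alpha> x [] = 0"
  by (simp add: ext_d_def)

text \<open>
  Cartan's formula \<open>\<iota>\<^sub>v d + d \<iota>\<^sub>v = L\<^sub>v\<close> for a constant vector field \<open>v\<close>. It reduces identities for
  the exterior derivative to inductions on the list of vectors.
\<close>

lemma ext_d_Cons: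
  "ext_d \<alpha> x (v # vs) = frechet_derivative (\<lambda>y. \<alpha> y vs) (at x) v
     - ext_d (\<lambda>y. interior_product v (\<alpha> y)) x vs"
  by (simp add: ext_d_def sum.lessThan_Suc_shift interior_product_def sum_negf del:
    sum.lessThan_Suc)

lemma frechet_derivative_form_add:
  assumes "polynomial_dform \<alpha>" "polynomial_dform \<beta>"
  shows "frechet_derivative (\<lambda>y. (\<alpha> y + \<beta> y) vs) (at x) v =
    frechet_derivative (\<lambda>y. \<alpha> y vs) (at x) v + frechet_derivative (\<lambda>y. \<beta> y vs) (at x) v"
proof -
  have "((\<lambda>y. \<alpha> y vs + \<beta> y vs) has_derivative
      (\<lambda>v. frechet_derivative (\<lambda>y. \<alpha> y vs) (at x) v + frechet_derivative (\<lambda>y. \<beta> y vs) (at x) v))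
        (at x)"
    using assms unfolding polynomial_dform_def
    by (intro has_derivative_add real_polynomial_function_differentiable(2)) auto
  then show ?thesis by (simp add: frechet_derivative_at[symmetric])
qed

lemma frechet_derivative_form_scale:
  assumes "polynomial_dform \<alpha>"
  shows "frechet_derivative (\<lambda>y. c * \<alpha> y vs) (at x) v =
    c * frechet_derivative (\<lambda>y. \<alpha> y vs) (at x) v"
proof -
  have "((\<lambda>y. c * \<alpha> y vs) has_derivative
      (\<lambda>v. c * frechet_derivative (\<lambda>y. \<alpha> y vs) (at x) v)) (at x)"
    using assms unfolding polynomial_dform_def
    by (intro has_derivative_mult_right real_polynomial_function_differentiable(2)) auto
  then show ?thesis by (simp add: frechet_derivative_at[symmetric])
qed

lemma frechet_derivative_wedge:
  assumes "polynomial_dform \<alpha>" "polynomial_dform \<beta>"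
  shows "frechet_derivative (\<lambda>y. (\<alpha> y \<^bold>\<and> \<beta> y) vs) (at x) v =
    ((\<lambda>us. frechet_derivative (\<lambda>y. \<alpha> y us) (at x) v) \<^bold>\<and> \<beta> x) vs
    + (\<alpha> x \<^bold>\<and> (\<lambda>us. frechet_derivative (\<lambda>y. \<beta> y us) (at x) v)) vs"
proof -
  have d: "((\<lambda>y. \<alpha> y us) has_derivative frechet_derivative (\<lambda>y. \<alpha> y us) (at x)) (at x)"
    "((\<lambda>y. \<beta> y us) has_derivative frechet_derivative (\<lambda>y. \<beta> y us) (at x)) (at x)" for us
    using assms unfolding polynomial_dform_def
      by (auto intro: real_polynomial_function_differentiable(2))
  have "((\<lambda>y. (\<alpha> y \<^bold>\<and> \<beta> y) vs) has_derivative
     (\<lambda>v. ((\<lambda>us. frechet_derivative (\<lambda>y. \<alpha> y us) (at x) v) \<^bold>\<and> \<beta> x) vs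
      + (\<alpha> x \<^bold>\<and> (\<lambda>us. frechet_derivative (\<lambda>y. \<beta> y us) (at x) v)) vs)) (at x)"
    unfolding wedge_def sum.distrib[symmetric]
    by (rule has_derivative_eq_rhs, (rule has_derivative_sum has_derivative_mult
      has_derivative_const d)+)
      (simp add: fun_eq_iff algebra_simps)
  then show ?thesis by (simp add: frechet_derivative_at[symmetric])
qed

lemma ext_d_add:
  assumes "polynomial_dform \<alpha>" "polynomial_dform \<beta>"
  shows "ext_d (\<lambda>y. \<alpha> y + \<beta> y) x = ext_d \<alpha> x + ext_d \<beta> x"
proof
  fix vs
  show "ext_d (\<lambda>y. \<alpha> y + \<beta> y) x vs = (ext_d \<alpha> x + ext_d \<beta> x) vs"
    using frechet_derivative_form_add[OF assms]
    by (simp add: ext_d_def sum.distrib algebra_simps)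
qed

lemma ext_d_scale:
  assumes "polynomial_dform \<alpha>"
  shows "ext_d (\<lambda>y. c *\<^sub>F \<alpha> y) x = c *\<^sub>F ext_d \<alpha> x"
  using frechet_derivative_form_scale[OF assms]
  by (simp add: ext_d_def form_scale_def sum_distrib_left fun_eq_iff algebra_simps)

lemma ext_d_grade_sign:
  assumes "polynomial_dform \<alpha>"
  shows "ext_d (\<lambda>y. grade_sign (\<alpha> y)) x = (- 1) *\<^sub>F grade_sign (ext_d \<alpha> x)"
proof
  fix vs :: "'a list"
  have "ext_d (\<lambda>y. grade_sign (\<alpha> y)) x vs = (\<Sum>i<length vs. (- 1) ^ i * ((- 1) ^ (length vs - 1) *
      frechet_derivative (\<lambda>y. \<alpha> y (take i vs @ drop (Suc i) vs)) (at x) (vs ! i)))"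
    unfolding ext_d_def grade_sign_def frechet_derivative_form_scale[OF assms]
    by (intro sum.cong refl) (auto simp: min_def)
  also have "\<dots> = (- 1) ^ (length vs - 1) * ext_d \<alpha> x vs"
    by (simp add: ext_d_def sum_distrib_left mult_ac)
  also have "\<dots> = ((- 1) *\<^sub>F grade_sign (ext_d \<alpha> x)) vs"
    by (cases vs) (simp_all add: grade_sign_def form_scale_apply ext_d_Nil)
  finally show "ext_d (\<lambda>y. grade_sign (\<alpha> y)) x vs = ((- 1) *\<^sub>F grade_sign (ext_d \<alpha> x)) vs" .
qed

text \<open>
  The Leibniz rule. Contraction with \<open>v\<close> turns it into the rule for shorter lists and the product
  rule for the derivative in the direction of \<open>v\<close>.
\<close>

lemma ext_d_wedge:
  assumes "polynomial_dform \<alpha>" "polynomial_dform \<beta>"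
  shows "ext_d (\<lambda>y. \<alpha> y \<^bold>\<and> \<beta> y) x = ext_d \<alpha> x \<^bold>\<and> \<beta> x + grade_sign (\<alpha> x) \<^bold>\<and> ext_d \<beta> x"
proof
  fix vs
  show "ext_d (\<lambda>y. \<alpha> y \<^bold>\<and> \<beta> y) x vs = (ext_d \<alpha> x \<^bold>\<and> \<beta> x + grade_sign (\<alpha> x) \<^bold>\<and> ext_d \<beta> x) vs"
    using assms
  proof (induction vs arbitrary: \<alpha> \<beta>)
    case Nil
    then show ?case by (simp add: ext_d_Nil wedge_Nil)
  next
    case (Cons v vs)
    note p = Cons.prems polynomial_dform_interior[OF Cons.prems(1), of v]
      polynomial_dform_interior[OF Cons.prems(2), of v] polynomial_dform_grade_sign[OF
        Cons.prems(1)]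
    let ?D\<alpha> = "\<lambda>us. frechet_derivative (\<lambda>y. \<alpha> y us) (at x) v"
    let ?D\<beta> = "\<lambda>us. frechet_derivative (\<lambda>y. \<beta> y us) (at x) v"
    have d: "interior_product v (ext_d \<gamma> x) = (\<lambda>us. frechet_derivative (\<lambda>y. \<gamma> y us) (at x) v) -
        ext_d (\<lambda>y. interior_product v (\<gamma> y)) x" for \<gamma> :: "'a dform"
      by (auto simp: interior_product_def[of v "ext_d _ _"] ext_d_Cons)
    have gg: "grade_sign (grade_sign (\<alpha> x)) = \<alpha> x"
      by (simp add: grade_sign_def fun_eq_iff)
    have gi: "interior_product v (grade_sign (\<alpha> x)) =
      (- 1) *\<^sub>F grade_sign (interior_product v (\<alpha> x))"
      by (simp add: form_scale_def interior_product_def grade_sign_def fun_eq_iff)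
    have neg: "(\<gamma> - \<epsilon>) \<^bold>\<and> \<delta> = \<gamma> \<^bold>\<and> \<delta> - \<epsilon> \<^bold>\<and> \<delta>" "\<delta> \<^bold>\<and> (\<gamma> - \<epsilon>) = \<delta> \<^bold>\<and> \<gamma> - \<delta> \<^bold>\<and> \<epsilon>" for \<gamma> \<delta> \<epsilon> :: "'a form"
      by (simp_all only: form_minus wedge_scale_left wedge_scale_right wedge_add_left
        wedge_add_right)
    have uminus: "(\<lambda>us. - \<gamma> us) \<^bold>\<and> \<delta> = (\<lambda>us. - (\<gamma> \<^bold>\<and> \<delta>) us)" for \<gamma> \<delta> :: "'a form"
      using wedge_scale_left[of "- 1" \<gamma> \<delta>] by (simp add: form_scale_def)
    have "ext_d (\<lambda>y. \<alpha> y \<^bold>\<and> \<beta> y) x (v # vs) = (?D\<alpha> \<^bold>\<and> \<beta> x) vs + (\<alpha> x \<^bold>\<and> ?D\<beta>) vs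
        - (ext_d (\<lambda>y. interior_product v (\<alpha> y) \<^bold>\<and> \<beta> y) x
           + ext_d (\<lambda>y. grade_sign (\<alpha> y) \<^bold>\<and> interior_product v (\<beta> y)) x) vs"
      by (simp add: ext_d_Cons frechet_derivative_wedge[OF Cons.prems] interior_wedge ext_d_add
          polynomial_dform_wedge p)
    then show ?case
      by (simp add: Cons.IH p ext_d_grade_sign wedge_Cons d gg gi neg uminus wedge_scale_left
        form_scale_apply)
  qed
qed

section \<open>Invariant forms on the nilpotent group\<close>

lemma coframe_one_form: "one_form (coframe i x)"
  by (simp add: one_form_def coframe_degree)

lemma symplectic_coframe_coframe: "symplectic_coframe (nil_omega x) (\<lambda>i. coframe i x)"
proof (rule symplectic_coframeI)
  show "alternating_form 1 (coframe i x)" for i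
  proof (rule alternating_one_formI[OF coframe_one_form])
    show "linear (\<lambda>v. coframe i x [v])"
      by (rule linearI) (simp_all add: coframe_def algebra_simps)
  qed
  show "v = 0" if "\<And>i. coframe i x [v] = 0" for v
  proof -
    have "v $ 1 = 0" "v $ 2 = 0" "v $ 3 = 0" "v $ 5 = 0"
      "v $ 4 + x $ 1 * v $ 5 = 0" "v $ 6 + x $ 1 * v $ 3 = 0"
      using that[of 1] that[of 2] that[of 3] that[of 4] that[of 5] that[of 6]
      by (simp_all add: coframe_def)
    then show ?thesis by (simp add: vec_eq_iff forall_6)
  qed
qed (simp add: nil_omega_def e2_def)

lemma polynomial_dform_coframe: "polynomial_dform (coframe i)"
  unfolding polynomial_dform_def
proof
  fix vs :: "(real^6) list"
  have p: "real_polynomial_function (\<lambda>x::real^6. c + x $ j * d)" for c d j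
    by (intro real_polynomial_function.intros(2-4) real_polynomial_function.intros(1)
      bounded_linear_vec_nth)
  show "real_polynomial_function (\<lambda>x. coframe i x vs)"
  proof (cases "\<exists>v. vs = [v]")
    case True
    then obtain v where "vs = [v]" ..
    then show ?thesis
      using p[of _ 1] real_polynomial_function.intros(2)
      by (cases "i = 4"; cases "i = 6") (simp_all add: coframe_def)
  next
    case False
    then have "coframe i x vs = 0" for x by (auto simp: coframe_def split: list.splits)
    then show ?thesis by (simp add: real_polynomial_function.intros(2))
  qed
qed

lemmas polynomial_dform_intros = polynomial_dform_coframe polynomial_dform_wedge
  polynomial_dform_add polynomial_dform_scale

lemmas coframe_sort = exterior_sort[of "\<lambda>i. coframe i x" for x, OF coframe_one_form]

text \<open>
  As a sum of twenty monomials, the form is accessible to rules about sums, scalar multiples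
  and products.
\<close>

lemma primitive3_expand:
  "primitive3 f A B C D E F G H I J K L M N =
      A *\<^sub>F (f 1 \<^bold>\<and> f 3 \<^bold>\<and> f 5) + (B *\<^sub>F (f 1 \<^bold>\<and> f 3 \<^bold>\<and> f 6) + (C *\<^sub>F (f 1 \<^bold>\<and> f 4 \<^bold>\<and> f 5)
    + (D *\<^sub>F (f 1 \<^bold>\<and> f 4 \<^bold>\<and> f 6) + (E *\<^sub>F (f 2 \<^bold>\<and> f 3 \<^bold>\<and> f 5) + (F *\<^sub>F (f 2 \<^bold>\<and> f 3 \<^bold>\<and> f 6)
    + (G *\<^sub>F (f 2 \<^bold>\<and> f 4 \<^bold>\<and> f 5) + (H *\<^sub>F (f 2 \<^bold>\<and> f 4 \<^bold>\<and> f 6)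
    + (I *\<^sub>F (f 1 \<^bold>\<and> f 3 \<^bold>\<and> f 4) + ((- I) *\<^sub>F (f 1 \<^bold>\<and> f 5 \<^bold>\<and> f 6)
    + (J *\<^sub>F (f 2 \<^bold>\<and> f 3 \<^bold>\<and> f 4) + ((- J) *\<^sub>F (f 2 \<^bold>\<and> f 5 \<^bold>\<and> f 6)
    + (K *\<^sub>F (f 3 \<^bold>\<and> f 1 \<^bold>\<and> f 2) + ((- K) *\<^sub>F (f 3 \<^bold>\<and> f 5 \<^bold>\<and> f 6)
    + (L *\<^sub>F (f 4 \<^bold>\<and> f 1 \<^bold>\<and> f 2) + ((- L) *\<^sub>F (f 4 \<^bold>\<and> f 5 \<^bold>\<and> f 6)
    + (M *\<^sub>F (f 5 \<^bold>\<and> f 1 \<^bold>\<and> f 2) + ((- M) *\<^sub>F (f 5 \<^bold>\<and> f 3 \<^bold>\<and> f 4)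
    + (N *\<^sub>F (f 6 \<^bold>\<and> f 1 \<^bold>\<and> f 2) + (- N) *\<^sub>F (f 6 \<^bold>\<and> f 3 \<^bold>\<and> f 4)))))))))))))))))))"
  unfolding primitive3_def triple_def exterior_ring by (simp add: form_fun_simps)

lemma ext_d_coframe_at:
  "ext_d (coframe 1) x = 0" "ext_d (coframe 2) x = 0" "ext_d (coframe 3) x = 0"
  "ext_d (coframe 5) x = 0" "ext_d (coframe 4) x = coframe 1 x \<^bold>\<and> coframe 5 x"
  "ext_d (coframe 6) x = coframe 1 x \<^bold>\<and> coframe 3 x"
  by (simp_all add: structure_equations e2_def)

lemmas ext_d_rules = ext_d_add ext_d_scale ext_d_wedge ext_d_coframe_at polynomial_dform_intros
  grade_sign_one_form[OF coframe_one_form]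

text \<open>
  A monomial contributes only if it contains \<open>e\<^sup>4\<close> or \<open>e\<^sup>6\<close> and does not contain \<open>e\<^sup>1\<close>, because both
  non-zero differentials \<open>e\<^sup>1\<^sup>5\<close>, \<open>e\<^sup>1\<^sup>3\<close> contain \<open>e\<^sup>1\<close>.
\<close>

lemma ext_d_primitive3:
  "ext_d (\<lambda>x. primitive3 (\<lambda>i. coframe i x) A B C D E F G H I J K L M N) = (\<lambda>x.
      H *\<^sub>F (coframe 1 x \<^bold>\<and> coframe 2 x \<^bold>\<and> coframe 5 x \<^bold>\<and> coframe 6 x)
    - H *\<^sub>F (coframe 1 x \<^bold>\<and> coframe 2 x \<^bold>\<and> coframe 3 x \<^bold>\<and> coframe 4 x)
    + (2 * J) *\<^sub>F (coframe 1 x \<^bold>\<and> coframe 2 x \<^bold>\<and> coframe 3 x \<^bold>\<and> coframe 5 x)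
    - L *\<^sub>F (coframe 1 x \<^bold>\<and> coframe 3 x \<^bold>\<and> coframe 4 x \<^bold>\<and> coframe 5 x)
    - N *\<^sub>F (coframe 1 x \<^bold>\<and> coframe 3 x \<^bold>\<and> coframe 5 x \<^bold>\<and> coframe 6 x))"
proof
  fix x
  show "ext_d (\<lambda>x. primitive3 (\<lambda>i. coframe i x) A B C D E F G H I J K L M N) x =
      H *\<^sub>F (coframe 1 x \<^bold>\<and> coframe 2 x \<^bold>\<and> coframe 5 x \<^bold>\<and> coframe 6 x)
    - H *\<^sub>F (coframe 1 x \<^bold>\<and> coframe 2 x \<^bold>\<and> coframe 3 x \<^bold>\<and> coframe 4 x)
    + (2 * J) *\<^sub>F (coframe 1 x \<^bold>\<and> coframe 2 x \<^bold>\<and> coframe 3 x \<^bold>\<and> coframe 5 x)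
    - L *\<^sub>F (coframe 1 x \<^bold>\<and> coframe 3 x \<^bold>\<and> coframe 4 x \<^bold>\<and> coframe 5 x)
    - N *\<^sub>F (coframe 1 x \<^bold>\<and> coframe 3 x \<^bold>\<and> coframe 5 x \<^bold>\<and> coframe 6 x)"
    unfolding primitive3_expand
    by (simp add: ext_d_rules exterior_ring coframe_sort) (simp add: form_fun_simps algebra_simps)
qed

lemma primitive3_closed_iff:
  "ext_d (\<lambda>x. primitive3 (\<lambda>i. coframe i x) A B C D E F G H I J K L M N) = 0 \<longleftrightarrow>
     H = 0 \<and> J = 0 \<and> L = 0 \<and> N = 0"
  (is "ext_d ?\<phi> = 0 \<longleftrightarrow> _")
proof
  obtain b where b: "\<And>i j. coframe i 0 [b j] = (if i = j then 1 else 0)"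
    by (rule symplectic_coframe_dual[OF symplectic_coframe_coframe[of 0]]) (rule that)
  assume "ext_d ?\<phi> = 0"
  then have z: "ext_d ?\<phi> 0 vs = 0" for vs by simp
  have "ext_d ?\<phi> 0 [b 1, b 2, b 5, b 6] = H" "ext_d ?\<phi> 0 [b 1, b 2, b 3, b 5] = 2 * J"
    "ext_d ?\<phi> 0 [b 1, b 3, b 4, b 5] = - L" "ext_d ?\<phi> 0 [b 1, b 3, b 5, b 6] = - N"
    by (simp_all add: ext_d_primitive3 form_scale_apply wedge_apply_Cons[OF coframe_one_form] b
        exterior_ring interior_linear interior_zero coframe_sort(5,6))
  then show "H = 0 \<and> J = 0 \<and> L = 0 \<and> N = 0" unfolding z by simp
next
  assume "H = 0 \<and> J = 0 \<and> L = 0 \<and> N = 0"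
  then show "ext_d ?\<phi> = 0"
    by (simp add: ext_d_primitive3 scale_zero fun_eq_iff)
qed

lemma coframe_alternating: "alternating_form 1 (coframe i x)"
  by (rule frame_alternating[OF symplectic_coframe_coframe])

lemma alternating_primitive3:
  assumes "\<And>i. alternating_form 1 (f i)"
  shows "alternating_form 3 (primitive3 f A B C D E F G H I J K L M N)"
  unfolding primitive3_expand numeral_3_eq_3
  by (intro alternating_form_add alternating_form_scale alternating_form_wedge assms
    assms[unfolded One_nat_def])

text \<open>
  Contracting \<open>d\<phi>\<close> leaves \<open>H (e\<^sup>5\<^sup>6 - e\<^sup>3\<^sup>4)\<close> plus a combination of the closed forms \<open>e\<^sup>3\<^sup>5\<close>, \<open>e\<^sup>1\<^sup>5\<close>,
  \<open>e\<^sup>1\<^sup>3\<close>, so only \<open>H\<close> survives the second derivative.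
\<close>

lemma ext_d_lefschetz_ext_d:
  "ext_d (\<lambda>y. lefschetz (nil_omega y)
      (ext_d (\<lambda>x. primitive3 (\<lambda>i. coframe i x) A B C D E F G H I J K L M N) y)) =
    (\<lambda>x. (- 2 * H) *\<^sub>F (coframe 1 x \<^bold>\<and> coframe 3 x \<^bold>\<and> coframe 5 x))"
proof -
  let ?\<phi> = "\<lambda>x. primitive3 (\<lambda>i. coframe i x) A B C D E F G H I J K L M N"
  have *: "lefschetz (nil_omega y) (ext_d ?\<phi> y) =
      H *\<^sub>F (coframe 5 y \<^bold>\<and> coframe 6 y) + ((- H) *\<^sub>F (coframe 3 y \<^bold>\<and> coframe 4 y)
      + ((2 * J) *\<^sub>F (coframe 3 y \<^bold>\<and> coframe 5 y) + ((- L) *\<^sub>F (coframe 1 y \<^bold>\<and> coframe 5 y)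
      + (- N) *\<^sub>F (coframe 1 y \<^bold>\<and> coframe 3 y))))" for y
  proof
    fix vs
    obtain b where b: "\<And>i j. coframe i y [b j] = (if i = j then 1 else 0)"
      and expand: "\<And>v. v = (\<Sum>i\<in>UNIV. coframe i y [v] *\<^sub>R b i)"
      by (rule symplectic_coframe_dual[OF symplectic_coframe_coframe[of y]]) (rule that)
    have alt: "alternating_form (Suc (Suc (Suc 1))) (ext_d ?\<phi> y)"
      unfolding ext_d_primitive3 form_minus
      by (intro alternating_form_add alternating_form_scale alternating_form_wedge
        coframe_alternating)
    have ii: "\<beta> (v # w # vs) = interior_product w (interior_product v \<beta>) vs"
      for \<beta> and v w :: "real^6"
      by (simp add: interior_product_def)
    show "lefschetz (nil_omega y) (ext_d ?\<phi> y) vs =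
       (H *\<^sub>F (coframe 5 y \<^bold>\<and> coframe 6 y) + ((- H) *\<^sub>F (coframe 3 y \<^bold>\<and> coframe 4 y)
      + ((2 * J) *\<^sub>F (coframe 3 y \<^bold>\<and> coframe 5 y) + ((- L) *\<^sub>F (coframe 1 y \<^bold>\<and> coframe 5 y)
      + (- N) *\<^sub>F (coframe 1 y \<^bold>\<and> coframe 3 y))))) vs"
      unfolding lefschetz_dual_basis[OF symplectic_coframe_coframe b expand alt] ii
      unfolding ext_d_primitive3
      by (simp add: exterior_ring interior_linear interior_zero coframe_sort b)
        (simp add: form_fun_simps)
  qed
  show ?thesis
  proof
    fix x
    show "ext_d (\<lambda>y. lefschetz (nil_omega y) (ext_d ?\<phi> y)) x =
        (- 2 * H) *\<^sub>F (coframe 1 x \<^bold>\<and> coframe 3 x \<^bold>\<and> coframe 5 x)"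
      unfolding *
      by (simp add: ext_d_rules exterior_ring coframe_sort) (simp add: form_fun_simps algebra_simps)
  qed
qed

text \<open>
  A constant path solves the flow equation exactly if its right-hand side vanishes, and the
  right-hand side is \<open>- 2 H e\<^sup>1\<^sup>3\<^sup>5\<close>, with \<open>H\<close> the \<open>e\<^sup>2\<^sup>4\<^sup>6\<close>-coefficient of \<open>F(\<phi>)\<close>.
\<close>

lemma stationary_iff_F_field_coefficient:
  assumes "F_field nil_omega \<phi> = (\<lambda>x. primitive3 (\<lambda>i. coframe i x) A B C D E F G H I J K L M N)"
  shows "stationary_IIA nil_omega \<phi> \<longleftrightarrow> H = 0"
proof -
  have flow: "stationary_IIA nil_omega \<phi> \<longleftrightarrow>
      (\<forall>x vs. (- 2 * H) * (coframe 1 x \<^bold>\<and> coframe 3 x \<^bold>\<and> coframe 5 x) vs = 0)"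
    unfolding stationary_IIA_def type_IIA_flow_def assms ext_d_lefschetz_ext_d form_scale_apply
    by (metis DERIV_const DERIV_unique)
  obtain b where b: "\<And>i j. coframe i 0 [b j] = (if i = j then 1 else 0)"
    by (rule symplectic_coframe_dual[OF symplectic_coframe_coframe[of 0]]) (rule that)
  have "(coframe 1 0 \<^bold>\<and> coframe 3 0 \<^bold>\<and> coframe 5 0) [b 1, b 3, b 5] = 1"
    by (simp add: form_scale_apply wedge_apply_Cons[OF coframe_one_form] b
        exterior_ring interior_linear interior_zero coframe_sort(5,6))
  then show ?thesis unfolding flow by (metis mult_cancel_left1 mult_eq_0_iff
    neg_equal_0_iff_equal zero_neq_numeral mult_zero_left mult_zero_right)
qed

lemma left_invariant_wedge:
  "left_invariant \<alpha> \<Longrightarrow> left_invariant \<beta> \<Longrightarrow> left_invariant (\<lambda>x. \<alpha> x \<^bold>\<and> \<beta> x)"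
  by (simp add: left_invariant_def pullback_def[abs_def] wedge_map fun_eq_iff)

lemma left_invariant_add:
  "left_invariant \<alpha> \<Longrightarrow> left_invariant \<beta> \<Longrightarrow> left_invariant (\<lambda>x. \<alpha> x + \<beta> x)"
  by (simp add: left_invariant_def pullback_def fun_eq_iff)

lemma left_invariant_scale: "left_invariant \<alpha> \<Longrightarrow> left_invariant (\<lambda>x. c *\<^sub>F \<alpha> x)"
  by (simp add: left_invariant_def pullback_def form_scale_def fun_eq_iff)

lemmas left_invariant_intros = left_invariant_coframe left_invariant_wedge left_invariant_add
  left_invariant_scale

lemma left_invariant_primitive3:
  "left_invariant (\<lambda>x. primitive3 (\<lambda>i. coframe i x) A B C D E F G H I J K L M N)"
  unfolding primitive3_expand by (intro left_invariant_intros)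

lemma left_invariant_nil_omega: "left_invariant nil_omega"
proof -
  have o: "nil_omega = (\<lambda>x. coframe 1 x \<^bold>\<and> coframe 2 x + coframe 3 x \<^bold>\<and> coframe 4 x
    + coframe 5 x \<^bold>\<and> coframe 6 x)"
    by (simp add: nil_omega_def e2_def fun_eq_iff)
  show ?thesis unfolding o by (intro left_invariant_intros)
qed

lemma smooth_primitive3:
  "smooth_form 3 (\<lambda>x. primitive3 (\<lambda>i. coframe i x) A B C D E F G H I J K L M N)"
proof (rule smooth_formI)
  show "polynomial_dform (\<lambda>x. primitive3 (\<lambda>i. coframe i x) A B C D E F G H I J K L M N)"
    unfolding primitive3_expand by (intro polynomial_dform_intros)
qed (rule alternating_primitive3[OF coframe_alternating])

lemma invariant_primitive3:
  "invariant_primitive_3form (\<lambda>x. primitive3 (\<lambda>i. coframe i x) A B C D E F G H I J K L M N)"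
  unfolding invariant_primitive_3form_def primitive_form_def
  using smooth_primitive3 left_invariant_primitive3
    omega_wedge_primitive3[of "\<lambda>i. coframe i x" for x, OF coframe_one_form]
  by (simp add: nil_omega_def e2_def)

lemma symplectic_nil_omega: "symplectic_form nil_omega"
  unfolding symplectic_form_def
proof (intro conjI allI impI)
  have o: "nil_omega = (\<lambda>x. coframe 1 x \<^bold>\<and> coframe 2 x + coframe 3 x \<^bold>\<and> coframe 4 x
    + coframe 5 x \<^bold>\<and> coframe 6 x)"
    by (simp add: nil_omega_def e2_def fun_eq_iff)
  have "polynomial_dform nil_omega" unfolding o by (intro polynomial_dform_intros)
  moreover have "alternating_form 2 (nil_omega x)" for x
    unfolding o numeral_2_eq_2
    by (intro alternating_form_add alternating_form_wedge coframe_alternating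
      coframe_alternating[unfolded One_nat_def])
  ultimately show "smooth_form 2 nil_omega" by (rule smooth_formI)
  show "ext_d nil_omega = 0"
  proof
    fix x
    show "ext_d nil_omega x = 0 x"
      unfolding o by (simp add: ext_d_rules exterior_ring coframe_sort) (simp add: form_fun_simps)
  qed
  fix x v :: "real^6" assume "v \<noteq> 0"
  obtain b where b: "\<And>i j. coframe i x [b j] = (if i = j then 1 else 0)"
    and expand: "\<And>v. v = (\<Sum>i\<in>UNIV. coframe i x [v] *\<^sub>R b i)"
    by (rule symplectic_coframe_dual[OF symplectic_coframe_coframe[of x]]) (rule that)
  show "\<exists>w. nil_omega x [v, w] \<noteq> 0"
  proof (rule ccontr)
    assume "\<nexists>w. nil_omega x [v, w] \<noteq> 0"
    then have z: "nil_omega x [v, w] = 0" for w by blast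
    from z[of "b 1"] z[of "b 2"] z[of "b 3"] z[of "b 4"] z[of "b 5"] z[of "b 6"]
    have "v = 0" unfolding frame_omega_apply[OF symplectic_coframe_coframe]
      by (subst expand) (simp add: b sum_6)
    with \<open>v \<noteq> 0\<close> show False ..
  qed
qed

section \<open>Symplectic normal forms\<close>

definition frame6 :: "'a \<Rightarrow> 'a \<Rightarrow> 'a \<Rightarrow> 'a \<Rightarrow> 'a \<Rightarrow> 'a \<Rightarrow> 6 \<Rightarrow> 'a" where
  "frame6 a1 a2 a3 a4 a5 a6 i = (if i = 1 then a1 else if i = 2 then a2 else if i = 3 then a3
     else if i = 4 then a4 else if i = 5 then a5 else a6)"

lemma frame6_simps [simp]:
  "frame6 a1 a2 a3 a4 a5 a6 1 = a1" "frame6 a1 a2 a3 a4 a5 a6 2 = a2"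
  "frame6 a1 a2 a3 a4 a5 a6 3 = a3" "frame6 a1 a2 a3 a4 a5 a6 4 = a4"
  "frame6 a1 a2 a3 a4 a5 a6 5 = a5" "frame6 a1 a2 a3 a4 a5 a6 6 = a6"
  by (simp_all add: frame6_def)

lemma frame6_symplectic:
  fixes f :: "6 \<Rightarrow> (real^6) form"
  assumes f: "symplectic_coframe \<omega> f"
    and a: "alternating_form 1 a1" "alternating_form 1 a2" "alternating_form 1 a3"
      "alternating_form 1 a4" "alternating_form 1 a5" "alternating_form 1 a6"
    and eq: "a1 \<^bold>\<and> a2 + a3 \<^bold>\<and> a4 + a5 \<^bold>\<and> a6 = f 1 \<^bold>\<and> f 2 + f 3 \<^bold>\<and> f 4 + f 5 \<^bold>\<and> f 6"
  shows "symplectic_coframe \<omega> (frame6 a1 a2 a3 a4 a5 a6)"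
proof (rule symplectic_coframe_change[OF f])
  show "alternating_form 1 (frame6 a1 a2 a3 a4 a5 a6 i)" for i
    using exhaust_6[of i] a by auto
qed (simp add: eq frame_omega[OF f])

text \<open>
  The primitive 3-forms that are closed when the coframe is the left-invariant one.
\<close>

definition reduced3 :: "(6 \<Rightarrow> 'v form) \<Rightarrow> real \<Rightarrow> real \<Rightarrow> real \<Rightarrow> real \<Rightarrow> real \<Rightarrow> real \<Rightarrow> real \<Rightarrow>
    real \<Rightarrow> real \<Rightarrow> real \<Rightarrow> 'v form" where
  "reduced3 f A B C D E F G I K M = primitive3 f A B C D E F G 0 I 0 K 0 M 0"

text \<open>
  Quantifying over all symplectic coframes expresses that \<open>\<mu>\<close> depends on the coefficients only,
  so the same \<open>\<mu>\<close> serves at all points of the group. It also allows the coframe to be changed in the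
  reduction steps.
\<close>

definition negative_type :: "real \<Rightarrow> real \<Rightarrow> real \<Rightarrow> real \<Rightarrow> real \<Rightarrow> real \<Rightarrow> real \<Rightarrow> real \<Rightarrow> real \<Rightarrow> real \<Rightarrow>
    real \<Rightarrow> bool" where
  "negative_type A B C D E F G I K M \<mu> \<longleftrightarrow>
     (\<forall>\<omega> f. symplectic_coframe \<omega> f \<longrightarrow>
        reduced3 (f :: 6 \<Rightarrow> (real^6) form) A B C D E F G I K M \<in> O_minus \<omega> (- 1) \<mu>)"

lemma negative_type_step:
  assumes "negative_type A' B' C' D' E' F' G' I' K' M' \<mu>"
    and "\<And>\<omega> f. symplectic_coframe \<omega> (f :: 6 \<Rightarrow> (real^6) form) \<Longrightarrow> \<exists>g. symplectic_coframe \<omega> g \<and>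
      reduced3 f A B C D E F G I K M = reduced3 g A' B' C' D' E' F' G' I' K' M'"
  shows "negative_type A B C D E F G I K M \<mu>"
  using assms unfolding negative_type_def by metis

lemmas combination_alternating = alternating_form_add alternating_form_scale

text \<open>
  The product of numerals and forms is the pointwise one; it appears when the simplifier
  collects equal summands.
\<close>

lemma form_double: "2 * \<alpha> = 2 *\<^sub>F \<alpha>" for \<alpha> :: "'v form"
  unfolding mult_2 by (simp add: form_fun_simps)

text \<open>
  The factor \<open>F f\<^sup>2\<^sup>3\<^sup>6\<close> produces a multiple of \<open>f\<^sup>2\<^sup>3\<^sup>5\<close> when \<open>f\<^sup>6\<close> is sheared along \<open>f\<^sup>5\<close>.
\<close>

lemma reduced3_shear_E:
  fixes f :: "6 \<Rightarrow> (real^6) form"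
  assumes f: "symplectic_coframe \<omega> f"
  shows "\<exists>g. symplectic_coframe \<omega> g \<and>
    reduced3 f A B C 0 E F G I K M = reduced3 g (A - s * B) B C 0 (E - s * F) F G I K M"
proof (intro exI conjI)
  let ?g = "frame6 (f 1) (f 2) (f 3) (f 4) (f 5) (f 6 + s *\<^sub>F f 5)"
  note ring = form_double exterior_ring exterior_sort[of f, OF frame_one(1)[OF f]]
  note alt = frame_alternating[OF f]
  show "symplectic_coframe \<omega> ?g"
    by (rule frame6_symplectic[OF f], (intro combination_alternating alt)+)
      (simp add: ring)
  show "reduced3 f A B C 0 E F G I K M = reduced3 ?g (A - s * B) B C 0 (E - s * F) F G I K M"
    by (simp add: reduced3_def primitive3_def triple_def ring)
      (simp add: form_fun_simps algebra_simps)
qed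

text \<open>
  Shearing \<open>f\<^sup>2\<close> along \<open>f\<^sup>1\<close> moves \<open>(B, C)\<close> along \<open>(F, G)\<close>, and \<open>B G - C F\<close> is invariant.
\<close>

lemma reduced3_shear_BC:
  fixes f :: "6 \<Rightarrow> (real^6) form"
  assumes f: "symplectic_coframe \<omega> f"
  shows "\<exists>g. symplectic_coframe \<omega> g \<and>
    reduced3 f A B C 0 0 F G I K M = reduced3 g A (B - s * F) (C - s * G) 0 0 F G I K M"
proof (intro exI conjI)
  let ?g = "frame6 (f 1) (f 2 + s *\<^sub>F f 1) (f 3) (f 4) (f 5) (f 6)"
  note ring = form_double exterior_ring exterior_sort[of f, OF frame_one(1)[OF f]]
  note alt = frame_alternating[OF f]
  show "symplectic_coframe \<omega> ?g"
    by (rule frame6_symplectic[OF f], (intro combination_alternating alt)+)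
      (simp add: ring)
  show "reduced3 f A B C 0 0 F G I K M = reduced3 ?g A (B - s * F) (C - s * G) 0 0 F G I K M"
    by (simp add: reduced3_def primitive3_def triple_def ring)
      (simp add: form_fun_simps algebra_simps)
qed

text \<open>
  A shear of \<open>(f\<^sup>2, f\<^sup>4)\<close> along \<open>(f\<^sup>3, f\<^sup>1)\<close> acts on \<open>G f\<^sup>2\<^sup>4\<^sup>5\<close> by adding a multiple of
  \<open>f\<^sup>5 \<and> (f\<^sup>1\<^sup>2 - f\<^sup>3\<^sup>4)\<close>.
\<close>

lemma reduced3_shear_M:
  fixes f :: "6 \<Rightarrow> (real^6) form"
  assumes f: "symplectic_coframe \<omega> f"
  shows "\<exists>g. symplectic_coframe \<omega> g \<and>
    reduced3 f A B C 0 0 F G I K M =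
      reduced3 g (A - s * s * G - 2 * s * M) B C 0 0 F G I K (M + s * G)"
proof (intro exI conjI)
  let ?g = "frame6 (f 1) (f 2 + s *\<^sub>F f 3) (f 3) (f 4 + s *\<^sub>F f 1) (f 5) (f 6)"
  note ring = form_double exterior_ring exterior_sort[of f, OF frame_one(1)[OF f]]
  note alt = frame_alternating[OF f]
  show "symplectic_coframe \<omega> ?g"
    by (rule frame6_symplectic[OF f], (intro combination_alternating alt)+)
      (simp add: ring, simp add: form_fun_simps)
  show "reduced3 f A B C 0 0 F G I K M =
      reduced3 ?g (A - s * s * G - 2 * s * M) B C 0 0 F G I K (M + s * G)"
    by (simp add: reduced3_def primitive3_def triple_def ring)
      (simp add: form_fun_simps algebra_simps)
qed

text \<open>
  A shear of \<open>(f\<^sup>2, f\<^sup>6)\<close> along \<open>(f\<^sup>5, f\<^sup>1)\<close> acts on \<open>F f\<^sup>2\<^sup>3\<^sup>6\<close> by adding a multiple of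
  \<open>f\<^sup>3 \<and> (f\<^sup>1\<^sup>2 - f\<^sup>5\<^sup>6)\<close>.
\<close>

lemma reduced3_shear_K:
  fixes f :: "6 \<Rightarrow> (real^6) form"
  assumes f: "symplectic_coframe \<omega> f"
  shows "\<exists>g. symplectic_coframe \<omega> g \<and>
    reduced3 f A B C 0 0 F G I K 0 =
      reduced3 g (A - s * s * F + 2 * s * K) B C 0 0 F G I (K - s * F) 0"
proof (intro exI conjI)
  let ?g = "frame6 (f 1) (f 2 + s *\<^sub>F f 5) (f 3) (f 4) (f 5) (f 6 + s *\<^sub>F f 1)"
  note ring = form_double exterior_ring exterior_sort[of f, OF frame_one(1)[OF f]]
  note alt = frame_alternating[OF f]
  show "symplectic_coframe \<omega> ?g"
    by (rule frame6_symplectic[OF f], (intro combination_alternating alt)+)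
      (simp add: ring, simp add: form_fun_simps)
  show "reduced3 f A B C 0 0 F G I K 0 =
      reduced3 ?g (A - s * s * F + 2 * s * K) B C 0 0 F G I (K - s * F) 0"
    by (simp add: reduced3_def primitive3_def triple_def ring)
      (simp add: form_fun_simps algebra_simps)
qed

text \<open>
  A shear of \<open>(f\<^sup>4, f\<^sup>6)\<close> along \<open>(f\<^sup>5, f\<^sup>3)\<close> fixes the terms with coefficients \<open>B\<close>, \<open>C\<close>, \<open>F\<close>, \<open>G\<close> and
  moves \<open>f\<^sup>1 \<and> (f\<^sup>3\<^sup>4 - f\<^sup>5\<^sup>6)\<close> by a multiple of \<open>f\<^sup>1\<^sup>3\<^sup>5\<close>.
\<close>

lemma reduced3_shear_A:
  fixes f :: "6 \<Rightarrow> (real^6) form"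
  assumes f: "symplectic_coframe \<omega> f"
  shows "\<exists>g. symplectic_coframe \<omega> g \<and>
    reduced3 f A B C 0 0 F G I 0 0 = reduced3 g (A - 2 * s * I) B C 0 0 F G I 0 0"
proof (intro exI conjI)
  let ?g = "frame6 (f 1) (f 2) (f 3) (f 4 + s *\<^sub>F f 5) (f 5) (f 6 + s *\<^sub>F f 3)"
  note ring = form_double exterior_ring exterior_sort[of f, OF frame_one(1)[OF f]]
  note alt = frame_alternating[OF f]
  show "symplectic_coframe \<omega> ?g"
    by (rule frame6_symplectic[OF f], (intro combination_alternating alt)+)
      (simp add: ring, simp add: form_fun_simps)
  show "reduced3 f A B C 0 0 F G I 0 0 = reduced3 ?g (A - 2 * s * I) B C 0 0 F G I 0 0"
    by (simp add: reduced3_def primitive3_def triple_def ring)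
      (simp add: form_fun_simps algebra_simps)
qed

text \<open>
  Cyclic permutation of the conjugate pairs permutes \<open>D\<close>, \<open>F\<close>, \<open>G\<close> cyclically.
\<close>

lemma reduced3_rotate_pairs:
  fixes f :: "6 \<Rightarrow> (real^6) form"
  assumes f: "symplectic_coframe \<omega> f"
  shows "\<exists>g. symplectic_coframe \<omega> g \<and>
    reduced3 f A B C D E F G I K M = reduced3 g A E B F C G D (- K) (- M) I"
proof (intro exI conjI)
  let ?g = "frame6 (f 3) (f 4) (f 5) (f 6) (f 1) (f 2)"
  note ring = form_double exterior_ring exterior_sort[of f, OF frame_one(1)[OF f]]
  note alt = frame_alternating[OF f]
  show "symplectic_coframe \<omega> ?g"
    by (rule frame6_symplectic[OF f], (intro combination_alternating alt)+)
      (simp add: ring)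
  show "reduced3 f A B C D E F G I K M = reduced3 ?g A E B F C G D (- K) (- M) I"
    by (simp add: reduced3_def primitive3_def triple_def ring ac_simps)
qed

lemma reduced3_scale:
  fixes f :: "6 \<Rightarrow> (real^6) form"
  assumes f: "symplectic_coframe \<omega> f" and c: "c * d = 1" and \<epsilon>: "\<epsilon> * \<epsilon> = 1"
  shows "\<exists>g. symplectic_coframe \<omega> g \<and>
    reduced3 f 0 B C 0 0 F G I 0 0 =
      reduced3 g 0 (\<epsilon> * c * B) (\<epsilon> * d * C) 0 0 (\<epsilon> * c * F) (\<epsilon> * d * G) I 0 0"
proof (intro exI conjI)
  let ?g = "frame6 (f 1) (f 2) (\<epsilon> *\<^sub>F f 3) (\<epsilon> *\<^sub>F f 4) (c *\<^sub>F f 5) (d *\<^sub>F f 6)"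
  note ring = form_double exterior_ring exterior_sort[of f, OF frame_one(1)[OF f]]
  note alt = frame_alternating[OF f]
  have s: "c * (d * x) = x" "d * (c * x) = x" "\<epsilon> * (\<epsilon> * x) = x" "d * c = 1" for x
    using c \<epsilon> by (simp_all add: mult.assoc[symmetric] mult.commute)
  show "symplectic_coframe \<omega> ?g"
    by (rule frame6_symplectic[OF f], (intro combination_alternating alt)+)
      (simp add: ring s c \<epsilon>)
  show "reduced3 f 0 B C 0 0 F G I 0 0 =
      reduced3 ?g 0 (\<epsilon> * c * B) (\<epsilon> * d * C) 0 0 (\<epsilon> * c * F) (\<epsilon> * d * G) I 0 0"
    by (simp add: reduced3_def primitive3_def triple_def ring)
      (simp add: form_fun_simps algebra_simps s c \<epsilon>)
qed

text \<open>
  In the four directions complementary to \<open>f\<^sup>1\<close>, \<open>f\<^sup>2\<close> the 2-forms \<open>\<rho> = f\<^sup>3\<^sup>6 + f\<^sup>4\<^sup>5\<close> and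
  \<open>\<sigma> = f\<^sup>3\<^sup>4 - f\<^sup>5\<^sup>6\<close> satisfy \<open>\<rho>\<^sup>2 = - \<sigma>\<^sup>2 \<noteq> 0\<close> and \<open>\<rho> \<and> \<sigma> = 0\<close>, while \<open>f\<^sup>3\<^sup>6 - f\<^sup>4\<^sup>5\<close> is orthogonal to both. A boost
  that fixes \<open>f\<^sup>3\<^sup>6 - f\<^sup>4\<^sup>5\<close> takes \<open>B \<rho> + I \<sigma>\<close> to \<open>r \<sigma>\<close> with \<open>r\<^sup>2 = I\<^sup>2 - B\<^sup>2\<close>. On \<open>(f\<^sup>4, f\<^sup>6)\<close> it is taken to be the
  symmetric matrix with diagonal entry \<open>r + I\<close> and off-diagonal entry \<open>B\<close>, and on \<open>(f\<^sup>3, f\<^sup>5)\<close> the inverse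
  matrix. The determinant need not be \<open>1\<close>, since the 2-forms pair the two planes with each other, and so
  no hyperbolic functions occur.
\<close>

lemma reduced3_boost:
  fixes f :: "6 \<Rightarrow> (real^6) form"
  assumes f: "symplectic_coframe \<omega> f" and r: "r * r = I * I - B * B" "r * (r + I) \<noteq> 0"
  shows "\<exists>g. symplectic_coframe \<omega> g \<and>
    reduced3 f 0 B B 0 0 p (- p) I 0 0 = reduced3 g 0 0 0 0 0 p (- p) r 0 0"
proof -
  \<comment> \<open>The determinant \<open>(r + I)\<^sup>2 - B\<^sup>2\<close> of the matrix with entries \<open>r + I\<close> and \<open>B\<close>.\<close>
  define \<delta> where "\<delta> = 2 * r * (r + I)"
  have \<delta>: "\<delta> \<noteq> 0" using r by (simp add: \<delta>_def)
  define x where "x = (r + I) / \<delta>"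
  define y where "y = B / \<delta>"
  define u where "u = r + I"
  let ?g = "frame6 (f 1) (f 2) (x *\<^sub>F f 3 + (- y) *\<^sub>F f 5) (u *\<^sub>F f 4 + B *\<^sub>F f 6)
     (x *\<^sub>F f 5 + (- y) *\<^sub>F f 3) (u *\<^sub>F f 6 + B *\<^sub>F f 4)"
  note ring = form_double exterior_ring exterior_sort[of f, OF frame_one(1)[OF f]]
  note alt = frame_alternating[OF f]
  have e1: "x * u - y * B = 1"
  proof -
    have "(r + I) * (r + I) - B * B = \<delta>" using r(1) by (simp add: \<delta>_def algebra_simps)
    then show ?thesis using \<delta> by (simp add: x_def y_def u_def diff_divide_distrib[symmetric])
  qed
  have e2: "x * B = y * u" by (simp add: x_def y_def u_def)
  have e3: "r * (x * u + y * B) = I"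
  proof -
    have "r * ((r + I) * (r + I) + B * B) = I * \<delta>"
    proof -
      have B: "B * B = I * I - r * r" using r(1) by simp
      show ?thesis unfolding B \<delta>_def by (simp add: algebra_simps)
    qed
    then show ?thesis using \<delta> by (simp add: x_def y_def u_def add_divide_distrib[symmetric]
      field_simps)
  qed
  have e4: "2 * r * x * B = B" using \<delta> by (simp add: x_def \<delta>_def)
  have sy: "symplectic_coframe \<omega> ?g"
  proof (rule frame6_symplectic[OF f])
    show "f 1 \<^bold>\<and> f 2 + (x *\<^sub>F f 3 + (- y) *\<^sub>F f 5) \<^bold>\<and> (u *\<^sub>F f 4 + B *\<^sub>F f 6) +
      (x *\<^sub>F f 5 + (- y) *\<^sub>F f 3) \<^bold>\<and> (u *\<^sub>F f 6 + B *\<^sub>F f 4) = f 1 \<^bold>\<and> f 2 + f 3 \<^bold>\<and> f 4 + f 5 \<^bold>\<and> f 6"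
      (is "?\<omega> = _")
    proof -
      have "?\<omega> = f 1 \<^bold>\<and> f 2 + (x * u - y * B) *\<^sub>F (f 3 \<^bold>\<and> f 4) + (x * u - y * B) *\<^sub>F (f 5 \<^bold>\<and> f 6)
        + (x * B - y * u) *\<^sub>F (f 3 \<^bold>\<and> f 6) + (y * u - x * B) *\<^sub>F (f 4 \<^bold>\<and> f 5)"
        by (simp add: ring) (simp add: form_fun_simps algebra_simps)
      then show ?thesis unfolding e1 e2 by (simp add: scale_zero)
    qed
  qed (intro combination_alternating alt)+
  have "reduced3 ?g 0 0 0 0 0 p (- p) r 0 0 =
     (p * (x * u - y * B)) *\<^sub>F (f 2 \<^bold>\<and> f 3 \<^bold>\<and> f 6) + (- (p * (x * u - y * B))) *\<^sub>F (f 2 \<^bold>\<and> f 4 \<^bold>\<and> f 5)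
     + (p * (x * B - y * u)) *\<^sub>F (f 2 \<^bold>\<and> f 3 \<^bold>\<and> f 4) + (p * (x * B - y * u)) *\<^sub>F (f 2 \<^bold>\<and> f 5 \<^bold>\<and> f 6)
     + (r * (x * u + y * B)) *\<^sub>F (f 1 \<^bold>\<and> f 3 \<^bold>\<and> f 4) + (- (r * (x * u + y * B))) *\<^sub>F (f 1 \<^bold>\<and> f 5 \<^bold>\<and> f 6)
     + (r * (x * B + y * u)) *\<^sub>F (f 1 \<^bold>\<and> f 3 \<^bold>\<and> f 6) + (r * (x * B + y * u)) *\<^sub>F (f 1 \<^bold>\<and> f 4 \<^bold>\<and> f 5)"
    by (simp add: reduced3_def primitive3_def triple_def ring)
      (simp add: form_fun_simps algebra_simps)
  also have "\<dots> = reduced3 f 0 B B 0 0 p (- p) I 0 0"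
  proof -
    have "r * (x * B + y * u) = 2 * r * x * B" unfolding e2[symmetric] by simp
    then have "r * (x * B + y * u) = B" using e4 by simp
    then show ?thesis unfolding e1 e3 e2
      by (simp add: reduced3_def primitive3_def triple_def ring ac_simps)
  qed
  finally show ?thesis using sy by metis
qed

text \<open>
  The new coframe \<open>g\<close> has multiples of \<open>f\<^sup>1\<close>, \<open>f\<^sup>2\<close> in the places of \<open>g\<^sup>3\<close>, \<open>g\<^sup>4\<close>, and a rotation by
  \<open>\<plusminus> 45\<close> degrees in the other directions turns \<open>f\<^sup>3\<^sup>6 - f\<^sup>4\<^sup>5\<close> into \<open>g\<^sup>1\<^sup>6 - g\<^sup>2\<^sup>5\<close> and \<open>f\<^sup>3\<^sup>4 - f\<^sup>5\<^sup>6\<close> into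
  \<open>\<mp> (g\<^sup>1\<^sup>5 + g\<^sup>2\<^sup>6)\<close>. This matches the orbit representative, which is \<open>\<mu>\<close> times
  \<open>- g\<^sup>3 \<and> (g\<^sup>1\<^sup>5 + g\<^sup>2\<^sup>6) + g\<^sup>4 \<and> (g\<^sup>1\<^sup>6 - g\<^sup>2\<^sup>5)\<close>.
\<close>

lemma reduced3_normal_form:
  fixes f :: "6 \<Rightarrow> (real^6) form"
  assumes f: "symplectic_coframe \<omega> f" and s: "s * s = 1" and a: "a * l = 1"
  shows "reduced3 f 0 0 0 0 0 (\<mu> * l) (- (\<mu> * l)) (s * \<mu> * a) 0 0 \<in> O_minus \<omega> (- 1) \<mu>"
proof -
  \<comment> \<open>The cosine of the rotation; the sine is \<open>k * s\<close>.\<close>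
  define k :: real where "k = sqrt (1/2)"
  have k: "k * k = 1/2" by (simp add: k_def)
  define g where "g = frame6 (k *\<^sub>F f 3 + (- k * s) *\<^sub>F f 6) (k *\<^sub>F f 4 + (k * s) *\<^sub>F f 5)
     (a *\<^sub>F f 1) (l *\<^sub>F f 2) (k *\<^sub>F f 5 + (- k * s) *\<^sub>F f 4) (k *\<^sub>F f 6 + (k * s) *\<^sub>F f 3)"
  note ring = form_double exterior_ring exterior_sort[of f, OF frame_one(1)[OF f]]
  note alt = frame_alternating[OF f]
  have kk: "k * (k * x) = x / 2" for x using k by (simp add: mult.assoc[symmetric])
  have ss: "s * (s * x) = x" for x using s by (simp add: mult.assoc[symmetric])
  have "symplectic_coframe \<omega> g"
    unfolding g_def
    by (rule frame6_symplectic[OF f], (intro combination_alternating alt)+)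
      (simp add: ring, simp add: form_fun_simps algebra_simps k kk s ss a)
  moreover have "reduced3 f 0 0 0 0 0 (\<mu> * l) (- (\<mu> * l)) (s * \<mu> * a) 0 0 =
     \<mu> *\<^sub>F (triple g 1 3 5 - triple g 1 4 6 - (- 1) *\<^sub>F triple g 2 3 6 - (- 1) *\<^sub>F triple g 2 4 5)"
    by (simp add: reduced3_def primitive3_def triple_def g_def ring)
      (simp add: form_fun_simps algebra_simps k kk s ss)
  ultimately show ?thesis unfolding O_minus_def orbit_of_def by blast
qed

text \<open>
  The boost leaves the coefficients \<open>p\<close> and \<open>r\<close> of the two summands; scaling \<open>f\<^sup>1\<close> against \<open>f\<^sup>2\<close>
  makes them equal up to sign.
\<close>

lemma negative_type_boost:
  assumes p: "p > 0" and B: "B\<^sup>2 < I\<^sup>2"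
  shows "\<exists>\<mu>>0. negative_type 0 B B 0 0 p (- p) I 0 0 \<mu>"
proof -
  \<comment> \<open>The sign keeps \<open>r\<close> and \<open>r + I\<close> away from zero.\<close>
  define r where "r = sgn I * sqrt (I\<^sup>2 - B\<^sup>2)"
  have I: "I \<noteq> 0" using B by auto
  then have sI: "sgn I * sgn I = 1" "sgn I * I > 0" by (auto simp: sgn_if)
  have rr: "r * r = I * I - B * B"
  proof -
    have "r * r = (sgn I * sgn I) * (sqrt (I\<^sup>2 - B\<^sup>2) * sqrt (I\<^sup>2 - B\<^sup>2))"
      unfolding r_def by (simp only: mult_ac)
    then show ?thesis using B sI by (simp add: power2_eq_square)
  qed
  have "r * r > 0" using rr B by (simp add: power2_eq_square)
  then have r0: "r \<noteq> 0" by auto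
  have "r * I = sqrt (I\<^sup>2 - B\<^sup>2) * (sgn I * I)" by (simp add: r_def)
  then have "r * I > 0" using sI B by (simp only: mult_pos_pos real_sqrt_gt_zero diff_gt_0_iff_gt)
  then have rI: "r * (r + I) \<noteq> 0" using \<open>r * r > 0\<close> by (simp add: distrib_left)
  \<comment> \<open>With this scale the coefficient \<open>r * l\<close> equals \<open>p / l\<close> up to sign.\<close>
  define l where "l = sqrt (p / \<bar>r\<bar>)"
  define \<mu> where "\<mu> = p / l"
  have l: "l > 0" "l * l = p / \<bar>r\<bar>" using p r0 by (simp_all add: l_def)
  have \<mu>: "\<mu> > 0" using p l by (simp add: \<mu>_def)
  have "negative_type 0 B B 0 0 p (- p) I 0 0 \<mu>"
    unfolding negative_type_def
  proof (intro allI impI)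
    fix \<omega> and f :: "6 \<Rightarrow> (real^6) form" assume "symplectic_coframe \<omega> f"
    from reduced3_boost[OF this rr rI, of p] obtain g where g: "symplectic_coframe \<omega> g"
      and eq: "reduced3 f 0 B B 0 0 p (- p) I 0 0 = reduced3 g 0 0 0 0 0 p (- p) r 0 0" by blast
    have "sgn r * sgn r = 1" using r0 by (simp add: sgn_if)
    from reduced3_normal_form[OF g this, of "1 / l" l \<mu>] l
    have "reduced3 g 0 0 0 0 0 (\<mu> * l) (- (\<mu> * l)) (sgn r * \<mu> * (1 / l)) 0 0 \<in> O_minus \<omega> (- 1) \<mu>"
      by simp
    moreover have "\<mu> * l = p" using l by (simp add: \<mu>_def)
    moreover have "sgn r * \<mu> * (1 / l) = r"
    proof -
      have "sgn r * \<mu> * (1 / l) = sgn r * (p / (l * l))" by (simp add: \<mu>_def)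
      also have "\<dots> = sgn r * \<bar>r\<bar>" using p r0 by (simp add: l(2))
      finally show ?thesis by (simp add: sgn_mult_abs)
    qed
    ultimately show "reduced3 f 0 B B 0 0 p (- p) I 0 0 \<in> O_minus \<omega> (- 1) \<mu>" by (simp only: eq)
  qed
  with \<mu> show ?thesis by blast
qed

text \<open>
  Scaling \<open>f\<^sup>5\<close> against \<open>f\<^sup>6\<close> makes \<open>F\<close> and \<open>G\<close> opposite, and then \<open>B G + C F = 0\<close> makes \<open>B\<close> and \<open>C\<close>
  equal.
\<close>

lemma negative_type_scale:
  assumes FG: "F * G < 0" and BC: "B * G + C * F = 0" and Q: "B\<^sup>2 * G\<^sup>2 + I\<^sup>2 * F * G < 0"
  shows "\<exists>\<mu>>0. negative_type 0 B C 0 0 F G I 0 0 \<mu>"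
proof -
  have F: "F \<noteq> 0" using FG by auto
  define c where "c = sqrt (- G / F)"
  define \<epsilon> where "\<epsilon> = sgn F"
  have "- G / F > 0" using FG by (auto simp: divide_simps mult_less_0_iff split: if_splits)
  then have c: "c > 0" "c * c = - G / F"
    unfolding c_def by (simp_all only: real_sqrt_gt_zero real_sqrt_mult_self abs_of_pos)
  have \<epsilon>: "\<epsilon> * \<epsilon> = 1" "\<epsilon> * F > 0" using F by (auto simp: \<epsilon>_def sgn_if)
  define p where "p = \<epsilon> * c * F"
  have p: "p > 0" using c \<epsilon> by (simp add: p_def mult.assoc mult.left_commute[of \<epsilon> c])
  have G: "G = - (c * c * F)" using F c by (simp add: field_simps)
  have C: "C = c * c * B"
  proof -
    have "F * C = F * (c * c * B)" using BC unfolding G by (simp add: algebra_simps)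
    then show ?thesis using F by simp
  qed
  have "F * F * (c * c) * (B\<^sup>2 * (c * c) - I\<^sup>2) < 0"
    using Q unfolding G by (simp add: algebra_simps power2_eq_square)
  moreover have "F * F * (c * c) > 0" using F c(1)
    by (simp add: zero_less_mult_iff) (auto simp: neq_iff)
  ultimately have "B\<^sup>2 * (c * c) < I\<^sup>2"
    by (metis diff_less_0_iff_less mult_less_0_iff order_less_asym)
  moreover have "(\<epsilon> * c * B)\<^sup>2 = (\<epsilon> * \<epsilon>) * (B\<^sup>2 * (c * c))"
    by (simp add: power2_eq_square mult_ac)
  ultimately have "(\<epsilon> * c * B)\<^sup>2 < I\<^sup>2" by (simp add: \<epsilon>(1))
  from negative_type_boost[OF p this] obtain \<mu> where \<mu>: "\<mu> > 0"
    and nt: "negative_type 0 (\<epsilon> * c * B) (\<epsilon> * c * B) 0 0 p (- p) I 0 0 \<mu>" by blast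
  have "\<epsilon> * (1 / c) * C = \<epsilon> * c * B" "\<epsilon> * (1 / c) * G = - p"
    using c by (simp_all add: C G p_def)
  with reduced3_scale[of _ _ c "1 / c" \<epsilon> B C F G I] c \<epsilon>
  have "\<exists>g. symplectic_coframe \<omega> g \<and>
      reduced3 f 0 B C 0 0 F G I 0 0 =
      reduced3 g 0 (\<epsilon> * c * B) (\<epsilon> * c * B) 0 0 p (- p) I 0 0"
    if "symplectic_coframe \<omega> f" for \<omega> and f :: "6 \<Rightarrow> (real^6) form"
    using that by (simp add: p_def)
  from negative_type_step[OF nt this] \<mu> show ?thesis by blast
qed

text \<open>
  The shears can be solved for the parameters because \<open>F\<close>, \<open>G\<close> and \<open>I\<close> are non-zero. They are
  applied here in reverse order. The coefficient of \<open>f\<^sup>1\<^sup>3\<^sup>5\<close> changes on the way and is removed at the end of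
  the reduction, so it stays arbitrary until then.
\<close>

lemma negative_type_D_zero:
  assumes Q: "(B * G - C * F)\<^sup>2 + 4 * I\<^sup>2 * F * G < 0"
  shows "\<exists>\<mu>>0. negative_type A B C 0 E F G I K M \<mu>"
proof -
  have "4 * I\<^sup>2 * F * G < 0" using Q zero_le_power2[of "B * G - C * F"] by linarith
  then have "(4 * I\<^sup>2) * (F * G) < 0" by (simp add: mult_ac)
  then have I: "I \<noteq> 0" and FG: "F * G < 0"
    by (auto simp: mult_less_0_iff)
  then have F: "F \<noteq> 0" and G: "G \<noteq> 0" by auto
  \<comment> \<open>Solves \<open>(B - t F) G + (C - t G) F = 0\<close>.\<close>
  define t where "t = (B * G + C * F) / (2 * F * G)"
  define B' where "B' = B - t * F"
  define C' where "C' = C - t * G"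
  have tFG: "2 * (t * (F * G)) = B * G + C * F" using F G by (simp add: t_def)
  have BC: "B' * G + C' * F = 0" using tFG by (simp add: B'_def C'_def algebra_simps)
  have inv: "B' * G - C' * F = B * G - C * F" by (simp add: B'_def C'_def algebra_simps)
  have "B' * G - C' * F = 2 * (B' * G)" using BC by simp
  then have "(2 * (B' * G))\<^sup>2 + 4 * I\<^sup>2 * F * G < 0" using Q inv by simp
  then have "B'\<^sup>2 * G\<^sup>2 + I\<^sup>2 * F * G < 0" by (simp add: power_mult_distrib)
  from negative_type_scale[OF FG BC this] obtain \<mu> where \<mu>: "\<mu> > 0"
    and nt: "negative_type 0 B' C' 0 0 F G I 0 0 \<mu>" by blast
  have nt: "negative_type a B' C' 0 0 F G I 0 0 \<mu>" for a
    by (rule negative_type_step[OF nt]) (use reduced3_shear_A[where A = a and s =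
      "a / (2 * I)" and I = I] I in simp)
  have nt: "negative_type a B' C' 0 0 F G I K 0 \<mu>" for a
    by (rule negative_type_step[OF nt])
      (use reduced3_shear_K[where s = "K / F" and F = F and K = K] F in \<open>simp\<close>)
  have nt: "negative_type a B' C' 0 0 F G I K M \<mu>" for a
    by (rule negative_type_step[OF nt])
      (use reduced3_shear_M[where s = "- M / G" and G = G and M = M] G in \<open>simp\<close>)
  have nt: "negative_type a B C 0 0 F G I K M \<mu>" for a
    by (rule negative_type_step[OF nt])
      (use reduced3_shear_BC[where s = t and B = B and C = C and F = F and G =
        G] in \<open>simp add: B'_def C'_def\<close>)
  have "negative_type A B C 0 E F G I K M \<mu>"
    by (rule negative_type_step[OF nt])
      (use reduced3_shear_E[where s = "E / F" and F = F and E = E] F in \<open>simp\<close>)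
  with \<mu> show ?thesis by blast
qed

lemma negative_type_rotate:
  "negative_type A E B F C G D (- K) (- M) I \<mu> \<Longrightarrow> negative_type A B C D E F G I K M \<mu>"
  by (rule negative_type_step) (auto intro: reduced3_rotate_pairs)

text \<open>
  One or two cyclic permutations reduce the cases \<open>F = 0\<close> and \<open>G = 0\<close> to \<open>D = 0\<close>.
\<close>

lemma negative_type_exists:
  assumes DFG: "D * F * G = 0"
    and Q: "2 * (B\<^sup>2 * G\<^sup>2 + C\<^sup>2 * F\<^sup>2 + D\<^sup>2 * E\<^sup>2) - (B * G + C * F + D * E)\<^sup>2
       + 4 * (I\<^sup>2 * F * G + K\<^sup>2 * D * G + M\<^sup>2 * D * F) < 0"
  shows "\<exists>\<mu>>0. negative_type A B C D E F G I K M \<mu>"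
proof -
  consider "D = 0" | "F = 0" | "G = 0" using DFG by auto
  then show ?thesis
  proof cases
    case 1
    have "(B * G - C * F)\<^sup>2 + 4 * I\<^sup>2 * F * G < 0"
      using Q by (simp add: 1 power2_eq_square algebra_simps)
    from negative_type_D_zero[OF this] show ?thesis by (simp add: 1)
  next
    case 2
    have "(E * D - B * G)\<^sup>2 + 4 * (- K)\<^sup>2 * G * D < 0"
      using Q by (simp add: 2 power2_eq_square algebra_simps)
    from negative_type_D_zero[OF this] show ?thesis
      unfolding 2 by (blast intro: negative_type_rotate)
  next
    case 3
    have "(C * F - E * D)\<^sup>2 + 4 * (- (- M))\<^sup>2 * D * F < 0"
      using Q by (simp add: 3 power2_eq_square algebra_simps)
    from negative_type_D_zero[OF this] show ?thesis
      unfolding 3 by (blast intro: negative_type_rotate)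
  qed
qed

text \<open>
  In the dual basis of the coframe of the normal form, \<open>K\<close> exchanges the members of each
  conjugate pair up to a factor, so \<open>q\<close> is diagonal.
\<close>

lemma signature_O_minus:
  assumes "\<phi> \<in> O_minus \<omega> (- 1) \<mu>" "\<mu> > 0"
  shows "has_signature (q_metric \<omega> (\<phi> :: (real^6) form)) 2 4"
proof -
  obtain f where f: "symplectic_coframe \<omega> f" and
    \<phi>: "\<phi> = \<mu> *\<^sub>F (triple f 1 3 5 - triple f 1 4 6 - (- 1) *\<^sub>F triple f 2 3 6
      - (- 1) *\<^sub>F triple f 2 4 5)"
    using assms(1) unfolding O_minus_def orbit_of_def by blast
  have \<phi>: "\<phi> = primitive3 f \<mu> 0 0 (- \<mu>) 0 \<mu> \<mu> 0 0 0 0 0 0 0"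
    unfolding \<phi> primitive3_def by (simp add: exterior_ring)
  obtain b where b: "\<And>i j. f i [b j] = (if i = j then 1 else 0)"
    and expand: "\<And>v. v = (\<Sum>i\<in>UNIV. f i [v] *\<^sub>R b i)"
    by (rule symplectic_coframe_dual[OF f]) (rule that)
  have q: "q_metric \<omega> \<phi> u v = 2 * \<mu> * \<mu> * (f 1 [u] * f 1 [v] + f 2 [u] * f 2 [v] - f 3 [u] * f 3 [v]
      - f 4 [u] * f 4 [v] - f 5 [u] * f 5 [v] - f 6 [u] * f 6 [v])" for u v
    unfolding q_metric_def frame_omega_apply[OF f] \<phi> K_op_primitive3[OF f]
      by (simp add: algebra_simps)
  have inj: "inj b"
    by (rule injI) (metis b zero_neq_one)
  have span: "span (range b) = UNIV"
  proof -
    have "v \<in> span (range b)" for v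
      by (subst expand) (intro span_sum span_scale span_base rangeI)
    then show ?thesis by blast
  qed
  have card: "card (range b) = 6"
    using card_image[OF inj] by simp
  have indep: "independent (range b)"
    by (rule card_le_dim_spanning[of _ UNIV]) (simp_all add: span card)
  have "q_metric \<omega> \<phi> (b i) (b j) = 0" if "b i \<noteq> b j" for i j
    using that exhaust_6[of i] by (auto simp: q b)
  moreover have sq: "q_metric \<omega> \<phi> (b i) (b i) =
    (if i \<in> {1, 2} then 2 * \<mu> * \<mu> else - (2 * \<mu> * \<mu>))" for i
    using exhaust_6[of i] by (auto simp: q b)
  moreover have "{u \<in> range b. q_metric \<omega> \<phi> u u > 0} = b ` {1, 2}"
    "{u \<in> range b. q_metric \<omega> \<phi> u u < 0} = b ` (- {1, 2})"
    using assms(2) by (auto simp: sq not_less split: if_splits)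
  moreover have "card (b ` {1, 2}) = 2" "card (b ` (- {1, 2})) = 4"
    unfolding card_image[OF inj_on_subset[OF inj subset_UNIV]]
    by (simp_all add: Compl_eq_Diff_UNIV card_Diff_subset)
  ultimately show ?thesis
    unfolding has_signature_def using indep span
    by (intro exI[of _ "range b"]) auto
qed

text \<open>
  The orbit representative contains \<open>f\<^sup>2\<^sup>4\<^sup>6\<close>, which is not closed for the left-invariant coframe.
  Exchanging \<open>f\<^sup>5\<close> and \<open>f\<^sup>6\<close> up to sign yields a closed form.
\<close>

lemma O_plus_representative:
  fixes f :: "6 \<Rightarrow> (real^6) form"
  assumes f: "symplectic_coframe \<omega> f"
  shows "primitive3 f 0 \<mu> 0 0 0 0 (- \<mu>) 0 0 0 0 0 0 0 \<in> O_plus \<omega> \<mu>"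
proof -
  let ?g = "frame6 (f 1) (f 2) (f 3) (f 4) (f 6) ((- 1) *\<^sub>F f 5)"
  note ring = form_double exterior_ring exterior_sort[of f, OF frame_one(1)[OF f]]
  note alt = frame_alternating[OF f]
  have "symplectic_coframe \<omega> ?g"
    by (rule frame6_symplectic[OF f], (intro combination_alternating alt)+) (simp add: ring)
  moreover have "primitive3 f 0 \<mu> 0 0 0 0 (- \<mu>) 0 0 0 0 0 0 0 =
    \<mu> *\<^sub>F (triple ?g 1 3 5 + triple ?g 2 4 6)"
    by (simp add: primitive3_def triple_def ring)
  ultimately show ?thesis unfolding O_plus_def orbit_of_def by blast
qed

text \<open>
  Here the exchange takes place in the last two conjugate pairs, which turns the term \<open>f\<^sup>1\<^sup>4\<^sup>6\<close>
  into \<open>f\<^sup>1\<^sup>3\<^sup>5\<close> and thereby makes \<open>D\<close> vanish.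
\<close>

lemma O_0_representative:
  fixes f :: "6 \<Rightarrow> (real^6) form"
  assumes f: "symplectic_coframe \<omega> f"
  shows "primitive3 f 1 0 0 0 0 (- s) (- s) 0 0 0 0 0 0 0 \<in> O_0 \<omega> s"
proof -
  let ?g = "frame6 (f 1) (f 2) ((- 1) *\<^sub>F f 4) (f 3) ((- 1) *\<^sub>F f 6) (f 5)"
  note ring = form_double exterior_ring exterior_sort[of f, OF frame_one(1)[OF f]]
  note alt = frame_alternating[OF f]
  have "symplectic_coframe \<omega> ?g"
    by (rule frame6_symplectic[OF f], (intro combination_alternating alt)+) (simp add: ring)
  moreover have "primitive3 f 1 0 0 0 0 (- s) (- s) 0 0 0 0 0 0 0 =
      triple ?g 1 4 6 + s *\<^sub>F triple ?g 2 3 6 + s *\<^sub>F triple ?g 2 4 5"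
    by (simp add: primitive3_def triple_def ring ac_simps)
  ultimately show ?thesis unfolding O_0_def orbit_of_def by blast
qed

lemma O_1_representative:
  assumes f: "symplectic_coframe \<omega> f"
  shows "primitive3 f 1 0 0 0 0 0 (- s) 0 0 0 0 0 0 0 \<in> O_1 \<omega> s"
proof -
  have "primitive3 f 1 0 0 0 0 0 (- s) 0 0 0 0 0 0 0 = (f 1 \<^bold>\<and> f 3 - s *\<^sub>F (f 2 \<^bold>\<and> f 4)) \<^bold>\<and> f 5"
    by (simp add: primitive3_def triple_def exterior_ring)
  then show ?thesis unfolding O_1_def orbit_of_def using f by blast
qed

lemma O_3_representative:
  assumes f: "symplectic_coframe \<omega> f"
  shows "primitive3 f 1 0 0 0 0 0 0 0 0 0 0 0 0 0 \<in> O_3 \<omega>"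
proof -
  have "primitive3 f 1 0 0 0 0 0 0 0 0 0 0 0 0 0 = triple f 1 3 5"
    by (simp add: primitive3_def exterior_ring)
  then show ?thesis unfolding O_3_def orbit_of_def using f by blast
qed

lemma primitive3_zero: "primitive3 f 0 0 0 0 0 0 0 0 0 0 0 0 0 0 = 0"
  by (simp add: primitive3_def exterior_ring)

section \<open>A lattice\<close>

text \<open>
  The group law is polynomial with integer coefficients, so these points form a subgroup.
\<close>

definition integer_lattice :: "(real^6) set" where
  "integer_lattice = {x. \<forall>i. x $ i \<in> \<int>}"

lemma nil_group_simps:
  "carrier nil_group = UNIV" "x \<otimes>\<^bsub>nil_group\<^esub> y = nil_mult x y" "\<one>\<^bsub>nil_group\<^esub> = 0"
  by (simp_all add: nil_group_def)

lemma nil_inverse: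
  "inv\<^bsub>nil_group\<^esub> x = (\<chi> i. if i = 4 then - x $ 4 - x $ 1 * x $ 5
      else if i = 6 then - x $ 6 - x $ 1 * x $ 3 else - x $ i)"
  by (rule group.inv_equality[OF group_nil_group])
    (simp_all add: nil_group_simps nil_mult_def vec_eq_iff)

lemma subgroup_integer_lattice: "subgroup integer_lattice nil_group"
proof (rule subgroup.intro)
  show "x \<otimes>\<^bsub>nil_group\<^esub> y \<in> integer_lattice" if "x \<in> integer_lattice" "y \<in> integer_lattice" for x y
    using that by (simp add: integer_lattice_def nil_group_simps nil_mult_def)
  show "inv\<^bsub>nil_group\<^esub> x \<in> integer_lattice" if "x \<in> integer_lattice" for x
    using that by (simp add: integer_lattice_def nil_inverse)
qed (simp_all add: integer_lattice_def nil_group_simps)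

lemma discrete_integer_lattice: "discrete integer_lattice"
proof (rule uniform_discrete_imp_discrete)
  have "x = y" if xy: "x \<in> integer_lattice" "y \<in> integer_lattice" "dist x y < 1" for x y
  proof -
    have "x $ i = y $ i" for i
    proof -
      have "x $ i \<in> \<int>" "y $ i \<in> \<int>" using xy(1,2) by (simp_all add: integer_lattice_def)
      then obtain m n where mn: "x $ i = of_int m" "y $ i = of_int n"
        by (auto elim!: Ints_cases)
      have "\<bar>x $ i - y $ i\<bar> < 1"
        using dist_vec_nth_le[of x i y] xy(3) by (simp add: dist_real_def)
      then have "\<bar>m - n\<bar> < 1" unfolding mn by linarith
      then show ?thesis by (simp add: mn)
    qed
    then show ?thesis by (simp add: vec_eq_iff)
  qed
  then show "uniform_discrete integer_lattice"
    unfolding uniform_discrete_def by (intro exI[of _ 1]) auto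
qed

lemma openin_coset_topology:
  "openin (coset_topology \<Gamma>) U \<longleftrightarrow>
     U \<subseteq> rcosets\<^bsub>nil_group\<^esub> \<Gamma> \<and> open {g. \<Gamma> #>\<^bsub>nil_group\<^esub> g \<in> U}"
proof -
  have "istopology (\<lambda>U. U \<subseteq> rcosets\<^bsub>nil_group\<^esub> \<Gamma> \<and> open {g. \<Gamma> #>\<^bsub>nil_group\<^esub> g \<in> U})"
    unfolding istopology_def
  proof (intro conjI allI impI)
    fix S T assume "S \<subseteq> rcosets\<^bsub>nil_group\<^esub> \<Gamma> \<and> open {g. \<Gamma> #>\<^bsub>nil_group\<^esub> g \<in> S}"
      and "T \<subseteq> rcosets\<^bsub>nil_group\<^esub> \<Gamma> \<and> open {g. \<Gamma> #>\<^bsub>nil_group\<^esub> g \<in> T}"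
    then show "open {g. \<Gamma> #>\<^bsub>nil_group\<^esub> g \<in> S \<inter> T}"
      using open_Int[of "{g. \<Gamma> #>\<^bsub>nil_group\<^esub> g \<in> S}" "{g. \<Gamma> #>\<^bsub>nil_group\<^esub> g \<in> T}"]
      by (simp add: Collect_conj_eq)
  next
    fix \<K> assume "\<forall>S\<in>\<K>. S \<subseteq> rcosets\<^bsub>nil_group\<^esub> \<Gamma> \<and> open {g. \<Gamma> #>\<^bsub>nil_group\<^esub> g \<in> S}"
    then have "open (\<Union>S\<in>\<K>. {g. \<Gamma> #>\<^bsub>nil_group\<^esub> g \<in> S})" by (intro open_UN) blast
    moreover have "(\<Union>S\<in>\<K>. {g. \<Gamma> #>\<^bsub>nil_group\<^esub> g \<in> S}) = {g. \<Gamma> #>\<^bsub>nil_group\<^esub> g \<in> \<Union>\<K>}" by auto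
    ultimately show "open {g. \<Gamma> #>\<^bsub>nil_group\<^esub> g \<in> \<Union>\<K>}" by simp
  qed auto
  then show ?thesis unfolding coset_topology_def by (simp add: topology_inverse')
qed

lemma coset_in_rcosets: "\<Gamma> #>\<^bsub>nil_group\<^esub> g \<in> rcosets\<^bsub>nil_group\<^esub> \<Gamma>"
  by (auto simp: RCOSETS_def nil_group_simps)

lemma topspace_coset_topology: "topspace (coset_topology \<Gamma>) = rcosets\<^bsub>nil_group\<^esub> \<Gamma>"
proof
  show "topspace (coset_topology \<Gamma>) \<subseteq> rcosets\<^bsub>nil_group\<^esub> \<Gamma>"
    using openin_topspace openin_coset_topology by blast
  have "openin (coset_topology \<Gamma>) (rcosets\<^bsub>nil_group\<^esub> \<Gamma>)"
    unfolding openin_coset_topology by (simp add: coset_in_rcosets)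
  then show "rcosets\<^bsub>nil_group\<^esub> \<Gamma> \<subseteq> topspace (coset_topology \<Gamma>)" by (rule openin_subset)
qed

text \<open>
  The quotient map is continuous and maps \<open>C\<close> onto the quotient.
\<close>

lemma compact_coset_topology:
  assumes "compact C" "\<And>g. \<exists>c\<in>C. \<Gamma> #>\<^bsub>nil_group\<^esub> g = \<Gamma> #>\<^bsub>nil_group\<^esub> c"
  shows "compact_space (coset_topology \<Gamma>)"
proof -
  let ?p = "\<lambda>g. \<Gamma> #>\<^bsub>nil_group\<^esub> g"
  have "continuous_map euclidean (coset_topology \<Gamma>) ?p"
    unfolding continuous_map_def topspace_coset_topology openin_coset_topology
    by (auto simp: coset_in_rcosets)
  then have "compactin (coset_topology \<Gamma>) (?p ` C)"
    using assms(1) by (intro image_compactin[where X = euclidean]) auto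
  moreover have "?p ` C = rcosets\<^bsub>nil_group\<^esub> \<Gamma>"
    using assms(2) by (auto simp: coset_in_rcosets RCOSETS_def nil_group_simps)
  ultimately show ?thesis by (simp add: compact_space_def topspace_coset_topology)
qed

lemma integer_lattice_cube:
  "\<exists>c\<in>cbox 0 1. integer_lattice #>\<^bsub>nil_group\<^esub> g = integer_lattice #>\<^bsub>nil_group\<^esub> c"
proof -
  \<comment> \<open>Translating by \<open>z\<close> shifts the coordinates \<open>4\<close> and \<open>6\<close> also by multiples of \<open>g $ 5\<close> and \<open>g $ 3\<close>,
      and the shifted value is what has to be rounded.\<close>
  define z :: "real^6" where "z = (\<chi> i.
     if i = 4 then - of_int \<lfloor>g $ 4 + of_int \<lfloor>g $ 1\<rfloor> * g $ 5\<rfloor>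
     else if i = 6 then - of_int \<lfloor>g $ 6 + of_int \<lfloor>g $ 1\<rfloor> * g $ 3\<rfloor>
     else - of_int \<lfloor>g $ i\<rfloor>)"
  have z: "z \<in> integer_lattice" by (simp add: z_def integer_lattice_def)
  define c where "c = nil_mult z g"
  have "0 \<le> c $ i \<and> c $ i \<le> 1" for i
  proof -
    have "0 \<le> x - of_int \<lfloor>x\<rfloor> \<and> x - of_int \<lfloor>x\<rfloor> \<le> 1" for x :: real by linarith
    then show ?thesis
      by (cases "i = 4"; cases "i = 6") (simp_all add: c_def z_def nil_mult_def algebra_simps)
  qed
  then have "c \<in> cbox 0 1" by (simp add: mem_box_cart)
  moreover have "integer_lattice #>\<^bsub>nil_group\<^esub> g = integer_lattice #>\<^bsub>nil_group\<^esub> c"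
  proof (rule group.repr_independence[OF group_nil_group _ _ subgroup_integer_lattice])
    have "c \<in> integer_lattice #>\<^bsub>nil_group\<^esub> g"
      using z by (auto simp: r_coset_def c_def nil_group_simps)
    then show "c \<in> integer_lattice #>\<^bsub>nil_group\<^esub> g" .
  qed (simp add: nil_group_simps)
  ultimately show ?thesis by blast
qed

lemma cocompact_integer_lattice: "cocompact_discrete_subgroup integer_lattice"
  unfolding cocompact_discrete_subgroup_def
  using subgroup_integer_lattice discrete_integer_lattice
    compact_coset_topology[OF compact_cbox integer_lattice_cube] by blast

section \<open>Left-invariant primitive 3-forms and the flow\<close>

text \<open>
  The coefficients of \<open>- F(\<phi>) / 2\<close> in the four places that enter its exterior derivative.
\<close>

definition F_hat_H :: "real \<Rightarrow> real \<Rightarrow> real \<Rightarrow> real \<Rightarrow> real \<Rightarrow> real \<Rightarrow> real \<Rightarrow> real \<Rightarrow> real \<Rightarrow> real \<Rightarrow>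
    real \<Rightarrow> real \<Rightarrow> real \<Rightarrow> real \<Rightarrow> real" where
  "F_hat_H A B C D E F G H I J K L M N =
     -A * H * H + B * G * H + C * F * H + D * E * H - 2 * D * F * G + 2 * D * J * J
       + 2 * F * L * L + 2 * G * N * N - 2 * H * I * J - 2 * H * K * L - 2 * H * M * N
       - 4 * J * L * N"

definition F_hat_J :: "real \<Rightarrow> real \<Rightarrow> real \<Rightarrow> real \<Rightarrow> real \<Rightarrow> real \<Rightarrow> real \<Rightarrow> real \<Rightarrow> real \<Rightarrow> real \<Rightarrow>
    real \<Rightarrow> real \<Rightarrow> real \<Rightarrow> real \<Rightarrow> real" where
  "F_hat_J A B C D E F G H I J K L M N =
     -A * H * J + B * G * J + C * F * J - D * E * J + 2 * E * H * I + 2 * E * L * N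
       - 2 * F * G * I - 2 * F * L * M - 2 * G * K * N + 2 * H * K * M"

definition F_hat_L :: "real \<Rightarrow> real \<Rightarrow> real \<Rightarrow> real \<Rightarrow> real \<Rightarrow> real \<Rightarrow> real \<Rightarrow> real \<Rightarrow> real \<Rightarrow> real \<Rightarrow>
    real \<Rightarrow> real \<Rightarrow> real \<Rightarrow> real \<Rightarrow> real" where
  "F_hat_L A B C D E F G H I J K L M N =
     -A * H * L + B * G * L - C * F * L + 2 * C * H * K + 2 * C * J * N + D * E * L
       - 2 * D * G * K - 2 * D * J * M - 2 * G * I * N + 2 * H * I * M"

definition F_hat_N :: "real \<Rightarrow> real \<Rightarrow> real \<Rightarrow> real \<Rightarrow> real \<Rightarrow> real \<Rightarrow> real \<Rightarrow> real \<Rightarrow> real \<Rightarrow> real \<Rightarrow>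
    real \<Rightarrow> real \<Rightarrow> real \<Rightarrow> real \<Rightarrow> real" where
  "F_hat_N A B C D E F G H I J K L M N =
     -A * H * N - B * G * N + 2 * B * H * M + 2 * B * J * L + C * F * N + D * E * N
       - 2 * D * F * M - 2 * D * J * K - 2 * F * I * L + 2 * H * I * K"

lemmas F_hat_defs = F_hat_H_def F_hat_J_def F_hat_L_def F_hat_N_def

text \<open>
  The other ten coefficients of \<open>F(\<phi>)\<close> do not influence \<open>dF(\<phi>)\<close> and are left unspecified.
\<close>

lemma F_field_primitive3:
  obtains a b c d e f g i k m where
    "F_field nil_omega (\<lambda>x. primitive3 (\<lambda>i. coframe i x) A B C D E F G H I J K L M N) =
      (\<lambda>x. primitive3 (\<lambda>i. coframe i x) a b c d e f g
        (- 2 * F_hat_H A B C D E F G H I J K L M N)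
        i
        (- 2 * F_hat_J A B C D E F G H I J K L M N)
        k
        (- 2 * F_hat_L A B C D E F G H I J K L M N)
        m
        (- 2 * F_hat_N A B C D E F G H I J K L M N))"
  by (rule that) (simp only: F_field_def F_form_primitive3[OF symplectic_coframe_coframe]
    F_hat_defs)

lemma coeff_246_primitive3: "coeff_e3 2 4 6 (\<lambda>x. primitive3 (\<lambda>i. coframe i x) A B C D E F G H I
  J K L M N) = H"
proof -
  have "coframe i 0 [axis j 1] = (if i = j then 1 else 0)" for i j
    by (auto simp: coframe_def axis_def)
  then show ?thesis
    unfolding coeff_e3_def primitive3_expand
    by (simp add: form_scale_apply wedge_apply_Cons[OF coframe_one_form]
        exterior_ring interior_linear interior_zero coframe_sort(5,6))
qed

lemma minus_two_times_eq_0: "- 2 * h = 0 \<longleftrightarrow> h = 0" for h :: real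
  by simp

lemma integrable_primitive3_iff:
  "integrable_form (\<lambda>x. primitive3 (\<lambda>i. coframe i x) A B C D E F G H I J K L M N) \<longleftrightarrow>
     H = 0 \<and> J = 0 \<and> L = 0 \<and> N = 0"
  by (simp add: integrable_form_def primitive3_closed_iff)

lemma stationary_primitive3_iff:
  "stationary_IIA nil_omega (\<lambda>x. primitive3 (\<lambda>i. coframe i x) A B C D E F G H I J K L M N) \<longleftrightarrow>
     F_hat_H A B C D E F G H I J K L M N = 0"
proof -
  obtain a b c d e f g i k m where *: "F_field nil_omega (\<lambda>x. primitive3 (\<lambda>i. coframe i x) A B C
    D E F G H I J K L M N) =
      (\<lambda>x. primitive3 (\<lambda>i. coframe i x) a b c d e f g
        (- 2 * F_hat_H A B C D E F G H I J K L M N)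
        i
        (- 2 * F_hat_J A B C D E F G H I J K L M N)
        k
        (- 2 * F_hat_L A B C D E F G H I J K L M N)
        m
        (- 2 * F_hat_N A B C D E F G H I J K L M N))"
    by (rule F_field_primitive3)
  show ?thesis unfolding stationary_iff_F_field_coefficient[OF *] minus_two_times_eq_0
    by (rule refl)
qed

lemma F_field_246_coefficient:
  assumes "\<phi> = (\<lambda>x. primitive3 (\<lambda>i. coframe i x) A B C D E F G H I J K L M N)"
  shows "coeff_e3 2 4 6 (\<lambda>x. (- 1/2) *\<^sub>F F_field nil_omega \<phi> x) =
    F_hat_H A B C D E F G H I J K L M N"
proof -
  obtain a b c d e f g i k m where *: "F_field nil_omega (\<lambda>x. primitive3 (\<lambda>i. coframe i x) A B C
    D E F G H I J K L M N) =
      (\<lambda>x. primitive3 (\<lambda>i. coframe i x) a b c d e f g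
        (- 2 * F_hat_H A B C D E F G H I J K L M N)
        i
        (- 2 * F_hat_J A B C D E F G H I J K L M N)
        k
        (- 2 * F_hat_L A B C D E F G H I J K L M N)
        m
        (- 2 * F_hat_N A B C D E F G H I J K L M N))"
    by (rule F_field_primitive3)
  have half: "coeff_e3 2 4 6 (\<lambda>x. (- 1/2) *\<^sub>F F_field nil_omega \<phi> x) = h"
    if "coeff_e3 2 4 6 (F_field nil_omega \<phi>) = - 2 * h" for h
    using that by (simp add: coeff_e3_def form_scale_apply)
  show ?thesis by (rule half) (simp only: assms * coeff_246_primitive3)
qed

lemma F_integrable_primitive3_iff:
  "F_integrable_form nil_omega (\<lambda>x. primitive3 (\<lambda>i. coframe i x) A B C D E F G H I J K L M N) \<longleftrightarrow>
     F_hat_H A B C D E F G H I J K L M N = 0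
   \<and> F_hat_J A B C D E F G H I J K L M N = 0
   \<and> F_hat_L A B C D E F G H I J K L M N = 0
   \<and> F_hat_N A B C D E F G H I J K L M N = 0"
proof -
  obtain a b c d e f g i k m where *: "F_field nil_omega (\<lambda>x. primitive3 (\<lambda>i. coframe i x) A B C
    D E F G H I J K L M N) =
      (\<lambda>x. primitive3 (\<lambda>i. coframe i x) a b c d e f g
        (- 2 * F_hat_H A B C D E F G H I J K L M N)
        i
        (- 2 * F_hat_J A B C D E F G H I J K L M N)
        k
        (- 2 * F_hat_L A B C D E F G H I J K L M N)
        m
        (- 2 * F_hat_N A B C D E F G H I J K L M N))"
    by (rule F_field_primitive3)
  show ?thesis
    unfolding F_integrable_form_def * primitive3_closed_iff minus_two_times_eq_0 by (rule refl)
qed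

lemma F_integrable_closed_primitive3_iff:
  "F_integrable_form nil_omega (\<lambda>x. primitive3 (\<lambda>i. coframe i x) A B C D E F G 0 I 0 K 0 M 0) \<longleftrightarrow>
     D * F * G = 0 \<and> D * K * G = 0 \<and> D * F * M = 0 \<and> I * F * G = 0"
  unfolding F_integrable_primitive3_iff F_hat_defs by auto

text \<open>
  If one of \<open>D\<close>, \<open>F\<close>, \<open>G\<close> vanishes, the expression is the square of a difference.
\<close>

lemma quartic_nonneg:
  fixes B C D E F G :: real
  assumes "D * F * G = 0"
  shows "2 * (B\<^sup>2 * G\<^sup>2 + C\<^sup>2 * F\<^sup>2 + D\<^sup>2 * E\<^sup>2) - (B * G + C * F + D * E)\<^sup>2 \<ge> 0"
proof -
  have sq: "2 * (a\<^sup>2 + b\<^sup>2) - (a + b)\<^sup>2 \<ge> 0" for a b :: real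
    using zero_le_power2[of "a - b"] by (simp add: power2_eq_square algebra_simps)
  consider "D = 0" | "F = 0" | "G = 0" using assms by auto
  then show ?thesis
    using sq[of "B * G" "C * F"] sq[of "B * G" "D * E"] sq[of "C * F" "D * E"]
    by cases (simp_all add: power_mult_distrib)
qed

theorem proposition5p3:
  fixes A B C D E F G H I J K L M N :: real
    and \<phi> :: "(real^6) dform"
    and H_hat :: real
  assumes "invariant_primitive_3form \<phi>"
    and "\<phi> = (\<lambda>x.
        A *\<^sub>F e3 1 3 5 x + B *\<^sub>F e3 1 3 6 x + C *\<^sub>F e3 1 4 5 x + D *\<^sub>F e3 1 4 6 x
      + E *\<^sub>F e3 2 3 5 x + F *\<^sub>F e3 2 3 6 x + G *\<^sub>F e3 2 4 5 x + H *\<^sub>F e3 2 4 6 x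
      + (I *\<^sub>F coframe 1 x + J *\<^sub>F coframe 2 x) \<^bold>\<and> (e2 3 4 x - e2 5 6 x)
      + (K *\<^sub>F coframe 3 x + L *\<^sub>F coframe 4 x) \<^bold>\<and> (e2 1 2 x - e2 5 6 x)
      + (M *\<^sub>F coframe 5 x + N *\<^sub>F coframe 6 x) \<^bold>\<and> (e2 1 2 x - e2 3 4 x))"
    and "H_hat = coeff_e3 2 4 6 (\<lambda>x. (- 1/2) *\<^sub>F F_field nil_omega \<phi> x)"
  shows
    \<comment> \<open>1\<close>
    "(integrable_form \<phi> \<longleftrightarrow> H = 0 \<and> J = 0 \<and> L = 0 \<and> N = 0)
    \<and>
    \<comment> \<open>2\<close>
    (stationary_IIA nil_omega \<phi> \<longleftrightarrow> H_hat = 0)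
    \<and>
    \<comment> \<open>3\<close>
    ((integrable_form \<phi> \<and> stationary_IIA nil_omega \<phi> \<longleftrightarrow>
        H = 0 \<and> J = 0 \<and> L = 0 \<and> N = 0 \<and> H_hat = - 2 * D * F * G \<and> - 2 * D * F * G = 0)
     \<and> (H = 0 \<and> J = 0 \<and> L = 0 \<and> N = 0 \<longrightarrow> H_hat = - 2 * D * F * G)
     \<and> (integrable_form \<phi> \<and> stationary_IIA nil_omega \<phi> \<longrightarrow>
          (\<forall>x. Q_num (nil_omega x) (\<phi> x) / 4 =
             2 * (B\<^sup>2 * G\<^sup>2 + C\<^sup>2 * F\<^sup>2 + D\<^sup>2 * E\<^sup>2) - (B * G + C * F + D * E)\<^sup>2
             + 4 * (I\<^sup>2 * F * G + K\<^sup>2 * D * G + M\<^sup>2 * D * F)))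
     \<and> (\<forall>\<sigma>\<in>{- 1, 0, 1}. \<exists>\<psi>. invariant_primitive_3form \<psi>
          \<and> integrable_form \<psi> \<and> stationary_IIA nil_omega \<psi>
          \<and> (\<forall>x. sgn (Q_num (nil_omega x) (\<psi> x)) = \<sigma>))
     \<and> (integrable_form \<phi> \<and> stationary_IIA nil_omega \<phi>
          \<and> (\<forall>x. Q_num (nil_omega x) (\<phi> x) < 0) \<longrightarrow>
            (\<exists>\<mu>>0. \<forall>x. \<phi> x \<in> O_minus (nil_omega x) (- 1) \<mu>)
          \<and> (\<forall>x. has_signature (q_metric (nil_omega x) (\<phi> x)) 2 4)))
    \<and>
    \<comment> \<open>4\<close>
    ((integrable_form \<phi> \<and> F_integrable_form nil_omega \<phi> \<longleftrightarrow>
        H = 0 \<and> J = 0 \<and> L = 0 \<and> N = 0 \<and>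
        D * F * G = 0 \<and> D * K * G = 0 \<and> D * F * M = 0 \<and> I * F * G = 0)
     \<and> (integrable_form \<phi> \<and> F_integrable_form nil_omega \<phi> \<longrightarrow>
          (\<forall>x. Q_num (nil_omega x) (\<phi> x) / 4 =
             2 * (B\<^sup>2 * G\<^sup>2 + C\<^sup>2 * F\<^sup>2 + D\<^sup>2 * E\<^sup>2) - (B * G + C * F + D * E)\<^sup>2)
          \<and> 2 * (B\<^sup>2 * G\<^sup>2 + C\<^sup>2 * F\<^sup>2 + D\<^sup>2 * E\<^sup>2) - (B * G + C * F + D * E)\<^sup>2 \<ge> 0)
     \<and> (let realised = (\<lambda>orb. \<exists>\<psi>. invariant_primitive_3form \<psi>
            \<and> integrable_form \<psi> \<and> F_integrable_form nil_omega \<psi>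
            \<and> (\<forall>x. \<psi> x \<in> orb (nil_omega x)))
        in (\<forall>\<mu>>0. realised (\<lambda>\<omega>. O_plus \<omega> \<mu>))
          \<and> (\<forall>s\<in>{1, - 1}. realised (\<lambda>\<omega>. O_0 \<omega> s))
          \<and> (\<forall>s\<in>{1, - 1}. realised (\<lambda>\<omega>. O_1 \<omega> s))
          \<and> realised O_3
          \<and> realised (\<lambda>\<omega>. O_6))
     \<and> (\<exists>\<Gamma>. cocompact_discrete_subgroup \<Gamma>)
     \<and> (\<forall>\<Gamma>. cocompact_discrete_subgroup \<Gamma> \<longrightarrow>
          (\<exists>\<omega> \<psi>. form_on_quotient \<Gamma> \<omega> \<and> form_on_quotient \<Gamma> \<psi> \<and> para_Kaehler_CY \<omega> \<psi>)))"
proof -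
  let ?P = "\<lambda>x. primitive3 (\<lambda>i. coframe i x) A B C D E F G H I J K L M N"
  have \<phi>: "\<phi> = ?P"
    unfolding assms(2) primitive3_def triple_def e3_def e2_def by (rule refl)
  have hat: "H_hat = F_hat_H A B C D E F G H I J K L M N"
    unfolding assms(3) by (rule F_field_246_coefficient[OF \<phi>])
  have int: "integrable_form \<phi> \<longleftrightarrow> H = 0 \<and> J = 0 \<and> L = 0 \<and> N = 0"
    unfolding \<phi> by (rule integrable_primitive3_iff)
  have stat: "stationary_IIA nil_omega \<phi> \<longleftrightarrow> H_hat = 0"
    unfolding hat \<phi> by (rule stationary_primitive3_iff)
  have hat0: "H_hat = - 2 * D * F * G" if "H = 0 \<and> J = 0 \<and> L = 0 \<and> N = 0"
    using that by (simp add: hat F_hat_H_def)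
  have Q: "Q_num (nil_omega x) (\<phi> x) / 4 =
        2 * (B\<^sup>2 * G\<^sup>2 + C\<^sup>2 * F\<^sup>2 + D\<^sup>2 * E\<^sup>2) - (B * G + C * F + D * E)\<^sup>2
        + 4 * (I\<^sup>2 * F * G + K\<^sup>2 * D * G + M\<^sup>2 * D * F)"
    if "integrable_form \<phi>" "D * F * G = 0" for x
  proof -
    have z: "H = 0" "J = 0" "L = 0" "N = 0" using that(1) int by auto
    have zero: "4 * A * D * F * G = 0" using that(2) by auto
    show ?thesis
      unfolding \<phi> z Q_num_reduced[OF symplectic_coframe_coframe] zero by simp
  qed
  have Fint: "integrable_form \<phi> \<and> F_integrable_form nil_omega \<phi> \<longleftrightarrow>
      H = 0 \<and> J = 0 \<and> L = 0 \<and> N = 0 \<and>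
      D * F * G = 0 \<and> D * K * G = 0 \<and> D * F * M = 0 \<and> I * F * G = 0"
  proof (cases "H = 0 \<and> J = 0 \<and> L = 0 \<and> N = 0")
    case True
    then have z: "H = 0" "J = 0" "L = 0" "N = 0" by simp_all
    have "F_integrable_form nil_omega \<phi> \<longleftrightarrow>
        D * F * G = 0 \<and> D * K * G = 0 \<and> D * F * M = 0 \<and> I * F * G = 0"
      unfolding \<phi> z by (rule F_integrable_closed_primitive3_iff)
    with int True show ?thesis by blast
  next
    case False
    with int show ?thesis by blast
  qed
  note frame = symplectic_coframe_coframe
  have signs: "\<exists>\<psi>. invariant_primitive_3form \<psi> \<and> integrable_form \<psi> \<and> stationary_IIA nil_omega \<psi>
      \<and> (\<forall>x. sgn (Q_num (nil_omega x) (\<psi> x)) = \<sigma>)" if "\<sigma> \<in> {- 1, 0, 1}" for \<sigma> :: real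
  proof -
    \<comment> \<open>With \<open>D = 0\<close>, a negative value needs \<open>F G < 0\<close> and \<open>I \<noteq> 0\<close>, and \<open>e\<^sup>1\<^sup>3\<^sup>6 - e\<^sup>2\<^sup>4\<^sup>5\<close> is a positive example.\<close>
    have "\<exists>B F G I. F * G * (0::real) = 0 \<and> sgn (4 * (2 * (B\<^sup>2 * G\<^sup>2) - (B * G)\<^sup>2
      + 4 * (I\<^sup>2 * F * G))) = \<sigma>"
      using that
    proof (elim insertE emptyE)
      assume "\<sigma> = - 1"
      then show ?thesis by (intro exI[of _ 0] exI[of _ 1] exI[of _ "- 1"]) simp
    next
      assume "\<sigma> = 0"
      then show ?thesis by (intro exI[of _ 0]) simp
    next
      assume "\<sigma> = 1"
      then show ?thesis
        by (intro exI[of _ 1] exI[of _ 0] exI[of _ "- 1"] exI[of _ 0]) (simp add: power2_eq_square)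
    qed
    then obtain B F G I :: real
      where q: "sgn (4 * (2 * (B\<^sup>2 * G\<^sup>2) - (B * G)\<^sup>2 + 4 * (I\<^sup>2 * F * G))) = \<sigma>" by blast
    let ?\<psi> = "\<lambda>x. primitive3 (\<lambda>i. coframe i x) 0 B 0 0 0 F G 0 I 0 0 0 0 0"
    have "sgn (Q_num (nil_omega x) (?\<psi> x)) = \<sigma>" for x
      using q by (simp add: Q_num_reduced[OF frame])
    then show ?thesis
      by (intro exI[of _ ?\<psi>])
        (simp add: invariant_primitive3 integrable_primitive3_iff stationary_primitive3_iff
          F_hat_H_def)
  qed
  have neg: "(\<exists>\<mu>>0. \<forall>x. \<phi> x \<in> O_minus (nil_omega x) (- 1) \<mu>) \<and>
      (\<forall>x. has_signature (q_metric (nil_omega x) (\<phi> x)) 2 4)"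
    if *: "integrable_form \<phi>" "stationary_IIA nil_omega \<phi>" "\<forall>x. Q_num (nil_omega x) (\<phi> x) < 0"
  proof -
    have z: "H = 0" "J = 0" "L = 0" "N = 0" using * int by auto
    have DFG: "D * F * G = 0" using * stat hat0 z by simp
    have "2 * (B\<^sup>2 * G\<^sup>2 + C\<^sup>2 * F\<^sup>2 + D\<^sup>2 * E\<^sup>2) - (B * G + C * F + D * E)\<^sup>2
        + 4 * (I\<^sup>2 * F * G + K\<^sup>2 * D * G + M\<^sup>2 * D * F) < 0"
      using Q[OF *(1) DFG, of 0] *(3)[rule_format, of 0] by linarith
    from negative_type_exists[OF DFG this, of A] obtain \<mu> where \<mu>: "\<mu> > 0"
      and nt: "negative_type A B C D E F G I K M \<mu>" by blast
    have "\<phi> x \<in> O_minus (nil_omega x) (- 1) \<mu>" for x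
      using nt frame[of x] unfolding negative_type_def reduced3_def \<phi> z by blast
    with \<mu> signature_O_minus show ?thesis by blast
  qed
  define realised where "realised = (\<lambda>orb. \<exists>\<psi>. invariant_primitive_3form \<psi>
            \<and> integrable_form \<psi> \<and> F_integrable_form nil_omega \<psi>
            \<and> (\<forall>x. \<psi> x \<in> orb (nil_omega x)))"
  have realisedI: "realised orb"
    if "\<And>x. primitive3 (\<lambda>i. coframe i x) A B 0 0 0 F G 0 0 0 0 0 0 0 \<in> orb (nil_omega x)"
      for orb A B F G
    unfolding realised_def
    using that by (intro exI[of _ "\<lambda>x. primitive3 (\<lambda>i. coframe i x) A B 0 0 0 F G 0 0 0 0 0 0 0"])
      (simp add: invariant_primitive3 integrable_primitive3_iff F_integrable_closed_primitive3_iff)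
  have r_plus: "realised (\<lambda>\<omega>. O_plus \<omega> \<mu>)" for \<mu>
    by (rule realisedI[of 0 \<mu> 0 "- \<mu>"]) (rule O_plus_representative[OF frame])
  have r_0: "realised (\<lambda>\<omega>. O_0 \<omega> s)" for s
    by (rule realisedI[of 1 0 "- s" "- s"]) (rule O_0_representative[OF frame])
  have r_1: "realised (\<lambda>\<omega>. O_1 \<omega> s)" for s
    by (rule realisedI[of 1 0 0 "- s"]) (rule O_1_representative[OF frame])
  have r_3: "realised O_3"
    by (rule realisedI[of 1 0 0 0]) (rule O_3_representative[OF frame])
  have r_6: "realised (\<lambda>\<omega>. O_6)"
    by (rule realisedI[of 0 0 0 0]) (simp add: primitive3_zero O_6_def)
  have CY: "\<exists>\<omega> \<psi>. form_on_quotient \<Gamma> \<omega> \<and> form_on_quotient \<Gamma> \<psi> \<and> para_Kaehler_CY \<omega> \<psi>" for \<Gamma>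
  proof (intro exI conjI)
    let ?\<psi> = "\<lambda>x. primitive3 (\<lambda>i. coframe i x) 0 1 0 0 0 0 (- 1) 0 0 0 0 0 0 0"
    show "form_on_quotient \<Gamma> nil_omega" "form_on_quotient \<Gamma> ?\<psi>"
      using left_invariant_nil_omega left_invariant_primitive3
      by (simp_all add: form_on_quotient_def left_invariant_def)
    show "para_Kaehler_CY nil_omega ?\<psi>"
      unfolding para_Kaehler_CY_def integrable_primitive3_iff F_integrable_closed_primitive3_iff
    proof (intro conjI exI[of _ 1] allI symplectic_nil_omega smooth_primitive3)
      show "primitive_form nil_omega ?\<psi>"
        using invariant_primitive3 unfolding invariant_primitive_3form_def by blast
      show "?\<psi> x \<in> O_plus (nil_omega x) 1" for x by (rule O_plus_representative[OF frame])
    qed simp_all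
  qed
  have part3: "integrable_form \<phi> \<and> stationary_IIA nil_omega \<phi> \<longleftrightarrow>
        H = 0 \<and> J = 0 \<and> L = 0 \<and> N = 0 \<and> H_hat = - 2 * D * F * G \<and> - 2 * D * F * G = 0"
    using int stat hat0 by metis
  have DFG: "D * F * G = 0" if "integrable_form \<phi>" "stationary_IIA nil_omega \<phi>"
    using that int stat hat0 by simp
  have Q4: "Q_num (nil_omega x) (\<phi> x) / 4 =
        2 * (B\<^sup>2 * G\<^sup>2 + C\<^sup>2 * F\<^sup>2 + D\<^sup>2 * E\<^sup>2) - (B * G + C * F + D * E)\<^sup>2"
    if "integrable_form \<phi>" "F_integrable_form nil_omega \<phi>" for x
  proof -
    have *: "D * F * G = 0" "D * K * G = 0" "D * F * M = 0" "I * F * G = 0" using that Fint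
      by blast+
    have "I\<^sup>2 * F * G = I * (I * F * G)" "K\<^sup>2 * D * G = K * (D * K * G)" "M\<^sup>2 * D * F =
      M * (D * F * M)"
      by (simp_all add: power2_eq_square)
    then have "I\<^sup>2 * F * G + K\<^sup>2 * D * G + M\<^sup>2 * D * F = 0" by (simp only: *)
    then show ?thesis using Q[OF that(1) *(1), of x] by simp
  qed
  have nonneg: "2 * (B\<^sup>2 * G\<^sup>2 + C\<^sup>2 * F\<^sup>2 + D\<^sup>2 * E\<^sup>2) - (B * G + C * F + D * E)\<^sup>2 \<ge> 0"
    if "integrable_form \<phi>" "F_integrable_form nil_omega \<phi>"
    by (rule quartic_nonneg) (use that Fint in blast)
  show ?thesis
    unfolding Let_def realised_def[symmetric]
    by (intro conjI int stat part3 Fint impI allI ballI hat0 Q signs neg[THEN conjunct1]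
      neg[THEN conjunct2]
        Q4 nonneg r_plus r_0 r_1 r_3 r_6 CY exI[of _ integer_lattice] cocompact_integer_lattice;
        (elim conjE)?; blast intro: DFG)
qed

end
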